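(* Let $G$ be of type $C_n$, $\mathbf{i}_0=(1\,2\cdots n)^n$ and $c=(c^{(m)}_i)_{1\le i,m\le n}\in(\mathbb{C}^\times)^{n^2}$. For $b\in B(\Lambda_n)$ let $n(b):=\#\{v\in\mathcal{B}\mid \mathrm{Rect}(v)=b\}$. Then $$\Delta_{w_0s_n\Lambda_n,\Lambda_n}(\Theta^-_{\mathbf{i}_0}(c))=\sum_{b\in B(\Lambda_n)\setminus\{u_{\Lambda_n}\}}n(b)\cdot m^{(0)}_n(b),$$ where $u_{\Lambda_n}=[1,2,\dots,n-1,n]$ is the highest weight vector.
   Context: Group side. $G$ is the simply connected simple algebraic group over $\mathbb{C}$ of type $C_n$ ($n\ge2$), with Chevalley generators $e_i,f_i,h_i$ ($1\le i\le n$), simple roots $\alpha_i$, fundamental weights $\Lambda_i$, Cartan matrix $a_{ij}=\alpha_j(h_i)$: $a_{ii}=2$, $a_{n-1,n}=-2$, $a_{ij}=-1$ for other $|i-j|=1$, $0$ otherwise. $T$ is the maximal torus, $U^{\pm}$ the unipotent subgroups generated by $x_i(t)=\exp(te_i)$, resp. $y_i(t)=\exp(tf_i)$; $\alpha_i^\vee$ is the coroot one-parameter subgroup; $s_i$ are the simple reflections, $w_0$ the longest Weyl group element. $\overline{s}_i=x_i(-1)y_i(1)x_i(-1)$, $\overline{w}=\overline{s}_{i_1}\cdots\overline{s}_{i_l}$ for any reduced expression of $w$. $\Delta_{\Lambda_i}$ is the regular function on $G$ with $\Delta_{\Lambda_i}(u^-tu^+)=\Lambda_i(t)$, and $\Delta_{u\Lambda_i,v\Lambda_i}(g)=\Delta_{\Lambda_i}(\overline{u}^{-1}g\,\overline{v})$.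 With $\mathbf{y}_i(c)=y_i(c)\alpha_i^\vee(c^{-1})$, $\Theta^-_{\mathbf{i}_0}(c)=\prod_{m=1}^{n}\mathbf{y}_1(c^{(m)}_1)\cdots\mathbf{y}_n(c^{(m)}_n)$ (factors for $m=1,\dots,n$ from left to right). Combinatorial side. Order $1<2<\dots<n<\overline{n}<\dots<\overline{2}<\overline{1}$. $\mathcal{B}$ is the set of all strictly increasing sequences $v=[u_1,\dots,u_m,\overline{l_k},\overline{l_{k-1}},\dots,\overline{l_1}]$ of length $n$, i.e. $k+m=n$, $0\le m\le n$, $1\le u_1<\dots<u_m\le n$, $1\le l_1<\dots<l_k\le n$. $B(\Lambda_n)\subset\mathcal{B}$ is the subset of those $v$ such that $u_a=l_b=i$ implies $a+b\le i$; it is the underlying set of the crystal of the fundamental representation $V(\Lambda_n)$. For any sequence $v=[u_1,\dots,u_m,\overline{l_k},\dots,\overline{l_1}]$ with $k+m=n$ and all $u_a,l_b\in\{1,\dots,n\}$ put $$m^{(0)}_n(v)=C^{(1)}_{u_1}\cdots C^{(m)}_{u_m}\,\overline{C}^{(l_1-1)}_{l_1}\cdots\overline{C}^{(l_k-k)}_{l_k},\quad C^{(j)}_i=\frac{c^{(n-j)}_i}{c^{(n-j+1)}_{i-1}},\quad \overline{C}^{(j)}_i=\frac{c^{(n-j)}_{i-1}}{c^{(n-j)}_i},\quad c^{(r)}_0=1.$$ On $B(\Lambda_n)$ this is the crystal embedding of $B(\Lambda_n)$ into Nakajima's monomial crystal (for the sign $p_{i,j}=1$ if $i<j$, $0$ if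 $i>j$) sending $u_{\Lambda_n}$ to $c^{(0)}_n$; it is injective on $B(\Lambda_n)$. Rectification. A pair $(u_a,\overline{l_b})$ in $v$ with $u_a=l_b=i$ and $a+b=i+1$ is said to be in $(+1)$-configuration. Given $v$ having such pairs, take one for which $i$ is smallest; let $u_a,u_{a+1},\dots$ be $i,i+1,\dots,j$ with $j$ as large as possible (maximal consecutive run starting at position $a$), and let $l_b,l_{b+1},\dots$ be $i,i+1,\dots,k'$ with $k'$ as large as possible. The move replaces the run $i,\dots,j$ in the $u$'s by $k'+1,k'+2,\dots,k'+j-i+1$, and the run $i,\dots,k'$ in the $l$'s by $j+1,j+2,\dots,k'+j-i+1$ (same positions). (Intermediate sequences need not be increasing.) Starting from any $v\in\mathcal{B}$, a finite (possibly empty) sequence of such moves leads to an element of $B(\Lambda_n)$, and this element is unique; it is denoted $\mathrm{Rect}(v)$. The moves preserve $m_n^{(0)}$, so $\mathrm{Rect}(v)$ is equivalently the unique $b\in B(\Lambda_n)$ with $m^{(0)}_n(b)=m^{(0)}_n(v)$. *)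

theory Defs
  imports
    Complex_Main
    "HOL-Algebra.Generated_Groups"
    "Jordan_Normal_Form.Matrix"
begin

section \<open>The group of type $C_n$ and its generalized minors\<close>

text \<open>
  The simply connected group of type $C_n$ is realized as $Sp_{2n}$ on its vector representation
  with ordered basis $1 < \dots < n < \overline{n} < \dots < \overline{1}$.  Matrices are indexed
  from 0: the basis vector $j$ has index $j-1$ and $\overline{j}$ has index $2n-j$.
  The Chevalley generators are normalized by $f_i v_i = v_{i+1}$,
  $f_i v_{\overline{i+1}} = v_{\overline{i}}$ for $i<n$, and $f_n v_n = v_{\overline{n}}$; the
  alternating signs in the symplectic form are the ones for which these preserve it.
\<close>

definition symp_form :: "nat \<Rightarrow> complex mat" where
  "symp_form n = mat (2*n) (2*n) (\<lambda>(p, q). if p + q + 1 = 2*n then (-1) ^ p else 0)"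

definition Sp :: "nat \<Rightarrow> complex mat monoid" where
  "Sp n = \<lparr>carrier = {g \<in> carrier_mat (2*n) (2*n). transpose_mat g * symp_form n * g = symp_form n},
           monoid.mult = (*), one = 1\<^sub>m (2*n)\<rparr>"

text \<open>For $i = n$ the two positions in the following definition coincide.\<close>

definition chev_e :: "nat \<Rightarrow> nat \<Rightarrow> complex mat" where
  "chev_e n i = mat (2*n) (2*n)
     (\<lambda>(p, q). if (p, q) \<in> {(i - 1, i), (2*n - i - 1, 2*n - i)} then 1 else 0)"

definition chev_f :: "nat \<Rightarrow> nat \<Rightarrow> complex mat" where
  "chev_f n i = transpose_mat (chev_e n i)"

definition mat_exp :: "complex mat \<Rightarrow> complex mat" where
  "mat_exp A = mat (dim_row A) (dim_col A) (\<lambda>(p, q). \<Sum>k. (A ^\<^sub>m k) $$ (p, q) / fact k)"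

definition x_sub :: "nat \<Rightarrow> nat \<Rightarrow> complex \<Rightarrow> complex mat" where
  "x_sub n i t = mat_exp (t \<cdot>\<^sub>m chev_e n i)"

definition y_sub :: "nat \<Rightarrow> nat \<Rightarrow> complex \<Rightarrow> complex mat" where
  "y_sub n i t = mat_exp (t \<cdot>\<^sub>m chev_f n i)"

text \<open>The diagonal entries of $h_i = [e_i, f_i]$.\<close>

definition chev_h_diag :: "nat \<Rightarrow> nat \<Rightarrow> nat \<Rightarrow> int" where
  "chev_h_diag n i p =
     (if p \<in> {i - 1, 2*n - i - 1} then 1 else if p \<in> {i, 2*n - i} then -1 else 0)"

definition coroot :: "nat \<Rightarrow> nat \<Rightarrow> complex \<Rightarrow> complex mat" where
  "coroot n i t = mat (2*n) (2*n) (\<lambda>(p, q). if p = q then t powi chev_h_diag n i p else 0)"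

definition mprod :: "nat \<Rightarrow> complex mat list \<Rightarrow> complex mat" where
  "mprod n gs = foldr (*) gs (1\<^sub>m (2*n))"

definition U_plus :: "nat \<Rightarrow> complex mat set" where
  "U_plus n = generate (Sp n) {x_sub n i t |i t. 1 \<le> i \<and> i \<le> n}"

definition U_minus :: "nat \<Rightarrow> complex mat set" where
  "U_minus n = generate (Sp n) {y_sub n i t |i t. 1 \<le> i \<and> i \<le> n}"

text \<open>Simple connectedness: for \<open>a\<close> nonvanishing on $\{1,\dots,n\}$ these products are exactly the
  elements of the maximal torus $T$ of diagonal matrices, each for unique $a_1,\dots,a_n$.\<close>

definition torus_elt :: "nat \<Rightarrow> (nat \<Rightarrow> complex) \<Rightarrow> complex mat" where
  "torus_elt n a = mprod n (map (\<lambda>j. coroot n j (a j)) [1..<Suc n])"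

text \<open>\<open>Sp n\<close> is closed in the affine space of matrices, so its regular functions are the
  restrictions of the polynomials in the matrix entries.\<close>

inductive poly_fun :: "nat \<Rightarrow> (complex mat \<Rightarrow> complex) \<Rightarrow> bool" for n where
  const: "poly_fun n (\<lambda>_. z)"
| entry: "p < 2*n \<Longrightarrow> q < 2*n \<Longrightarrow> poly_fun n (\<lambda>g. g $$ (p, q))"
| add: "poly_fun n f \<Longrightarrow> poly_fun n h \<Longrightarrow> poly_fun n (\<lambda>g. f g + h g)"
| mult: "poly_fun n f \<Longrightarrow> poly_fun n h \<Longrightarrow> poly_fun n (\<lambda>g. f g * h g)"

definition regular_on_Sp :: "nat \<Rightarrow> (complex mat \<Rightarrow> complex) \<Rightarrow> bool" where
  "regular_on_Sp n f \<longleftrightarrow> (\<exists>P. poly_fun n P \<and> (\<forall>g \<in> carrier (Sp n). f g = P g))"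

text \<open>
  $\Delta_{\Lambda_i}$, with $\Delta_{\Lambda_i}(u^- t u^+) = \Lambda_i(t)$.  For
  $t = \prod_j \alpha_j^\vee(a_j)$ one has $\Lambda_i(t) = a_i$, because
  $\Lambda_i(h_j) = \delta_{ij}$.  The function is determined on \<open>carrier (Sp n)\<close> only; the
  choice operator fixes arbitrary values elsewhere.
\<close>

definition Delta :: "nat \<Rightarrow> nat \<Rightarrow> complex mat \<Rightarrow> complex" where
  "Delta n i = (SOME f. regular_on_Sp n f \<and>
     (\<forall>um \<in> U_minus n. \<forall>up \<in> U_plus n. \<forall>a. (\<forall>j \<in> {1..n}. a j \<noteq> 0) \<longrightarrow>
        f (um * torus_elt n a * up) = a i))"

text \<open>
  The Weyl group acts faithfully on the weight lattice.  A weight $\lambda$ is given by its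
  coordinates $\lambda(h_j)$, $1 \le j \le n$, i.e. its coefficients at the fundamental weights,
  and $s_i \lambda = \lambda - \lambda(h_i) \alpha_i$ with $\alpha_i(h_j) = a_{ji}$.
\<close>

definition cartan :: "nat \<Rightarrow> nat \<Rightarrow> nat \<Rightarrow> int" where
  "cartan n i j =
     (if i \<in> {1..n} \<and> j \<in> {1..n} then
        if i = j then 2
        else if i = n - 1 \<and> j = n then -2
        else if i + 1 = j \<or> j + 1 = i then -1
        else 0
      else 0)"

definition simple_refl :: "nat \<Rightarrow> nat \<Rightarrow> (nat \<Rightarrow> int) \<Rightarrow> (nat \<Rightarrow> int)" where
  "simple_refl n i wt = (\<lambda>j. wt j - wt i * cartan n j i)"

definition weyl_word :: "nat \<Rightarrow> nat list \<Rightarrow> (nat \<Rightarrow> int) \<Rightarrow> (nat \<Rightarrow> int)" where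
  "weyl_word n ws = foldr (\<lambda>i w. simple_refl n i \<circ> w) ws id"

definition weyl_group :: "nat \<Rightarrow> ((nat \<Rightarrow> int) \<Rightarrow> (nat \<Rightarrow> int)) set" where
  "weyl_group n = {weyl_word n ws |ws. set ws \<subseteq> {1..n}}"

definition weyl_length :: "nat \<Rightarrow> ((nat \<Rightarrow> int) \<Rightarrow> (nat \<Rightarrow> int)) \<Rightarrow> nat" where
  "weyl_length n w = (LEAST l. \<exists>ws. set ws \<subseteq> {1..n} \<and> weyl_word n ws = w \<and> length ws = l)"

definition reduced_expression ::
  "nat \<Rightarrow> nat list \<Rightarrow> ((nat \<Rightarrow> int) \<Rightarrow> (nat \<Rightarrow> int)) \<Rightarrow> bool" where
  "reduced_expression n ws w \<longleftrightarrow>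
     set ws \<subseteq> {1..n} \<and> weyl_word n ws = w \<and> length ws = weyl_length n w"

definition longest_elt :: "nat \<Rightarrow> (nat \<Rightarrow> int) \<Rightarrow> (nat \<Rightarrow> int)" where
  "longest_elt n = (ARG_MAX (weyl_length n) w. w \<in> weyl_group n)"

definition sbar :: "nat \<Rightarrow> nat \<Rightarrow> complex mat" where
  "sbar n i = x_sub n i (-1) * y_sub n i 1 * x_sub n i (-1)"

definition wbar :: "nat \<Rightarrow> nat list \<Rightarrow> complex mat" where
  "wbar n ws = mprod n (map (sbar n) ws)"

text \<open>$\Delta_{u\Lambda_i, v\Lambda_i}$, where \<open>us\<close> and \<open>vs\<close> are reduced expressions of $u$ and $v$.\<close>

definition gen_minor :: "nat \<Rightarrow> nat \<Rightarrow> nat list \<Rightarrow> nat list \<Rightarrow> complex mat \<Rightarrow> complex" where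
  "gen_minor n i us vs g = Delta n i (inv\<^bsub>Sp n\<^esub> (wbar n us) * g * wbar n vs)"

definition ybold :: "nat \<Rightarrow> nat \<Rightarrow> complex \<Rightarrow> complex mat" where
  "ybold n i t = y_sub n i t * coroot n i (inverse t)"

text \<open>Throughout, \<open>c m i\<close> is $c^{(m)}_i$.\<close>

definition Theta_minus :: "nat \<Rightarrow> (nat \<Rightarrow> nat \<Rightarrow> complex) \<Rightarrow> complex mat" where
  "Theta_minus n c =
     mprod n (concat (map (\<lambda>m. map (\<lambda>i. ybold n i (c m i)) [1..<Suc n]) [1..<Suc n]))"


section \<open>Sequences, monomials and rectification\<close>

text \<open>
  The sequence $[u_1,\dots,u_m,\overline{l_k},\dots,\overline{l_1}]$ is the pair
  $([u_1,\dots,u_m],[l_1,\dots,l_k])$; note the reversed order of the barred part.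
  Positions $a$, $b$ are counted from 1, hence the shifts in the list accesses.
\<close>

type_synonym bseq = "nat list \<times> nat list"

definition calB :: "nat \<Rightarrow> bseq set" where
  "calB n = {(us, ls). length us + length ls = n \<and> set us \<subseteq> {1..n} \<and> set ls \<subseteq> {1..n} \<and>
               sorted_wrt (<) us \<and> sorted_wrt (<) ls}"

definition B_Lambda :: "nat \<Rightarrow> bseq set" where
  "B_Lambda n = {(us, ls). (us, ls) \<in> calB n \<and>
     (\<forall>a \<in> {1..length us}. \<forall>b \<in> {1..length ls}.
        us ! (a - 1) = ls ! (b - 1) \<longrightarrow> a + b \<le> us ! (a - 1))}"

definition hw_seq :: "nat \<Rightarrow> bseq" where
  "hw_seq n = ([1..<Suc n], [])"

definition cval :: "(nat \<Rightarrow> nat \<Rightarrow> complex) \<Rightarrow> int \<Rightarrow> nat \<Rightarrow> complex" where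
  "cval c r i = (if i = 0 then 1 else c (nat r) i)"

definition C_mon :: "nat \<Rightarrow> (nat \<Rightarrow> nat \<Rightarrow> complex) \<Rightarrow> int \<Rightarrow> nat \<Rightarrow> complex" where
  "C_mon n c j i = cval c (int n - j) i / cval c (int n - j + 1) (i - 1)"

definition Cbar_mon :: "nat \<Rightarrow> (nat \<Rightarrow> nat \<Rightarrow> complex) \<Rightarrow> int \<Rightarrow> nat \<Rightarrow> complex" where
  "Cbar_mon n c j i = cval c (int n - j) (i - 1) / cval c (int n - j) i"

text \<open>On \<open>B_Lambda n\<close> only the $c^{(r)}_i$ with $1 \le r, i \le n$ occur, except that
  \<open>hw_seq n\<close> is sent to $c^{(0)}_n$.\<close>

definition mon0 :: "nat \<Rightarrow> (nat \<Rightarrow> nat \<Rightarrow> complex) \<Rightarrow> bseq \<Rightarrow> complex" where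
  "mon0 n c v = (case v of (us, ls) \<Rightarrow>
     (\<Prod>a = 1..length us. C_mon n c (int a) (us ! (a - 1))) *
     (\<Prod>b = 1..length ls. Cbar_mon n c (int (ls ! (b - 1)) - int b) (ls ! (b - 1))))"

definition plus_config :: "bseq \<Rightarrow> nat \<Rightarrow> nat \<Rightarrow> bool" where
  "plus_config v a b \<longleftrightarrow> (case v of (us, ls) \<Rightarrow>
     a \<in> {1..length us} \<and> b \<in> {1..length ls} \<and>
     us ! (a - 1) = ls ! (b - 1) \<and> a + b = us ! (a - 1) + 1)"

text \<open>The last value of the maximal run of consecutive integers starting at position \<open>a\<close>.\<close>

definition run_end :: "nat list \<Rightarrow> nat \<Rightarrow> nat" where
  "run_end xs a = (let i = xs ! (a - 1) in
     GREATEST j. i \<le> j \<and> take (j - i + 1) (drop (a - 1) xs) = [i..<j + 1])"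

definition overwrite :: "nat list \<Rightarrow> nat \<Rightarrow> nat list \<Rightarrow> nat list" where
  "overwrite xs a ys = take (a - 1) xs @ ys @ drop (a - 1 + length ys) xs"

inductive rect_move :: "bseq \<Rightarrow> bseq \<Rightarrow> bool" where
  "\<lbrakk>plus_config (us, ls) a b;
    \<forall>a' b'. plus_config (us, ls) a' b' \<longrightarrow> us ! (a - 1) \<le> us ! (a' - 1);
    i = us ! (a - 1); j = run_end us a; k = run_end ls b\<rbrakk>
   \<Longrightarrow> rect_move (us, ls)
        (overwrite us a [k + 1..<k + j - i + 2], overwrite ls b [j + 1..<k + j - i + 2])"

definition Rect :: "nat \<Rightarrow> bseq \<Rightarrow> bseq" where
  "Rect n v = (THE b. b \<in> B_Lambda n \<and> rect_move\<^sup>*\<^sup>* v b)"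

definition rect_mult :: "nat \<Rightarrow> bseq \<Rightarrow> nat" where
  "rect_mult n b = card {v \<in> calB n. Rect n v = b}"

end

(*
  Let S_m be the sum of C^(1)_{u_1} ... C^(m)_{u_m} over all u_1 < ... < u_m.  Both sides equal
  the sum of S_m^2 / c^(n-m)_n over m < n.

  Combinatorial side: replace the barred part of a sequence by the complement of its set of
  entries.  A sequence becomes a pair of m-element subsets of {1..n}, that is, a pair of lattice
  paths with common ends; its monomial is symmetric in the two paths, rectification replaces the
  pair by its pointwise maximum and minimum, and the elements of B(Lambda_n) are the ordered
  pairs.

  Group side: Delta_{Lambda_n} is the leading n x n minor, because two regular functions which
  agree on U^- T U^+ agree on all products of the generators.  Since a reduced word for w_0 s_n
  has only n - 1 letters n, the generalized minor is, with its sign, the minor of Theta in the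
  rows n, bar(n-1), ..., bar(1) and the columns 1, ..., n.  Each of the n groups of factors of
  Theta = Y_1 ... Y_n is block triangular with a lower left block of rank one, so the rows
  bar(1), ..., bar(n) of Theta in these columns form Z Q, where the rows of Q are the n-th rows
  q_r of Y_{r+1} ... Y_n.  The recursion of the S_m in n yields the two linear relations
  q_0 = sum_r (-1)^(r+1) S_{n-r} / c^(r)_n q_r and sum_r (-1)^(r+1) S_{n-r} z_r = e_n, which
  reduce the minor to det Z, and the invariance of the symplectic form gives det Z = +-1.
*)
theory Submission
  imports Defs "Jordan_Normal_Form.Determinant"
begin

section \<open>The Weyl group\<close>

text \<open>Three objects are given only by description, and each must be made independent of it.
  \<open>Delta\<close> is a choice; instead of using that the cell is dense in the group, one
  follows a single factor x_i(t): a polynomial function becomes a polynomial in t, and for small t a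
  cell element stays in the cell. \<open>Rect\<close> is the end of a chain of moves whose
  intermediate sequences need not increase; the set of cells fired in total turns out to depend on
  the initial sequence alone, so the order of the moves does not matter. The reduced word
  \<open>us\<close> is arbitrary, and the lifts of reflections do not square to 1; the braid
  relations are avoided by following one minor through the word, where only a letter n that removes
  a negative sign could leave a sign behind, and counting the letters n excludes such letters. The
  two linear relations have a common source: the sums over subsets of {1..k} satisfy a Pascal
  recursion in k, and the rows of the partial products, like truncations of the z_r, satisfy a
  recursion adjoint to it.\<close>

definition eps_coord :: "nat \<Rightarrow> (nat \<Rightarrow> int) \<Rightarrow> nat \<Rightarrow> int" where
  "eps_coord n wt a = (\<Sum>k = Suc a..n. wt k)"

text \<open>Since \<Lambda>_k = \<epsilon>_1 + ... + \<epsilon>_k, the tail sum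
  \<open>eps_coord n wt a\<close> is the coefficient of \<epsilon>_(a+1). In these coordinates the
  simple reflections become adjacent transpositions and the sign change of the last
  coordinate.\<close>

definition refl_act :: "nat \<Rightarrow> nat \<Rightarrow> (nat \<Rightarrow> int) \<Rightarrow> (nat \<Rightarrow> int)" where
  "refl_act n i \<mu> = (if i < n then \<mu> \<circ> transpose (i - 1) i else \<mu>(n - 1 := - \<mu> (n - 1)))"

definition word_act :: "nat \<Rightarrow> nat list \<Rightarrow> (nat \<Rightarrow> int) \<Rightarrow> (nat \<Rightarrow> int)" where
  "word_act n ws \<mu> = foldr (refl_act n) ws \<mu>"

lemma word_act_Nil [simp]: "word_act n [] \<mu> = \<mu>"
  and word_act_Cons [simp]: "word_act n (i # ws) \<mu> = refl_act n i (word_act n ws \<mu>)"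
  by (simp_all add: word_act_def)

lemma word_act_append: "word_act n (vs @ ws) \<mu> = word_act n vs (word_act n ws \<mu>)"
  by (simp add: word_act_def)

lemma weyl_word_Nil [simp]: "weyl_word n [] = id"
  and weyl_word_Cons [simp]: "weyl_word n (i # ws) = simple_refl n i \<circ> weyl_word n ws"
  by (simp_all add: weyl_word_def)

lemma weyl_word_append: "weyl_word n (vs @ ws) = weyl_word n vs \<circ> weyl_word n ws"
  by (induction vs) (auto simp: comp_assoc)

lemma eps_coord_Suc: "a < n \<Longrightarrow> eps_coord n wt a = wt (Suc a) + eps_coord n wt (Suc a)"
  unfolding eps_coord_def by (simp add: sum.atLeast_Suc_atMost)

lemma eps_coord_ge [simp]: "n \<le> a \<Longrightarrow> eps_coord n wt a = 0"
  unfolding eps_coord_def by simp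

lemma eps_coord_refl:
  assumes n: "n \<ge> 2" and i: "1 \<le> i" "i \<le> n" and "a < n"
  shows "eps_coord n (simple_refl n i wt) a = refl_act n i (eps_coord n wt) a"
proof -
  \<comment> \<open>The coordinates of -\<alpha>_i, as \<alpha>_i = \<epsilon>_i - \<epsilon>_(i+1)
    for i < n and \<alpha>_n = 2 \<epsilon>_n. The induction descends because the coordinates are
    tail sums.\<close>
  define d where "d a = (if i < n then (if a = i - 1 then -1 else if a = i then 1 else 0)
                    else (if a = n - 1 then -2 else 0) :: int)" for a
  have "b \<le> n \<Longrightarrow> eps_coord n (simple_refl n i wt) b = eps_coord n wt b + wt i * d b" for b
  proof (induction rule: inc_induct)
    case base
    then show ?case using n i by (auto simp: d_def)
  next
    case (step b)
    obtain j where j: "i = Suc j" using i by (cases i) auto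
    obtain N where N: "n = Suc N" using n by (cases n) auto
    have d: "d b = d (Suc b) - cartan n (Suc b) i"
      using n i step.hyps unfolding d_def cartan_def j N by (cases "j = N"; cases "b = j"; cases "b = Suc j") auto
    have "eps_coord n (simple_refl n i wt) b = wt (Suc b) - wt i * cartan n (Suc b) i
        + (eps_coord n wt (Suc b) + wt i * d (Suc b))"
      using step by (simp add: eps_coord_Suc simple_refl_def)
    also have "\<dots> = eps_coord n wt b + wt i * d b"
      using step.hyps unfolding d by (simp add: eps_coord_Suc[of b] algebra_simps)
    finally show ?case .
  qed
  then have 1: "eps_coord n (simple_refl n i wt) a = eps_coord n wt a + wt i * d a"
    using \<open>a < n\<close> by simp
  have 2: "eps_coord n wt (i - 1) = wt i + eps_coord n wt i"
    using eps_coord_Suc[of "i - 1" n wt] i by simp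
  show ?thesis unfolding 1 refl_act_def d_def using i 2 by (auto simp: transpose_def)
qed

lemma refl_act_cong:
  assumes "1 \<le> i" "i \<le> n" "\<And>a. a < n \<Longrightarrow> \<mu> a = \<nu> a" "a < n"
  shows "refl_act n i \<mu> a = refl_act n i \<nu> a"
  using assms by (auto simp: refl_act_def transpose_def)

lemma word_act_cong:
  assumes "set ws \<subseteq> {1..n}" "\<And>a. a < n \<Longrightarrow> \<mu> a = \<nu> a" "a < n"
  shows "word_act n ws \<mu> a = word_act n ws \<nu> a"
  using assms(1,3)
proof (induction ws arbitrary: a)
  case (Cons i ws)
  then show ?case by (auto intro!: refl_act_cong)
qed (use assms in auto)

lemma eps_coord_weyl_word:
  assumes n: "n \<ge> 2" and "set ws \<subseteq> {1..n}" and "a < n"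
  shows "eps_coord n (weyl_word n ws wt) a = word_act n ws (eps_coord n wt) a"
  using assms(2,3)
proof (induction ws arbitrary: a)
  case (Cons i ws)
  have "eps_coord n (weyl_word n (i # ws) wt) a = refl_act n i (eps_coord n (weyl_word n ws wt)) a"
    using Cons.prems n by (simp add: eps_coord_refl)
  also have "\<dots> = refl_act n i (word_act n ws (eps_coord n wt)) a"
    using Cons by (intro refl_act_cong) auto
  finally show ?case by simp
qed auto

lemma weyl_word_outside:
  assumes "set ws \<subseteq> {1..n}" "k \<notin> {1..n}"
  shows "weyl_word n ws wt k = wt k"
  using assms by (induction ws) (auto simp: simple_refl_def cartan_def)

text \<open>Weights are functions on all natural numbers, so equality is also needed at indices
  outside \<open>{1..n}\<close>, where every word is the identity. Inside, a weight is recovered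
  from the differences of consecutive \<epsilon>-coordinates.\<close>

lemma weyl_word_eqI:
  assumes n: "n \<ge> 2" and vs: "set vs \<subseteq> {1..n}" and ws: "set ws \<subseteq> {1..n}"
    and eq: "\<And>\<mu> a. a < n \<Longrightarrow> word_act n vs \<mu> a = word_act n ws \<mu> a"
  shows "weyl_word n vs = weyl_word n ws"
proof (intro ext)
  fix wt k
  show "weyl_word n vs wt k = weyl_word n ws wt k"
  proof (cases "k \<in> {1..n}")
    case True
    have e: "eps_coord n (weyl_word n vs wt) a = eps_coord n (weyl_word n ws wt) a" for a
      using eps_coord_weyl_word[OF n vs, of a wt] eps_coord_weyl_word[OF n ws, of a wt] eq
      by (cases "a < n") auto
    have "w k = eps_coord n w (k - 1) - eps_coord n w k" for w
      using eps_coord_Suc[of "k - 1" n w] True by (cases k) auto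
    then show ?thesis using e by metis
  qed (use weyl_word_outside vs ws in auto)
qed

section \<open>Signed permutations\<close>

definition signed_perm :: "nat \<Rightarrow> ((nat \<Rightarrow> int) \<Rightarrow> (nat \<Rightarrow> int)) \<Rightarrow> (nat \<Rightarrow> nat) \<Rightarrow> (nat \<Rightarrow> int) \<Rightarrow> bool" where
  "signed_perm n F \<pi> \<sigma> \<longleftrightarrow> \<pi> permutes {..<n} \<and> (\<forall>a. \<sigma> a \<in> {1, -1}) \<and>
     (\<forall>\<mu>. \<forall>a<n. F \<mu> a = \<sigma> a * \<mu> (\<pi> a))"

lemma word_act_signed_perm:
  assumes "set ws \<subseteq> {1..n}"
  shows "\<exists>\<pi> \<sigma>. signed_perm n (word_act n ws) \<pi> \<sigma>"
  using assms
proof (induction ws)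
  case Nil
  have "signed_perm n (word_act n []) id (\<lambda>_. 1)"
    by (auto simp: signed_perm_def permutes_id)
  then show ?case by blast
next
  case (Cons i ws)
  then obtain \<pi> \<sigma> where *: "signed_perm n (word_act n ws) \<pi> \<sigma>" and i: "1 \<le> i" "i \<le> n" by auto
  show ?case
  proof (cases "i < n")
    case True
    let ?t = "transpose (i - 1) i"
    have t: "?t permutes {..<n}" using True by (intro permutes_swap_id) auto
    have "?t a < n \<longleftrightarrow> a < n" for a using permutes_in_image[OF t] by simp
    moreover have "\<pi> \<circ> ?t permutes {..<n}"
      using * by (intro permutes_compose[OF t]) (simp add: signed_perm_def)
    ultimately have "signed_perm n (word_act n (i # ws)) (\<pi> \<circ> ?t) (\<sigma> \<circ> ?t)"
      using * True unfolding signed_perm_def by (simp add: refl_act_def)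
    then show ?thesis by blast
  next
    case False
    have "signed_perm n (word_act n (i # ws)) \<pi> (\<sigma>(n - 1 := - \<sigma> (n - 1)))"
      using * False unfolding signed_perm_def by (auto simp: refl_act_def)
    then show ?thesis by blast
  qed
qed

text \<open>The half-sum (n, ..., 1) of the positive roots in \<epsilon>-coordinates. Its n entries
  are distinct and positive, so a signed permutation is determined by the image of this one
  vector.\<close>

definition rho :: "nat \<Rightarrow> nat \<Rightarrow> int" where
  "rho n a = int n - int a"

lemma signed_perm_rho_eq:
  assumes F: "signed_perm n F \<pi> \<sigma>" and G: "signed_perm n G \<pi>' \<sigma>'"
    and eq: "\<And>a. a < n \<Longrightarrow> F (rho n) a = G (rho n) a" and a: "a < n"
  shows "F \<mu> a = G \<mu> a"
proof -
  have p: "\<pi> a < n" "\<pi>' a < n"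
    using F G a permutes_in_image[of _ "{..<n}" a] by (auto simp: signed_perm_def)
  have s: "\<sigma> a = 1 \<or> \<sigma> a = -1" "\<sigma>' a = 1 \<or> \<sigma>' a = -1"
    using F G by (auto simp: signed_perm_def)
  have "\<sigma> a * rho n (\<pi> a) = \<sigma>' a * rho n (\<pi>' a)"
    using F G eq[OF a] a by (auto simp: signed_perm_def)
  then have "\<sigma> a = \<sigma>' a \<and> \<pi> a = \<pi>' a"
    using s p by (auto simp: rho_def)
  then show ?thesis using F G a by (auto simp: signed_perm_def)
qed

section \<open>Inversions and the length function\<close>

definition num_neg :: "nat \<Rightarrow> (nat \<Rightarrow> int) \<Rightarrow> nat" where
  "num_neg n \<mu> = card {a. a < n \<and> \<mu> a < 0}"

definition short_pair :: "(nat \<Rightarrow> int) \<Rightarrow> nat \<times> nat \<Rightarrow> nat" where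
  "short_pair \<mu> = (\<lambda>(a, b). of_bool (\<mu> a < \<mu> b) + of_bool (\<mu> a + \<mu> b < 0))"

definition short_inv :: "nat \<Rightarrow> (nat \<Rightarrow> int) \<Rightarrow> nat" where
  "short_inv n \<mu> = (\<Sum>p \<in> {(a, b). a < b \<and> b < n}. short_pair \<mu> p)"

lemma finite_pairs [simp]: "finite {(a, b). a < b \<and> b < (n::nat)}"
  by (rule finite_subset[of _ "{..<n} \<times> {..<n}"]) auto

lemma num_neg_swap:
  assumes "1 \<le> i" "i < n"
  shows "num_neg n (refl_act n i \<mu>) = num_neg n \<mu>"
proof -
  define t where "t = transpose (i - 1) i"
  have t: "t a < n \<longleftrightarrow> a < n" for a using assms by (auto simp: t_def transpose_def)
  have tt: "t (t a) = a" for a by (simp add: t_def)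
  have "bij_betw t {a. a < n \<and> \<mu> (t a) < 0} {a. a < n \<and> \<mu> a < 0}"
    by (rule bij_betw_byWitness[where f' = t]) (use t tt in auto)
  then show ?thesis
    using assms bij_betw_same_card[of t] unfolding num_neg_def refl_act_def t_def by simp
qed

lemma num_neg_flip_pos:
  assumes "n \<ge> 1" "\<mu> (n - 1) > 0"
  shows "num_neg n (refl_act n n \<mu>) = num_neg n \<mu> + 1"
proof -
  have "{a. a < n \<and> refl_act n n \<mu> a < 0} = insert (n - 1) {a. a < n \<and> \<mu> a < 0}"
    using assms by (auto simp: refl_act_def)
  then show ?thesis using assms by (simp add: num_neg_def)
qed

lemma num_neg_flip_neg:
  assumes "n \<ge> 1" "\<mu> (n - 1) < 0"
  shows "num_neg n (refl_act n n \<mu>) + 1 = num_neg n \<mu>"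
proof -
  have "{a. a < n \<and> \<mu> a < 0} = insert (n - 1) {a. a < n \<and> refl_act n n \<mu> a < 0}"
    using assms by (auto simp: refl_act_def)
  then show ?thesis using assms by (simp add: num_neg_def refl_act_def)
qed

lemma short_inv_flip: "short_inv n (refl_act n n \<mu>) = short_inv n \<mu>"
  unfolding short_inv_def
  by (intro sum.cong) (auto simp: short_pair_def refl_act_def)

text \<open>The transposition permutes the pairs other than (i - 1, i) without reversing any of
  them, and the sum of the two entries at (i - 1, i) is symmetric; so only the comparison of these
  two entries changes. An \<open>of_bool\<close> on each side avoids subtracting natural
  numbers.\<close>

lemma short_inv_swap:
  assumes "1 \<le> i" "i < n"
  shows "short_inv n (refl_act n i \<mu>) + of_bool (\<mu> (i - 1) < \<mu> i)
       = short_inv n \<mu> + of_bool (\<mu> i < \<mu> (i - 1))"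
proof -
  let ?t = "transpose (i - 1) i"
  let ?P = "{(a, b). a < b \<and> b < n} - {(i - 1, i)}"
  have P: "{(a, b). a < b \<and> b < n} = insert (i - 1, i) ?P" using assms by auto
  have split: "short_inv n \<nu> = short_pair \<nu> (i - 1, i) + sum (short_pair \<nu>) ?P" for \<nu>
    unfolding short_inv_def by (subst P, subst sum.insert) auto
  have "(?t a, ?t b) \<in> ?P" if "(a, b) \<in> ?P" for a b
    using that assms unfolding transpose_def by (simp split: if_splits) (intro conjI impI; linarith)?
  then have tP: "map_prod ?t ?t p \<in> ?P" if "p \<in> ?P" for p
    using that by (cases p) (simp del: mem_Collect_eq Diff_iff)
  have "sum (short_pair (\<mu> \<circ> ?t)) ?P = sum (short_pair \<mu>) ?P"
  proof (rule sum.reindex_bij_witness[where i = "map_prod ?t ?t" and j = "map_prod ?t ?t"])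
    show "short_pair \<mu> (map_prod ?t ?t p) = short_pair (\<mu> \<circ> ?t) p" for p
      by (cases p) (simp add: short_pair_def)
    show "map_prod ?t ?t (map_prod ?t ?t p) = p" for p by (cases p) simp
    show "map_prod ?t ?t (map_prod ?t ?t p) = p" for p by (cases p) simp
  qed (fact tP)+
  then show ?thesis
    using assms unfolding split[of "refl_act n i \<mu>"] split[of \<mu>]
    by (auto simp: refl_act_def short_pair_def)
qed

text \<open>For \<mu> = w \<rho> this counts the positive roots that pair negatively with \<mu>: 2
  \<epsilon>_a in \<open>num_neg\<close>, and \<epsilon>_a - \<epsilon>_b, \<epsilon>_a +
  \<epsilon>_b with a < b in \<open>short_inv\<close>. The two counts stay separate because later
  the letters n of a word have to be counted on their own.\<close>

definition weyl_inv :: "nat \<Rightarrow> (nat \<Rightarrow> int) \<Rightarrow> nat" where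
  "weyl_inv n \<mu> = short_inv n \<mu> + num_neg n \<mu>"

lemma inv_cong:
  assumes "\<And>a. a < n \<Longrightarrow> \<mu> a = \<nu> a"
  shows "num_neg n \<mu> = num_neg n \<nu>" "short_inv n \<mu> = short_inv n \<nu>"
proof -
  show "num_neg n \<mu> = num_neg n \<nu>"
    unfolding num_neg_def using assms by (intro arg_cong[where f = card]) auto
  show "short_inv n \<mu> = short_inv n \<nu>"
    unfolding short_inv_def using assms by (intro sum.cong) (auto simp: short_pair_def)
qed

lemma inv_rho [simp]: "num_neg n (rho n) = 0" "short_inv n (rho n) = 0"
  by (auto simp: num_neg_def short_inv_def rho_def short_pair_def)

lemma num_neg_le: "num_neg n \<mu> \<le> n"
  unfolding num_neg_def using card_mono[of "{..<n}" "{a. a < n \<and> \<mu> a < 0}"] by auto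

lemma word_act_nonzero:
  assumes "set ws \<subseteq> {1..n}" "a < n"
  shows "word_act n ws (rho n) a \<noteq> 0"
proof -
  obtain \<pi> \<sigma> where *: "signed_perm n (word_act n ws) \<pi> \<sigma>" using word_act_signed_perm[OF assms(1)] by blast
  then have "\<sigma> a \<in> {1, -1}" "\<pi> a < n" "word_act n ws (rho n) a = \<sigma> a * rho n (\<pi> a)"
    using assms permutes_in_image[of \<pi> "{..<n}" a] by (auto simp: signed_perm_def)
  then show ?thesis by (auto simp: rho_def)
qed

text \<open>A letter \<open>n\<close> changes only \<^const>\<open>num_neg\<close>, the other letters only \<^const>\<open>short_inv\<close>.\<close>

lemma short_inv_le_word:
  assumes "set ws \<subseteq> {1..n}"
  shows "short_inv n (word_act n ws (rho n)) \<le> length (filter (\<lambda>i. i \<noteq> n) ws)"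
  using assms
proof (induction ws)
  case (Cons i ws)
  let ?\<mu> = "word_act n ws (rho n)"
  have i: "1 \<le> i" "i \<le> n" using Cons.prems by auto
  show ?case
  proof (cases "i = n")
    case False
    then have "short_inv n (refl_act n i ?\<mu>) \<le> short_inv n ?\<mu> + 1"
      using short_inv_swap[of i n ?\<mu>] i by (auto simp: of_bool_def split: if_splits)
    then show ?thesis using Cons False by simp
  qed (use Cons short_inv_flip in auto)
qed auto

lemma num_neg_le_word:
  assumes "set ws \<subseteq> {1..n}"
  shows "num_neg n (word_act n ws (rho n)) \<le> count_list ws n"
  using assms
proof (induction ws)
  case (Cons i ws)
  let ?\<mu> = "word_act n ws (rho n)"
  have i: "1 \<le> i" "i \<le> n" using Cons.prems by auto
  show ?case
  proof (cases "i = n")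
    case True
    then have "?\<mu> (n - 1) \<noteq> 0" using word_act_nonzero[of ws n "n - 1"] Cons.prems by auto
    then show ?thesis
      using Cons i True num_neg_flip_pos[of n ?\<mu>] num_neg_flip_neg[of n ?\<mu>]
      by (cases "?\<mu> (n - 1) > 0") auto
  qed (use Cons i num_neg_swap[of i n ?\<mu>] in auto)
qed auto

lemma count_list_filter_length: "length (filter (\<lambda>i. i \<noteq> n) ws) + count_list ws n = length ws"
  by (induction ws) auto

lemma weyl_inv_le_word:
  assumes "set ws \<subseteq> {1..n}"
  shows "weyl_inv n (word_act n ws (rho n)) \<le> length ws"
  using short_inv_le_word[OF assms] num_neg_le_word[OF assms] count_list_filter_length[of n ws]
  unfolding weyl_inv_def by linarith

text \<open>If no simple root pairs negatively with the image of \<rho>, its n entries decrease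
  strictly and stay positive. They lie between 1 and n, so counting up from the last and down from
  the first forces n, ..., 1.\<close>

lemma exists_descent:
  assumes n: "n \<ge> 1" and F: "signed_perm n F \<pi> \<sigma>"
    and ne: "\<exists>a<n. F (rho n) a \<noteq> rho n a"
  shows "(\<exists>i. 1 \<le> i \<and> i < n \<and> F (rho n) (i - 1) < F (rho n) i) \<or> F (rho n) (n - 1) < 0"
proof (rule ccontr)
  define m where "m = F (rho n)"
  assume "\<not> ?thesis"
  then have neg: "\<not> (\<exists>i. 1 \<le> i \<and> i < n \<and> m (i - 1) < m i)" "\<not> m (n - 1) < 0"
    by (auto simp: m_def)
  have pa: "\<pi> a < n" if "a < n" for a
    using F that permutes_in_image[of \<pi> "{..<n}" a] by (auto simp: signed_perm_def)
  have mu: "m a = rho n (\<pi> a) \<or> m a = - rho n (\<pi> a)" if "a < n" for a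
    using F that unfolding signed_perm_def m_def by force
  have dec: "m (Suc a) < m a" if "Suc a < n" for a
  proof -
    have "\<pi> a \<noteq> \<pi> (Suc a)"
      using F by (metis n_not_Suc_n permutes_inj injD signed_perm_def)
    then have "m (Suc a) \<noteq> m a"
      using mu[of a] mu[of "Suc a"] that pa[of a] pa[of "Suc a"] by (auto simp: rho_def)
    moreover have "\<not> m a < m (Suc a)" using neg(1) that by (auto dest: spec[of _ "Suc a"])
    ultimately show ?thesis by linarith
  qed
  have pos: "m (n - 1) \<ge> 1"
    using neg mu[of "n - 1"] pa[of "n - 1"] n by (auto simp: rho_def)
  have ge: "m a \<ge> rho n a" if "a \<le> n - 1" for a
    using that
  proof (induction rule: inc_induct)
    case base
    then show ?case using pos n by (simp add: rho_def)
  next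
    case (step b)
    then have "Suc b < n" by simp
    with step dec[of b] show ?case by (simp add: rho_def)
  qed
  have le: "a < n \<Longrightarrow> m a \<le> rho n a" for a
  proof (induction a)
    case 0
    then show ?case using mu[of 0] pa[of 0] by (auto simp: rho_def)
  next
    case (Suc a)
    then show ?case using dec[of a] by (simp add: rho_def)
  qed
  have "m a = rho n a" if "a < n" for a
    using ge[of a] le[of a] that by simp
  then show False using ne m_def by blast
qed

lemma weyl_inv_refl_neg:
  assumes n: "n \<ge> 1" and ws: "set ws \<subseteq> {1..n}"
    and ne: "\<exists>a<n. word_act n ws (rho n) a \<noteq> rho n a"
  shows "\<exists>i \<in> {1..n}. weyl_inv n (word_act n (i # ws) (rho n)) + 1 = weyl_inv n (word_act n ws (rho n))"
proof -
  let ?\<mu> = "word_act n ws (rho n)"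
  obtain \<pi> \<sigma> where sp: "signed_perm n (word_act n ws) \<pi> \<sigma>" using word_act_signed_perm[OF ws] by blast
  from exists_descent[OF n sp ne] show ?thesis
  proof (elim disjE exE)
    fix i assume i: "1 \<le> i \<and> i < n \<and> ?\<mu> (i - 1) < ?\<mu> i"
    then show ?thesis
      using short_inv_swap[of i n ?\<mu>] num_neg_swap[of i n ?\<mu>]
      by (intro bexI[of _ i]) (auto simp: weyl_inv_def)
  next
    assume "?\<mu> (n - 1) < 0"
    then show ?thesis
      using short_inv_flip[of n ?\<mu>] num_neg_flip_neg[of n ?\<mu>] n
      by (intro bexI[of _ n]) (auto simp: weyl_inv_def)
  qed
qed

text \<open>An ascent of w is a descent of -w, which is again a signed permutation, so
  \<open>exists_descent\<close> applies to it.\<close>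

lemma weyl_inv_refl_pos:
  assumes n: "n \<ge> 1" and ws: "set ws \<subseteq> {1..n}"
    and ne: "\<exists>a<n. word_act n ws (rho n) a \<noteq> - rho n a"
  shows "\<exists>i \<in> {1..n}. weyl_inv n (word_act n (i # ws) (rho n)) = weyl_inv n (word_act n ws (rho n)) + 1"
proof -
  let ?\<mu> = "word_act n ws (rho n)"
  let ?F = "\<lambda>\<mu> a. - word_act n ws \<mu> a"
  obtain \<pi> \<sigma> where sp: "signed_perm n (word_act n ws) \<pi> \<sigma>" using word_act_signed_perm[OF ws] by blast
  have "signed_perm n ?F \<pi> (\<lambda>a. - \<sigma> a)"
    using sp by (auto simp: signed_perm_def)
  from exists_descent[OF n this] ne
  have "(\<exists>i. 1 \<le> i \<and> i < n \<and> ?\<mu> (i - 1) > ?\<mu> i) \<or> ?\<mu> (n - 1) > 0" by force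
  then show ?thesis
  proof (elim disjE exE)
    fix i assume i: "1 \<le> i \<and> i < n \<and> ?\<mu> (i - 1) > ?\<mu> i"
    then show ?thesis
      using short_inv_swap[of i n ?\<mu>] num_neg_swap[of i n ?\<mu>]
      by (intro bexI[of _ i]) (auto simp: weyl_inv_def)
  next
    assume "?\<mu> (n - 1) > 0"
    then show ?thesis
      using short_inv_flip[of n ?\<mu>] num_neg_flip_pos[of n ?\<mu>] n
      by (intro bexI[of _ n]) (auto simp: weyl_inv_def)
  qed
qed

lemma refl_act_involution:
  assumes "1 \<le> i" "i \<le> n" shows "refl_act n i (refl_act n i \<mu>) = \<mu>"
  using assms by (auto simp: refl_act_def fun_eq_iff)

text \<open>Descents are removed one at a time, each at the cost of one letter. When none is left
  the word fixes \<rho>, hence acts as the identity.\<close>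

lemma exists_short_word:
  assumes n: "n \<ge> 2" and ws: "set ws \<subseteq> {1..n}"
  shows "\<exists>vs. set vs \<subseteq> {1..n} \<and> weyl_word n vs = weyl_word n ws \<and>
              length vs = weyl_inv n (word_act n ws (rho n))"
  using ws
proof (induction "weyl_inv n (word_act n ws (rho n))" arbitrary: ws rule: less_induct)
  case less
  show ?case
  proof (cases "\<exists>a<n. word_act n ws (rho n) a \<noteq> rho n a")
    case True
    then obtain i where i: "i \<in> {1..n}"
      and eq: "weyl_inv n (word_act n (i # ws) (rho n)) + 1 = weyl_inv n (word_act n ws (rho n))"
      using weyl_inv_refl_neg[of n ws] n less.prems by auto
    obtain vs where vs: "set vs \<subseteq> {1..n}" "weyl_word n vs = weyl_word n (i # ws)"
      "length vs = weyl_inv n (word_act n (i # ws) (rho n))"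
      using less.hyps[of "i # ws"] less.prems i eq by auto
    have "weyl_word n (i # i # ws) = weyl_word n ws"
      using i less.prems n by (intro weyl_word_eqI) (auto simp: refl_act_involution)
    then have "weyl_word n (i # vs) = weyl_word n ws" using vs(2) by simp
    then show ?thesis using vs i eq by (intro exI[of _ "i # vs"]) auto
  next
    case False
    obtain \<pi> \<sigma> where sp: "signed_perm n (word_act n ws) \<pi> \<sigma>"
      using word_act_signed_perm[OF less.prems] by blast
    have id: "signed_perm n (word_act n []) id (\<lambda>_. 1)"
      by (auto simp: signed_perm_def permutes_id)
    have "weyl_word n [] = weyl_word n ws"
      using less.prems n False signed_perm_rho_eq[OF id sp]
      by (intro weyl_word_eqI) auto
    moreover have "weyl_inv n (word_act n ws (rho n)) = weyl_inv n (rho n)"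
      unfolding weyl_inv_def using False inv_cong[of n "word_act n ws (rho n)" "rho n"] by auto
    ultimately show ?thesis by (intro exI[of _ "[]"]) (simp add: weyl_inv_def)
  qed
qed

text \<open>\<open>word_act\<close> is defined on words; this makes its value at \<rho> an invariant
  of the Weyl group element. The weight used is \<rho> written as the sum of all fundamental
  weights.\<close>

lemma weyl_word_act_eq:
  assumes "n \<ge> 2" "set vs \<subseteq> {1..n}" "set ws \<subseteq> {1..n}" "weyl_word n vs = weyl_word n ws" "a < n"
  shows "word_act n vs (rho n) a = word_act n ws (rho n) a"
proof -
  have "eps_coord n (\<lambda>_. 1) b = rho n b" if "b < n" for b
    using that by (simp add: eps_coord_def rho_def of_nat_diff)
  then have "word_act n us (rho n) a = eps_coord n (weyl_word n us (\<lambda>_. 1)) a"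
    if "set us \<subseteq> {1..n}" for us
    using assms that eps_coord_weyl_word[of n us a "\<lambda>_. 1"]
      word_act_cong[of us n "eps_coord n (\<lambda>_. 1)" "rho n" a] by auto
  then show ?thesis using assms by auto
qed

lemma weyl_length_eq:
  assumes n: "n \<ge> 2" and ws: "set ws \<subseteq> {1..n}"
  shows "weyl_length n (weyl_word n ws) = weyl_inv n (word_act n ws (rho n))"
  unfolding weyl_length_def
proof (rule Least_equality)
  show "\<exists>vs. set vs \<subseteq> {1..n} \<and> weyl_word n vs = weyl_word n ws \<and>
              length vs = weyl_inv n (word_act n ws (rho n))"
    using exists_short_word[OF assms] .
next
  fix l assume "\<exists>vs. set vs \<subseteq> {1..n} \<and> weyl_word n vs = weyl_word n ws \<and> length vs = l"
  then obtain vs where vs: "set vs \<subseteq> {1..n}" "weyl_word n vs = weyl_word n ws" "length vs = l" by blast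
  have "weyl_inv n (word_act n ws (rho n)) = weyl_inv n (word_act n vs (rho n))"
    unfolding weyl_inv_def
    using inv_cong[of n "word_act n ws (rho n)" "word_act n vs (rho n)"]
      weyl_word_act_eq[OF n vs(1) ws vs(2)] by auto
  then show "weyl_inv n (word_act n ws (rho n)) \<le> l"
    using weyl_inv_le_word[OF vs(1)] vs(3) by simp
qed

section \<open>The longest element and w_0 s_n\<close>

lemma weyl_inv_bound: "weyl_inv n \<mu> < 2 * card {(a, b). a < b \<and> b < n} + n + 1"
proof -
  have "short_inv n \<mu> \<le> of_nat (card {(a, b). a < b \<and> b < n}) * 2"
    unfolding short_inv_def by (rule sum_bounded_above) (auto simp: short_pair_def)
  then show ?thesis using num_neg_le[of n \<mu>] by (simp add: weyl_inv_def)
qed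

lemma longest_elt_word:
  assumes n: "n \<ge> 2"
  obtains ws where "set ws \<subseteq> {1..n}" "longest_elt n = weyl_word n ws"
    "\<And>\<mu> a. a < n \<Longrightarrow> word_act n ws \<mu> a = - \<mu> a"
proof -
  have "id \<in> weyl_group n" unfolding weyl_group_def by (auto intro!: exI[of _ "[]"])
  \<comment> \<open>\<open>ARG_MAX\<close> is attained only for bounded lengths; there are twice the
    number of pairs plus n positive roots, and the extra 1 makes the bound strict.\<close>
  moreover have "\<forall>w. w \<in> weyl_group n \<longrightarrow>
      weyl_length n w < 2 * card {(a, b). a < b \<and> b < n} + n + 1"
    unfolding weyl_group_def using weyl_inv_bound by (auto simp: weyl_length_eq[OF n])
  ultimately have "longest_elt n \<in> weyl_group n"
    and max: "\<And>w. w \<in> weyl_group n \<Longrightarrow> weyl_length n w \<le> weyl_length n (longest_elt n)"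
    using arg_max_nat_lemma[of "\<lambda>w. w \<in> weyl_group n" id "weyl_length n"]
    unfolding longest_elt_def by auto
  then obtain ws where ws: "set ws \<subseteq> {1..n}" "longest_elt n = weyl_word n ws"
    unfolding weyl_group_def by auto
  \<comment> \<open>Any other image of \<rho> would admit an ascent, that is, a longer element.
    Being -1 on \<rho>, the longest element is -1 everywhere.\<close>
  have rho: "word_act n ws (rho n) a = - rho n a" if "a < n" for a
  proof (rule ccontr)
    assume "\<not> ?thesis"
    with that obtain i where i: "i \<in> {1..n}"
      "weyl_inv n (word_act n (i # ws) (rho n)) = weyl_inv n (word_act n ws (rho n)) + 1"
      using weyl_inv_refl_pos[of n ws] n ws by fastforce
    have "weyl_word n (i # ws) \<in> weyl_group n"
      unfolding weyl_group_def using ws i by (intro CollectI exI[of _ "i # ws"]) auto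
    from max[OF this] show False
      using weyl_length_eq[OF n, of "i # ws"] weyl_length_eq[OF n, of ws] ws i by simp
  qed
  obtain \<pi> \<sigma> where sp: "signed_perm n (word_act n ws) \<pi> \<sigma>"
    using word_act_signed_perm[OF ws(1)] by blast
  have "signed_perm n (\<lambda>\<mu> a. - \<mu> a) id (\<lambda>_. -1)"
    by (auto simp: signed_perm_def permutes_id)
  from signed_perm_rho_eq[OF sp this] rho
  have "word_act n ws \<mu> a = - \<mu> a" if "a < n" for \<mu> a using that by auto
  then show ?thesis using that ws by blast
qed

lemma reduced_expression_w0_sn:
  assumes n: "n \<ge> 2" and red: "reduced_expression n us (longest_elt n \<circ> simple_refl n n)"
  shows "set us \<subseteq> {1..n}" "count_list us n \<le> n - 1"
    "\<And>a. a < n \<Longrightarrow> word_act n us (\<lambda>_. 1) a = (if a = n - 1 then 1 else -1)"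
proof -
  obtain ws where ws: "set ws \<subseteq> {1..n}" "longest_elt n = weyl_word n ws"
    and act: "\<And>\<mu> a. a < n \<Longrightarrow> word_act n ws \<mu> a = - \<mu> a"
    using longest_elt_word[OF n] by blast
  have w: "longest_elt n \<circ> simple_refl n n = weyl_word n (ws @ [n])"
    by (simp add: ws weyl_word_append)
  from red show us: "set us \<subseteq> {1..n}" by (simp add: reduced_expression_def)
  have eq: "weyl_word n us = weyl_word n (ws @ [n])"
    using red w by (simp add: reduced_expression_def)
  have ws': "set (ws @ [n]) \<subseteq> {1..n}" using ws n by auto
  have rho: "word_act n us (rho n) a = word_act n (ws @ [n]) (rho n) a" if "a < n" for a
    using weyl_word_act_eq[OF n us ws' eq that] .
  have act': "word_act n (ws @ [n]) \<mu> a = (if a = n - 1 then \<mu> a else - \<mu> a)" if "a < n" for \<mu> a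
    using that act by (simp add: word_act_append refl_act_def)
  obtain \<pi> \<sigma> where sp: "signed_perm n (word_act n us) \<pi> \<sigma>" using word_act_signed_perm[OF us] by blast
  obtain \<pi>' \<sigma>' where sp': "signed_perm n (word_act n (ws @ [n])) \<pi>' \<sigma>'"
    using word_act_signed_perm[OF ws'] by blast
  show "word_act n us (\<lambda>_. 1) a = (if a = n - 1 then 1 else -1)" if "a < n" for a
    using signed_perm_rho_eq[OF sp sp' rho that] act'[OF that] by auto
  have "length us = weyl_inv n (word_act n us (rho n))"
    using red eq w weyl_length_eq[OF n us] by (simp add: reduced_expression_def)
  \<comment> \<open>The letters other than n must account for all of \<open>short_inv\<close>, so at
    most \<open>num_neg\<close> of the length is left for the letter n.\<close>
  then have "count_list us n \<le> num_neg n (word_act n us (rho n))"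
    using short_inv_le_word[OF us] count_list_filter_length[of n us] by (simp add: weyl_inv_def)
  also have "{a. a < n \<and> word_act n us (rho n) a < 0} = {..<n - 1}"
    using rho act' n by (auto simp: rho_def split: if_splits)
  then have "num_neg n (word_act n us (rho n)) = n - 1"
    by (simp add: num_neg_def)
  finally show "count_list us n \<le> n - 1" .
qed

lemma reduced_expression_id:
  assumes "reduced_expression n vs id" shows "vs = []"
proof -
  have "weyl_length n id = 0"
    unfolding weyl_length_def by (rule Least_eq_0) (auto intro!: exI[of _ "[]"])
  then show ?thesis using assms by (simp add: reduced_expression_def)
qed

section \<open>Rectification\<close>

text \<open>
  A move with \<open>p + 1\<close> entries \<open>us\<close> from position \<open>a\<close> and \<open>q + 1\<close> entries \<open>ls\<close> from position \<open>b\<close>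
  raises the former by \<open>q + 1\<close> and the latter by \<open>p + 1\<close>: it fires the cells of the rectangle
  \<open>{a..a + p} \<times> {b..b + q}\<close>, where firing the cell \<open>(x, y)\<close> raises both entries, at positions
  \<open>x\<close> and \<open>y\<close>, from \<open>x + y - 1\<close> to \<open>x + y\<close>.  The last condition below says that the two entries
  of a cell agree about whether it has been fired.
\<close>

definition fired :: "nat list \<Rightarrow> nat list \<Rightarrow> nat \<Rightarrow> nat \<Rightarrow> bool" where
  "fired us us' a b \<longleftrightarrow> us ! (a - 1) < a + b \<and> a + b \<le> us' ! (a - 1)"

text \<open>The bound \<open>a + k\<close> keeps an entry at position a within the k columns, so
  that every unit by which it rises belongs to a cell.\<close>

definition raised :: "nat \<Rightarrow> nat list \<Rightarrow> nat list \<Rightarrow> bool" where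
  "raised k us us' \<longleftrightarrow> length us' = length us \<and>
     (\<forall>a \<in> {1..length us}. us ! (a - 1) \<le> us' ! (a - 1) \<and> us' ! (a - 1) \<le> a + k)"

definition reach :: "bseq \<Rightarrow> bseq \<Rightarrow> bool" where
  "reach v s = (case v of (us, ls) \<Rightarrow> case s of (us', ls') \<Rightarrow>
     raised (length ls) us us' \<and> raised (length us) ls ls' \<and>
     (\<forall>a \<in> {1..length us}. \<forall>b \<in> {1..length ls}. fired us us' a b = fired ls ls' b a))"

section \<open>Moves and the states they reach\<close>

lemma reach_raised:
  assumes "reach (us, ls) (us', ls')"
  shows "length us' = length us" "length ls' = length ls"
    "a < length us \<Longrightarrow> us ! a \<le> us' ! a" "a < length us \<Longrightarrow> us' ! a \<le> Suc a + length ls"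
proof -
  have r: "raised (length ls) us us'" "raised (length us) ls ls'"
    using assms by (auto simp: reach_def)
  then show "length us' = length us" "length ls' = length ls" by (simp_all add: raised_def)
  have "us ! (Suc a - 1) \<le> us' ! (Suc a - 1) \<and> us' ! (Suc a - 1) \<le> Suc a + length ls"
    if "a < length us"
    using r(1) that unfolding raised_def by (metis Suc_le_eq atLeastAtMost_iff le_add1 plus_1_eq_Suc)
  then show "a < length us \<Longrightarrow> us ! a \<le> us' ! a" "a < length us \<Longrightarrow> us' ! a \<le> Suc a + length ls"
    by auto
qed

lemma reach_swap: "reach (us, ls) (us', ls') \<longleftrightarrow> reach (ls, us) (ls', us')"
  unfolding reach_def by auto

lemma plus_config_swap: "plus_config (us, ls) a b \<longleftrightarrow> plus_config (ls, us) b a"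
  unfolding plus_config_def by auto

text \<open>The \<open>GREATEST\<close> exists because a run cannot be longer than the list.\<close>

lemma run_end_run:
  assumes a: "1 \<le> a" "a \<le> length xs"
  defines "i \<equiv> xs ! (a - 1)"
  shows "i \<le> run_end xs a" "a + (run_end xs a - i) \<le> length xs"
    "\<And>x. a \<le> x \<Longrightarrow> x \<le> a + (run_end xs a - i) \<Longrightarrow> xs ! (x - 1) + a = i + x"
proof -
  define P where "P j \<longleftrightarrow> i \<le> j \<and> take (j - i + 1) (drop (a - 1) xs) = [i..<j + 1]" for j
  have "P i" unfolding P_def i_def using a by (simp add: take_Suc_conv_app_nth)
  moreover have len: "a + (j - i) \<le> length xs" if "P j" for j
  proof -
    have "length (take (j - i + 1) (drop (a - 1) xs)) = j - i + 1"
      using that unfolding P_def by simp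
    then have "j - i + 1 \<le> length (drop (a - 1) xs)" by simp
    then show ?thesis using a by simp
  qed
  then have "\<And>j. P j \<Longrightarrow> j \<le> i + length xs" using P_def by fastforce
  ultimately have P: "P (Greatest P)" by (rule GreatestI_nat)
  have g: "run_end xs a = Greatest P"
    unfolding run_end_def P_def i_def by (simp add: Let_def)
  show "i \<le> run_end xs a" "a + (run_end xs a - i) \<le> length xs"
    using P len unfolding g P_def by auto
  fix x assume x: "a \<le> x" "x \<le> a + (run_end xs a - i)"
  have "take (run_end xs a - i + 1) (drop (a - 1) xs) ! (x - a) = [i..<run_end xs a + 1] ! (x - a)"
    using P unfolding g P_def by simp
  also have "\<dots> = i + (x - a)" using x \<open>i \<le> run_end xs a\<close> by (subst nth_upt) auto
  finally show "xs ! (x - 1) + a = i + x"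
    using x a by (simp add: nth_append)
qed

lemma overwrite_nth:
  assumes "1 \<le> a" "a - 1 + length ys \<le> length xs"
  shows "length (overwrite xs a ys) = length xs"
    "1 \<le> x \<Longrightarrow> x \<le> length xs \<Longrightarrow> overwrite xs a ys ! (x - 1) =
       (if a \<le> x \<and> x < a + length ys then ys ! (x - a) else xs ! (x - 1))"
  using assms by (auto simp: overwrite_def nth_append min_def)

text \<open>With p = j - i and q = k - i, the relation a + b = i + 1 eliminates i: the entry at
  position x of the first run rises from x + b - 1 to x + b + q, and the second run behaves in the
  same way with the roles exchanged. This is the firing of a rectangle.\<close>

lemma rect_move_cases:
  assumes "rect_move (us, ls) s"
  obtains a b p q us' ls' where "s = (us', ls')" "length us' = length us" "length ls' = length ls"
    "1 \<le> a" "1 \<le> b" "a + p \<le> length us" "b + q \<le> length ls"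
    "\<And>x. a \<le> x \<Longrightarrow> x \<le> a + p \<Longrightarrow> us ! (x - 1) + 1 = x + b \<and> us' ! (x - 1) = x + b + q"
    "\<And>y. b \<le> y \<Longrightarrow> y \<le> b + q \<Longrightarrow> ls ! (y - 1) + 1 = y + a \<and> ls' ! (y - 1) = y + a + p"
    "\<And>x. 1 \<le> x \<Longrightarrow> x \<le> length us \<Longrightarrow> x \<notin> {a..a + p} \<Longrightarrow> us' ! (x - 1) = us ! (x - 1)"
    "\<And>y. 1 \<le> y \<Longrightarrow> y \<le> length ls \<Longrightarrow> y \<notin> {b..b + q} \<Longrightarrow> ls' ! (y - 1) = ls ! (y - 1)"
  using assms
proof cases
  case (1 a b i j k)
  have ab: "1 \<le> a" "a \<le> length us" "1 \<le> b" "b \<le> length ls"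
    "us ! (a - 1) = i" "ls ! (b - 1) = i" "a + b = i + 1"
    using 1 by (auto simp: plus_config_def)
  note ru = run_end_run[OF ab(1,2), unfolded ab, folded 1(5)]
  note rl = run_end_run[OF ab(3,4), unfolded ab, folded 1(6)]
  define ys where "ys = [k + 1..<k + j - i + 2]"
  define zs where "zs = [j + 1..<k + j - i + 2]"
  have ys: "length ys = j - i + 1" "\<And>x. x < j - i + 1 \<Longrightarrow> ys ! x = k + 1 + x"
    using ru(1) rl(1) by (auto simp: ys_def nth_upt simp del: upt_Suc)
  have zs: "length zs = k - i + 1" "\<And>x. x < k - i + 1 \<Longrightarrow> zs ! x = j + 1 + x"
    using ru(1) rl(1) by (auto simp: zs_def nth_upt simp del: upt_Suc)
  have ly: "a - 1 + length ys \<le> length us" and lz: "b - 1 + length zs \<le> length ls"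
    using ru(2) rl(2) ab ys zs by auto
  note oy = overwrite_nth[OF ab(1) ly] and oz = overwrite_nth[OF ab(3) lz]
  show ?thesis
  proof (rule that[of "overwrite us a ys" "overwrite ls b zs" a b "j - i" "k - i"])
    show "s = (overwrite us a ys, overwrite ls b zs)" using 1 by (simp add: ys_def zs_def)
    show "us ! (x - 1) + 1 = x + b \<and> overwrite us a ys ! (x - 1) = x + b + (k - i)"
      if x: "a \<le> x" "x \<le> a + (j - i)" for x
    proof -
      have "us ! (x - 1) + 1 = x + b" using ru(3)[OF x] ab by simp
      moreover have "overwrite us a ys ! (x - 1) = ys ! (x - a)"
        using oy(2)[of x] x ru(2) ab(1) ys(1) by simp
      moreover have "ys ! (x - a) = k + 1 + (x - a)" using ys(2) x by simp
      moreover have "k + 1 + (x - a) = x + b + (k - i)" using x ab(7) rl(1) by arith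
      ultimately show ?thesis by simp
    qed
    show "ls ! (y - 1) + 1 = y + a \<and> overwrite ls b zs ! (y - 1) = y + a + (j - i)"
      if y: "b \<le> y" "y \<le> b + (k - i)" for y
    proof -
      have "ls ! (y - 1) + 1 = y + a" using rl(3)[OF y] ab by simp
      moreover have "overwrite ls b zs ! (y - 1) = zs ! (y - b)"
        using oz(2)[of y] y rl(2) ab(3) zs(1) by simp
      moreover have "zs ! (y - b) = j + 1 + (y - b)" using zs(2) y by simp
      moreover have "j + 1 + (y - b) = y + a + (j - i)" using y ab(7) ru(1) by arith
      ultimately show ?thesis by simp
    qed
  qed (use oy oz ys zs ru rl ab in auto)
qed

lemma rect_move_exists:
  assumes "plus_config s a b"
  shows "\<exists>t. rect_move s t"
proof -
  obtain us ls where s: "s = (us, ls)" by (cases s)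
  define Q where "Q x \<longleftrightarrow> (\<exists>a b. plus_config s a b \<and> us ! (a - 1) = x)" for x
  have "\<exists>x. Q x" using assms unfolding Q_def by blast
  then have "Q (LEAST x. Q x)" by (rule LeastI_ex)
  then obtain a b where ab: "plus_config s a b" "us ! (a - 1) = (LEAST x. Q x)"
    unfolding Q_def by blast
  have "\<forall>a' b'. plus_config (us, ls) a' b' \<longrightarrow> us ! (a - 1) \<le> us ! (a' - 1)"
    unfolding ab(2) s[symmetric] Q_def by (blast intro: Least_le)
  then show ?thesis
    using rect_move.intros[OF ab(1)[unfolded s] _ refl refl refl] s by blast
qed

text \<open>An entry in the run jumps exactly over the values that belong to the columns of the
  rectangle, so its cells in other columns keep their status; the same holds with rows and columns
  exchanged. Hence both entries of every cell still agree. The growing sum is the measure for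
  termination.\<close>

lemma reach_rect_move:
  assumes r: "reach v s" and m: "rect_move s t"
  shows "reach v t" "sum_list (fst s) < sum_list (fst t)"
proof -
  obtain us0 ls0 us ls where vs: "v = (us0, ls0)" "s = (us, ls)" by (cases v, cases s)
  from m[unfolded vs] obtain a b p q us' ls' where t: "t = (us', ls')"
    and len: "length us' = length us" "length ls' = length ls"
    and ab: "1 \<le> a" "1 \<le> b" "a + p \<le> length us" "b + q \<le> length ls"
    and x1: "\<And>x. a \<le> x \<Longrightarrow> x \<le> a + p \<Longrightarrow> us ! (x - 1) + 1 = x + b \<and> us' ! (x - 1) = x + b + q"
    and y1: "\<And>y. b \<le> y \<Longrightarrow> y \<le> b + q \<Longrightarrow> ls ! (y - 1) + 1 = y + a \<and> ls' ! (y - 1) = y + a + p"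
    and x2: "\<And>x. 1 \<le> x \<Longrightarrow> x \<le> length us \<Longrightarrow> x \<notin> {a..a + p} \<Longrightarrow> us' ! (x - 1) = us ! (x - 1)"
    and y2: "\<And>y. 1 \<le> y \<Longrightarrow> y \<le> length ls \<Longrightarrow> y \<notin> {b..b + q} \<Longrightarrow> ls' ! (y - 1) = ls ! (y - 1)"
    by (rule rect_move_cases) blast
  have len0: "length us = length us0" "length ls = length ls0"
    using r vs by (auto simp: reach_def raised_def)
  have ru: "us0 ! (x - 1) \<le> us ! (x - 1)" "us ! (x - 1) \<le> x + length ls0"
    if "1 \<le> x" "x \<le> length us" for x
    using r vs that by (auto simp: reach_def raised_def)
  have rl: "ls0 ! (y - 1) \<le> ls ! (y - 1)" "ls ! (y - 1) \<le> y + length us0"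
    if "1 \<le> y" "y \<le> length ls" for y
    using r vs that by (auto simp: reach_def raised_def)
  have le: "us ! (x - 1) \<le> us' ! (x - 1)" "us' ! (x - 1) \<le> x + length ls0"
    if "1 \<le> x" "x \<le> length us" for x
    using x1[of x] x2[of x] ru[of x] that len0 ab by (cases "x \<in> {a..a + p}"; force)+
  have le': "ls ! (y - 1) \<le> ls' ! (y - 1)" "ls' ! (y - 1) \<le> y + length us0"
    if "1 \<le> y" "y \<le> length ls" for y
    using y1[of y] y2[of y] rl[of y] that len0 ab by (cases "y \<in> {b..b + q}"; force)+
  have f: "fired us0 us' x y = fired ls0 ls' y x"
    if x: "1 \<le> x" "x \<le> length us" and y: "1 \<le> y" "y \<le> length ls" for x y
  proof -
    have *: "fired us0 us x y = fired ls0 ls y x"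
      using r vs x y len0 by (simp add: reach_def)
    show ?thesis
    proof (cases "x \<in> {a..a + p}"; cases "y \<in> {b..b + q}")
      assume "x \<in> {a..a + p}" "y \<in> {b..b + q}"
      then show ?thesis
        using x1[of x] y1[of y] ru(1)[OF x] rl(1)[OF y] by (auto simp: fired_def)
    next
      assume "x \<in> {a..a + p}" "y \<notin> {b..b + q}"
      moreover from this have "fired us0 us' x y = fired us0 us x y"
        using x1[of x] by (auto simp: fired_def)
      ultimately show ?thesis
        using * y2[of y] y by (simp add: fired_def)
    next
      assume "x \<notin> {a..a + p}" "y \<in> {b..b + q}"
      moreover from this have "fired ls0 ls' y x = fired ls0 ls y x"
        using y1[of y] by (auto simp: fired_def)
      ultimately show ?thesis
        using * x2[of x] x by (simp add: fired_def)
    next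
      assume "x \<notin> {a..a + p}" "y \<notin> {b..b + q}"
      then show ?thesis
        using * x2[of x] y2[of y] x y by (simp add: fired_def)
    qed
  qed
  have "raised (length ls0) us0 us'" "raised (length us0) ls0 ls'"
    using len len0 ru(1) rl(1) le le' unfolding raised_def
    by (metis atLeastAtMost_iff le_trans)+
  then show "reach v t"
    using f len0 unfolding reach_def vs t by simp
  have "(\<Sum>x<length us. us ! x) < (\<Sum>x<length us. us' ! x)"
  proof (rule sum_strict_mono_ex1)
    show "\<forall>x\<in>{..<length us}. us ! x \<le> us' ! x"
    proof
      fix x assume "x \<in> {..<length us}"
      then show "us ! x \<le> us' ! x" using le(1)[of "Suc x"] by simp
    qed
    show "\<exists>x\<in>{..<length us}. us ! x < us' ! x"
      using x1[of a] ab by (intro bexI[of _ "a - 1"]) auto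
  qed simp
  then show "sum_list (fst s) < sum_list (fst t)"
    using len by (simp add: vs t sum_list_sum_nth atLeast0LessThan)
qed

lemma reach_bound:
  assumes "reach v s"
  shows "sum_list (fst s) \<le> (\<Sum>x<length (fst v). Suc x + length (snd v))"
proof -
  obtain us0 ls0 us ls where vs: "v = (us0, ls0)" "s = (us, ls)" by (cases v, cases s)
  have "us ! x \<le> Suc x + length ls0" if "x < length us0" for x
    using assms that vs reach_raised by simp
  then have "(\<Sum>x<length us0. us ! x) \<le> (\<Sum>x<length us0. Suc x + length ls0)"
    by (intro sum_mono) auto
  moreover have "length us = length us0" using assms vs by (auto simp: reach_def raised_def)
  ultimately show ?thesis using vs by (simp add: sum_list_sum_nth atLeast0LessThan)
qed

lemma reach_rtranclp:
  assumes "rect_move\<^sup>*\<^sup>* s t" "reach v s"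
  shows "reach v t"
  using assms by (induction rule: rtranclp_induct) (auto intro: reach_rect_move)

text \<open>The sum of the unbarred entries grows with each move and is bounded by
  \<open>reach_bound\<close>.\<close>

lemma reach_terminal:
  assumes "reach v s"
  shows "\<exists>t. rect_move\<^sup>*\<^sup>* s t \<and> (\<forall>a b. \<not> plus_config t a b)"
  using assms
proof (induction "(\<Sum>x<length (fst v). Suc x + length (snd v)) - sum_list (fst s)"
    arbitrary: s rule: less_induct)
  case less
  show ?case
  proof (cases "\<exists>a b. plus_config s a b")
    case True
    then obtain s' where s': "rect_move s s'" using rect_move_exists by blast
    have r: "reach v s'" "sum_list (fst s) < sum_list (fst s')"
      using reach_rect_move[OF less.prems s'] by auto
    then obtain t where "rect_move\<^sup>*\<^sup>* s' t" "\<forall>a b. \<not> plus_config t a b"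
      using less.hyps[OF diff_less_mono2[OF r(2)] r(1)] reach_bound[OF r(1)] r(2) by auto
    then show ?thesis using s' by (meson converse_rtranclp_into_rtranclp)
  qed blast
qed

section \<open>Uniqueness of the end state\<close>

lemma sorted_list_ge:
  assumes "sorted_wrt (<) xs" "\<forall>x \<in> set xs. 1 \<le> x" "a < length xs"
  shows "Suc a \<le> xs ! a"
  using assms(3)
proof (induction a)
  case 0
  then show ?case using assms(2) by (auto simp: Suc_le_eq)
next
  case (Suc a)
  then show ?case using sorted_wrt_nth_less[OF assms(1), of a "Suc a"] by simp
qed

lemma sorted_list_le:
  assumes "sorted_wrt (<) xs" "\<forall>x \<in> set xs. x \<le> n" "a < length xs"
  shows "xs ! a + length xs \<le> n + Suc a"
proof -
  have "a \<le> length xs - 1" using assms(3) by simp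
  then show ?thesis
  proof (induction rule: inc_induct)
    case base
    then show ?case using assms(2,3) by (cases "length xs") (auto simp: nth_mem)
  next
    case (step a)
    then have "Suc a < length xs" by simp
    with step show ?case using sorted_wrt_nth_less[OF assms(1), of a "Suc a"] by simp
  qed
qed

lemma calB_bounds:
  assumes v: "(us, ls) \<in> calB n"
  shows "1 \<le> a \<Longrightarrow> a \<le> length us \<Longrightarrow> a \<le> us ! (a - 1)"
    "1 \<le> a \<Longrightarrow> a \<le> length us \<Longrightarrow> us ! (a - 1) \<le> a + length ls"
    "1 \<le> b \<Longrightarrow> b \<le> length ls \<Longrightarrow> b \<le> ls ! (b - 1)"
    "1 \<le> b \<Longrightarrow> b \<le> length ls \<Longrightarrow> ls ! (b - 1) \<le> b + length us"
proof -
  have su: "sorted_wrt (<) us" "\<forall>x \<in> set us. 1 \<le> x" "\<forall>x \<in> set us. x \<le> n"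
    and sl: "sorted_wrt (<) ls" "\<forall>x \<in> set ls. 1 \<le> x" "\<forall>x \<in> set ls. x \<le> n"
    and n: "length us + length ls = n"
    using v by (auto simp: calB_def)
  show "1 \<le> a \<Longrightarrow> a \<le> length us \<Longrightarrow> a \<le> us ! (a - 1)"
    using sorted_list_ge[OF su(1,2), of "a - 1"] by simp
  show "1 \<le> a \<Longrightarrow> a \<le> length us \<Longrightarrow> us ! (a - 1) \<le> a + length ls"
    using sorted_list_le[OF su(1,3), of "a - 1"] n by (cases a) simp_all
  show "1 \<le> b \<Longrightarrow> b \<le> length ls \<Longrightarrow> b \<le> ls ! (b - 1)"
    using sorted_list_ge[OF sl(1,2), of "b - 1"] by simp
  show "1 \<le> b \<Longrightarrow> b \<le> length ls \<Longrightarrow> ls ! (b - 1) \<le> b + length us"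
    using sorted_list_le[OF sl(1,3), of "b - 1"] n by (cases b) simp_all
qed

lemma reach_refl:
  assumes "v \<in> calB n" shows "reach v v"
  using assms calB_bounds by (cases v) (auto simp: reach_def raised_def fired_def)

text \<open>In a least counterexample the entries have passed all preceding cells of their row and
  column, so both stand at a + b - 1, which is a (+1)-configuration. Strict increase of the initial
  sequence carries the hypotheses over to the cells (a, b - 1) and (a - 1, b).\<close>

lemma terminal_fired:
  assumes r: "reach (us, ls) (us', ls')" and no: "\<And>a b. \<not> plus_config (us', ls') a b"
    and v: "(us, ls) \<in> calB n"
    and ab: "1 \<le> a" "a \<le> length us" "1 \<le> b" "b \<le> length ls"
    and u: "us ! (a - 1) < a + b" and l: "ls ! (b - 1) < a + b"
  shows "a + b \<le> us' ! (a - 1)"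
  using ab u l
proof (induction "a + b" arbitrary: a b rule: less_induct)
  case less
  have su: "sorted_wrt (<) us" "sorted_wrt (<) ls" using v by (auto simp: calB_def)
  have ge: "a \<le> us ! (a - 1)" "b \<le> ls ! (b - 1)"
    using calB_bounds[OF v] less.prems by auto
  have len: "length us' = length us" "length ls' = length ls"
    using r by (auto simp: reach_def raised_def)
  have le: "us ! (a - 1) \<le> us' ! (a - 1)" "ls ! (b - 1) \<le> ls' ! (b - 1)"
    using r less.prems by (auto simp: reach_def raised_def)
  have iff: "fired us us' a' b' = fired ls ls' b' a'"
    if "1 \<le> a'" "a' \<le> length us" "1 \<le> b'" "b' \<le> length ls" for a' b'
    using r that by (auto simp: reach_def)
  show ?case
  proof (rule ccontr)
    assume neg: "\<not> ?thesis"
    then have neg': "ls' ! (b - 1) < a + b"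
      using iff[of a b] less.prems by (auto simp: fired_def)
    have "a + b \<le> us' ! (a - 1) + 1"
    proof (cases "us ! (a - 1) + 1 = a + b")
      case False
      then have *: "us ! (a - 1) < a + (b - 1)" "2 \<le> b" using less.prems ge by auto
      then have "ls ! (b - 1 - 1) < ls ! (b - 1)"
        using sorted_wrt_nth_less[OF su(2), of "b - 1 - 1" "b - 1"] less.prems by auto
      then have "ls ! (b - 1 - 1) < a + (b - 1)" using less.prems(6) by linarith
      then have "a + (b - 1) \<le> us' ! (a - 1)"
        by (intro less.hyps) (use less.prems * in linarith)+
      then show ?thesis using * by simp
    qed (use le in simp)
    moreover have "a + b \<le> ls' ! (b - 1) + 1"
    proof (cases "ls ! (b - 1) + 1 = a + b")
      case False
      then have *: "ls ! (b - 1) < a - 1 + b" "2 \<le> a" using less.prems ge by auto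
      then have "us ! (a - 1 - 1) < us ! (a - 1)"
        using sorted_wrt_nth_less[OF su(1), of "a - 1 - 1" "a - 1"] less.prems by auto
      then have **: "us ! (a - 1 - 1) < a - 1 + b" using less.prems(5) * by linarith
      then have "a - 1 + b \<le> us' ! (a - 1 - 1)"
        by (intro less.hyps) (use less.prems * in linarith)+
      then have "fired us us' (a - 1) b" using ** by (simp add: fired_def)
      then have "fired ls ls' b (a - 1)"
        using iff[of "a - 1" b] less.prems * by simp
      then show ?thesis using * unfolding fired_def by linarith
    qed (use le in simp)
    ultimately have "plus_config (us', ls') a b"
      using neg neg' less.prems len by (auto simp: plus_config_def)
    with no show False by blast
  qed
qed

text \<open>A cell fired in any reachable state had both initial entries below a + b, so
  \<open>terminal_fired\<close> shows that a terminal state has fired it too. Terminal states are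
  therefore maximal, whatever the order of the moves.\<close>

lemma terminal_le:
  assumes r1: "reach (us, ls) (us1, ls1)" and no: "\<And>a b. \<not> plus_config (us1, ls1) a b"
    and r2: "reach (us, ls) (us2, ls2)"
    and v: "(us, ls) \<in> calB n" and a: "a < length us"
  shows "us2 ! a \<le> us1 ! a"
proof (rule ccontr)
  assume neg: "\<not> ?thesis"
  have ge: "Suc a \<le> us ! a" using calB_bounds(1)[OF v, of "Suc a"] a by simp
  have le: "us ! a \<le> us1 ! a" "us2 ! a \<le> Suc a + length ls"
    using reach_raised(3)[OF r1 a] reach_raised(4)[OF r2 a] by auto
  \<comment> \<open>The column of the last cell fired in row \<open>Suc a\<close> by the second
    state.\<close>
  define b where "b = us2 ! a - Suc a"
  have b: "1 \<le> b" "b \<le> length ls" "us2 ! a = Suc a + b" using neg ge le by (auto simp: b_def)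
  have f: "fired us us2 (Suc a) b" using neg le b by (auto simp: fired_def)
  have "fired ls ls2 b (Suc a)" using r2 f a b by (auto simp: reach_def)
  then have "ls ! (b - 1) < Suc a + b" by (simp add: fired_def)
  then have "Suc a + b \<le> us1 ! a"
    using terminal_fired[OF r1 no v, of "Suc a" b] f a b by (simp add: fired_def)
  then show False using neg b by simp
qed

lemma terminal_unique:
  assumes r1: "reach v s1" and no1: "\<And>a b. \<not> plus_config s1 a b"
    and r2: "reach v s2" and no2: "\<And>a b. \<not> plus_config s2 a b"
    and v: "v \<in> calB n"
  shows "s1 = s2"
proof -
  have *: "fst s1 = fst s2" if "reach v s1" "\<And>a b. \<not> plus_config s1 a b"
    "reach v s2" "\<And>a b. \<not> plus_config s2 a b" "v \<in> calB n" for v s1 s2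
  proof -
    obtain us ls us1 ls1 us2 ls2 where e: "v = (us, ls)" "s1 = (us1, ls1)" "s2 = (us2, ls2)"
      by (cases v, cases s1, cases s2)
    have "us2 ! a = us1 ! a" if "a < length us" for a
      using terminal_le[of us ls us1 ls1 us2 ls2 n a] terminal_le[of us ls us2 ls2 us1 ls1 n a]
        \<open>reach v s1\<close> \<open>reach v s2\<close> \<open>\<And>a b. \<not> plus_config s1 a b\<close> \<open>\<And>a b. \<not> plus_config s2 a b\<close>
        \<open>v \<in> calB n\<close> that unfolding e by (meson le_antisym)
    moreover have "length us1 = length us" "length us2 = length us"
      using that unfolding e by (auto simp: reach_def raised_def)
    ultimately show ?thesis using e by (auto intro: nth_equalityI)
  qed
  \<comment> \<open>Exchanging the two halves reduces the second components to the first.\<close>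
  have "reach (prod.swap v) (prod.swap s)" if "reach v s" for s
    using that by (cases v; cases s) (simp add: reach_swap)
  moreover have "\<not> plus_config (prod.swap s) a b" if "\<And>a b. \<not> plus_config s a b" for s a b
    using that by (cases s) (simp add: plus_config_swap)
  moreover have "prod.swap v \<in> calB n" using v by (cases v) (auto simp: calB_def)
  ultimately have "fst (prod.swap s1) = fst (prod.swap s2)"
    using r1 no1 r2 no2 by (intro *) auto
  moreover have "fst s1 = fst s2" by (rule *) (fact assms)+
  ultimately show ?thesis by (simp add: prod_eq_iff)
qed

text \<open>Let the cell (a, b) be the one that lifted an entry to its final value a + b. Then the
  initial barred entry at b lies below a + b, so either the next unbarred entry started at a + 1 + b
  or higher, or \<open>terminal_fired\<close> makes the cell (a + 1, b) lift it there.\<close>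

lemma terminal_sorted:
  assumes r: "reach (us, ls) (us', ls')" and no: "\<And>a b. \<not> plus_config (us', ls') a b"
    and v: "(us, ls) \<in> calB n"
  shows "sorted_wrt (<) us'" "set us' \<subseteq> {1..n}"
proof -
  have su: "sorted_wrt (<) us" using v by (auto simp: calB_def)
  have len: "length us' = length us" using r by (auto simp: reach_def raised_def)
  have le: "us ! a \<le> us' ! a" "us' ! a \<le> Suc a + length ls" "Suc a \<le> us ! a" if "a < length us" for a
    using reach_raised(3,4)[OF r that] that calB_bounds(1)[OF v, of "Suc a"] by auto
  have "us' ! a < us' ! Suc a" if a: "Suc a < length us" for a
  proof (cases "us' ! a = us ! a")
    case True
    then show ?thesis using sorted_wrt_nth_less[OF su, of a "Suc a"] le[of "Suc a"] a by simp
  next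
    case False
    define b where "b = us' ! a - Suc a"
    have b: "1 \<le> b" "b \<le> length ls" "us' ! a = Suc a + b"
      using False le[of a] a by (auto simp: b_def)
    have "fired us us' (Suc a) b" using False le[of a] a b by (auto simp: fired_def)
    then have "fired ls ls' b (Suc a)" using r a b by (auto simp: reach_def)
    then have l: "ls ! (b - 1) < Suc a + b" by (simp add: fired_def)
    show ?thesis
    proof (cases "us ! Suc a < Suc (Suc a) + b")
      case True
      then show ?thesis using terminal_fired[OF r no v, of "Suc (Suc a)" b] a b l by simp
    qed (use le[of "Suc a"] a b in simp)
  qed
  then have "\<forall>a. Suc a < length us' \<longrightarrow> us' ! a < us' ! Suc a" using len by simp
  then show "sorted_wrt (<) us'"
    by (simp add: sorted_wrt_iff_nth_Suc_transp[OF transp_on_less])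
  show "set us' \<subseteq> {1..n}"
  proof
    fix x assume "x \<in> set us'"
    then obtain a where a: "a < length us" "x = us' ! a" using len by (auto simp: in_set_conv_nth)
    have "n = length us + length ls" using v by (simp add: calB_def)
    then show "x \<in> {1..n}" using le[OF a(1)] a by auto
  qed
qed

text \<open>Equal final entries i at a and b with i < a + b would have started below a + b, and then
  \<open>terminal_fired\<close> would have lifted them to at least a + b.\<close>

lemma terminal_B_Lambda:
  assumes r: "reach v s" and no: "\<And>a b. \<not> plus_config s a b" and v: "v \<in> calB n"
  shows "s \<in> B_Lambda n"
proof -
  obtain us ls us' ls' where e: "v = (us, ls)" "s = (us', ls')" by (cases v, cases s)
  note r = r[unfolded e] and no = no[unfolded e] and v = v[unfolded e]
  have v': "(ls, us) \<in> calB n" using v by (auto simp: calB_def)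
  have no': "\<And>a b. \<not> plus_config (ls', us') a b" using no plus_config_swap by blast
  note r' = r[unfolded reach_swap[of us]]
  have "length us' + length ls' = n"
    using r v by (auto simp: reach_def raised_def calB_def)
  then have "(us', ls') \<in> calB n"
    using terminal_sorted[OF r no v] terminal_sorted[OF r' no' v'] by (auto simp: calB_def)
  moreover have "a + b \<le> us' ! (a - 1)"
    if ab: "a \<in> {1..length us'}" "b \<in> {1..length ls'}" "us' ! (a - 1) = ls' ! (b - 1)" for a b
  proof (rule ccontr)
    assume neg: "\<not> ?thesis"
    have "us ! (a - 1) \<le> us' ! (a - 1)" "ls ! (b - 1) \<le> ls' ! (b - 1)"
      "a \<in> {1..length us}" "b \<in> {1..length ls}"
      using reach_raised(1,2)[OF r] reach_raised(3)[OF r, of "a - 1"] reach_raised(3)[OF r', of "b - 1"] ab(1,2) by auto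
    then show False using terminal_fired[OF r no v, of a b] neg ab by auto
  qed
  ultimately show ?thesis by (auto simp: B_Lambda_def e)
qed

lemma B_Lambda_no_plus_config:
  assumes "s \<in> B_Lambda n" shows "\<not> plus_config s a b"
  using assms by (force simp: B_Lambda_def plus_config_def)

text \<open>Elements of \<open>B_Lambda\<close> admit no move, so \<open>terminal_unique\<close>
  justifies the \<open>THE\<close> in \<open>Rect\<close>.\<close>

lemma Rect_props:
  assumes v: "v \<in> calB n"
  shows "Rect n v \<in> B_Lambda n" "reach v (Rect n v)"
    and Rect_eqI: "\<And>b. b \<in> B_Lambda n \<Longrightarrow> rect_move\<^sup>*\<^sup>* v b \<Longrightarrow> Rect n v = b"
proof -
  have un: "b1 = b2" if "b1 \<in> B_Lambda n" "rect_move\<^sup>*\<^sup>* v b1" "b2 \<in> B_Lambda n" "rect_move\<^sup>*\<^sup>* v b2" for b1 b2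
    using that terminal_unique[OF _ _ _ _ v] reach_rtranclp[OF _ reach_refl[OF v]]
      B_Lambda_no_plus_config by metis
  obtain t where t: "rect_move\<^sup>*\<^sup>* v t" "\<And>a b. \<not> plus_config t a b"
    using reach_terminal[OF reach_refl[OF v]] by blast
  have "reach v t" using reach_rtranclp[OF t(1) reach_refl[OF v]] .
  then have tB: "t \<in> B_Lambda n" using terminal_B_Lambda t(2) v by blast
  show eqI: "Rect n v = b" if "b \<in> B_Lambda n" "rect_move\<^sup>*\<^sup>* v b" for b
    unfolding Rect_def using that un by (intro the_equality) auto
  then have "Rect n v = t" using tB t by blast
  then show "Rect n v \<in> B_Lambda n" "reach v (Rect n v)" using tB \<open>reach v t\<close> by auto
qed

section \<open>The fibres of rectification and the monomials\<close>

lemma B_Lambda_subset: "B_Lambda n \<subseteq> calB n"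
  by (auto simp: B_Lambda_def)

lemma hw_seq_B_Lambda: "hw_seq n \<in> B_Lambda n"
  by (auto simp: hw_seq_def B_Lambda_def calB_def sorted_wrt_upt simp del: upt_Suc)

lemma calB_Nil: "(us, []) \<in> calB n \<longleftrightarrow> (us, []) = hw_seq n"
proof
  assume *: "(us, []) \<in> calB n"
  then have "card (set us) = n" by (simp add: calB_def strict_sorted_iff distinct_card)
  then have "set us = {1..n}" using * by (intro card_subset_eq) (auto simp: calB_def)
  then have "set [1..<Suc n] = set us"
    by (simp add: atLeastLessThanSuc_atLeastAtMost del: upt_Suc)
  moreover have "sorted_wrt (<) us" using * by (simp add: calB_def)
  ultimately have "us = [1..<Suc n]" using strict_sorted_equal sorted_wrt_upt by metis
  then show "(us, []) = hw_seq n" by (simp add: hw_seq_def)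
qed (use B_Lambda_subset hw_seq_B_Lambda in auto)

text \<open>Moves keep the number of barred entries, and \<open>hw_seq\<close> is the only sequence
  without any.\<close>

lemma Rect_eq_hw_seq:
  assumes "v \<in> calB n"
  shows "Rect n v = hw_seq n \<longleftrightarrow> v = hw_seq n"
proof
  assume "v = hw_seq n"
  then show "Rect n v = hw_seq n" using Rect_eqI[OF assms] hw_seq_B_Lambda by simp
next
  assume "Rect n v = hw_seq n"
  then have "reach v (hw_seq n)" using Rect_props[OF assms] by simp
  then have "snd v = []" by (auto simp: reach_def raised_def hw_seq_def split: prod.splits)
  then show "v = hw_seq n" using calB_Nil[of "fst v" n] assms by (cases v) auto
qed

text \<open>The quotient is spread over the whole range of b, with factors 1 where nothing is fired,
  so that the contributions of the two halves can be multiplied cell by cell.\<close>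

lemma prod_telescope:
  fixes f :: "nat \<Rightarrow> 'a :: field"
  assumes "\<And>z. f z \<noteq> 0" "a \<le> x" "x \<le> y" "y \<le> a + k"
  shows "f y = f x * (\<Prod>b = 1..k. if x < a + b \<and> a + b \<le> y then f (a + b) / f (a + b - 1) else 1)"
  using assms(3,4)
proof (induction y rule: dec_induct)
  case base
  have "(\<Prod>b = 1..k. if x < a + b \<and> a + b \<le> x then f (a + b) / f (a + b - 1) else 1) = 1"
    by (intro prod.neutral) auto
  then show ?case by simp
next
  case (step y)
  let ?F = "\<lambda>y b. if x < a + b \<and> a + b \<le> y then f (a + b) / f (a + b - 1) else 1"
  define b0 where "b0 = Suc y - a"
  have b0: "b0 \<in> {1..k}" "a + b0 = Suc y" using step assms by (auto simp: b0_def)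
  have "prod (?F (Suc y)) {1..k} = ?F (Suc y) b0 * prod (?F (Suc y)) ({1..k} - {b0})"
    using b0 by (intro prod.remove) auto
  also have "prod (?F (Suc y)) ({1..k} - {b0}) = prod (?F y) ({1..k} - {b0})"
    using b0 by (intro prod.cong) auto
  also have "\<dots> = prod (?F y) {1..k}"
    using b0 by (subst prod.remove[of "{1..k}" b0]) auto
  finally show ?case using step assms(1) b0 by simp
qed

lemma cval_nonzero: "(\<And>r i. c r i \<noteq> 0) \<Longrightarrow> cval c r i \<noteq> 0"
  by (simp add: cval_def)

text \<open>Each fired cell contributes the factor 1: with i = a + b, both C^(a)_i Cbar^(a)_i and
  C^(a)_(i-1) Cbar^(a-1)_(i-1) equal c^(n-a)_(i-1) / c^(n-a+1)_(i-1).\<close>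

lemma mon0_reach:
  assumes nz: "\<And>r i. c r i \<noteq> 0" and r: "reach v s" and v: "v \<in> calB n"
  shows "mon0 n c s = mon0 n c v"
proof -
  obtain us ls us' ls' where e: "v = (us, ls)" "s = (us', ls')" by (cases v, cases s)
  note r = r[unfolded e] and v = v[unfolded e]
  define f where "f a i = C_mon n c (int a) i" for a i
  define g where "g b i = Cbar_mon n c (int i - int b) i" for b i
  have fn: "f a i \<noteq> 0" and gn: "g a i \<noteq> 0" for a i
    using cval_nonzero[OF nz] by (auto simp: f_def g_def C_mon_def Cbar_mon_def)
  \<comment> \<open>The factors by which the cell (a, b) changes the unbarred and the barred half of
    the monomial.\<close>
  define X where "X a b = (if fired us us' a b then f a (a + b) / f a (a + b - 1) else 1)" for a b
  define Y where "Y a b = (if fired us us' a b then g b (a + b) / g b (a + b - 1) else 1)" for a b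
  let ?m = "length us" and ?k = "length ls"
  have len: "length us' = ?m" "length ls' = ?k" using r by (auto simp: reach_def raised_def)
  have F: "f a (us' ! (a - 1)) = f a (us ! (a - 1)) * (\<Prod>b = 1..?k. X a b)" if "a \<in> {1..?m}" for a
  proof -
    have "a \<le> us ! (a - 1)" using that calB_bounds[OF v] by auto
    then show ?thesis
      unfolding X_def fired_def using r that
      by (intro prod_telescope fn) (auto simp: reach_def raised_def)
  qed
  have G: "g b (ls' ! (b - 1)) = g b (ls ! (b - 1)) * (\<Prod>a = 1..?m. Y a b)" if b: "b \<in> {1..?k}" for b
  proof -
    have "b \<le> ls ! (b - 1)" using b calB_bounds[OF v] by auto
    then have "g b (ls' ! (b - 1)) = g b (ls ! (b - 1)) *
        (\<Prod>a = 1..?m. if fired ls ls' b a then g b (b + a) / g b (b + a - 1) else 1)"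
      unfolding fired_def using r b
      by (intro prod_telescope gn) (auto simp: reach_def raised_def)
    also have "(\<Prod>a = 1..?m. if fired ls ls' b a then g b (b + a) / g b (b + a - 1) else 1)
        = (\<Prod>a = 1..?m. Y a b)"
      using r b by (intro prod.cong) (auto simp: Y_def reach_def add.commute)
    finally show ?thesis .
  qed
  have XY: "X a b * Y a b = 1" if ab: "a \<in> {1..?m}" "b \<in> {1..?k}" for a b
  proof -
    have i: "int (a + b) - int b = int a" "int (a + b - 1) - int b = int a - 1"
      using ab by auto
    have "f a (a + b) * g b (a + b) = f a (a + b - 1) * g b (a + b - 1)"
      unfolding f_def g_def C_mon_def Cbar_mon_def i using cval_nonzero[OF nz]
      by (simp add: field_simps)
    then show ?thesis using fn gn by (simp add: X_def Y_def field_simps)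
  qed
  have "mon0 n c s = (\<Prod>a = 1..?m. f a (us' ! (a - 1))) * (\<Prod>b = 1..?k. g b (ls' ! (b - 1)))"
    by (simp add: mon0_def e len f_def g_def)
  also have "\<dots> = (\<Prod>a = 1..?m. f a (us ! (a - 1))) * (\<Prod>b = 1..?k. g b (ls ! (b - 1))) *
      ((\<Prod>a = 1..?m. \<Prod>b = 1..?k. X a b) * (\<Prod>b = 1..?k. \<Prod>a = 1..?m. Y a b))"
    using F G by (simp add: prod.distrib)
  also have "(\<Prod>b = 1..?k. \<Prod>a = 1..?m. Y a b) = (\<Prod>a = 1..?m. \<Prod>b = 1..?k. Y a b)"
    by (rule prod.swap)
  also have "(\<Prod>a = 1..?m. \<Prod>b = 1..?k. X a b) * \<dots> = 1"
    by (subst prod.distrib[symmetric])+ (auto intro!: prod.neutral simp: XY)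
  finally show ?thesis by (simp add: mon0_def e f_def g_def)
qed

lemma finite_calB: "finite (calB n)"
proof (rule finite_subset)
  let ?L = "{xs. set xs \<subseteq> {1..n} \<and> length xs \<le> n}"
  show "calB n \<subseteq> ?L \<times> ?L" by (auto simp: calB_def)
  show "finite (?L \<times> ?L)" by (intro finite_cartesian_product finite_lists_length_le) auto
qed

lemma sum_rect_mult:
  assumes nz: "\<And>r i. c r i \<noteq> 0"
  shows "(\<Sum>b \<in> B_Lambda n - {hw_seq n}. of_nat (rect_mult n b) * mon0 n c b)
       = (\<Sum>v \<in> calB n - {hw_seq n}. mon0 n c v)"
proof -
  have fin: "finite (B_Lambda n)"
    by (rule finite_subset[OF B_Lambda_subset finite_calB])
  have "(\<Sum>v \<in> calB n - {hw_seq n}. mon0 n c v) =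
      (\<Sum>b \<in> B_Lambda n - {hw_seq n}. \<Sum>v \<in> {v \<in> calB n - {hw_seq n}. Rect n v = b}. mon0 n c v)"
  proof (rule sum.group[symmetric])
    show "Rect n ` (calB n - {hw_seq n}) \<subseteq> B_Lambda n - {hw_seq n}"
    proof
      fix b assume "b \<in> Rect n ` (calB n - {hw_seq n})"
      then obtain v where "v \<in> calB n" "v \<noteq> hw_seq n" "b = Rect n v" by blast
      then show "b \<in> B_Lambda n - {hw_seq n}" using Rect_props(1) Rect_eq_hw_seq by simp
    qed
  qed (use finite_calB fin in auto)
  also have "\<dots> = (\<Sum>b \<in> B_Lambda n - {hw_seq n}. of_nat (rect_mult n b) * mon0 n c b)"
  proof (intro sum.cong refl)
    fix b assume b: "b \<in> B_Lambda n - {hw_seq n}"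
    have "{v \<in> calB n - {hw_seq n}. Rect n v = b} = {v \<in> calB n. Rect n v = b}"
      using b Rect_eq_hw_seq by auto
    moreover have "mon0 n c v = mon0 n c b" if "v \<in> calB n" "Rect n v = b" for v
      using mon0_reach[OF nz _ that(1), of b] Rect_props[OF that(1)] that by simp
    ultimately show "(\<Sum>v \<in> {v \<in> calB n - {hw_seq n}. Rect n v = b}. mon0 n c v)
        = of_nat (rect_mult n b) * mon0 n c b"
      by (simp add: rect_mult_def)
  qed
  finally show ?thesis by simp
qed

section \<open>Sums of monomials\<close>

text \<open>\<open>card (U \<inter> {..u})\<close> is the position of u in the increasing
  enumeration of U, which frees the monomial from lists.\<close>

definition set_wt :: "(nat \<Rightarrow> nat \<Rightarrow> complex) \<Rightarrow> nat set \<Rightarrow> complex" where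
  "set_wt f U = (\<Prod>u\<in>U. f (card (U \<inter> {..u})) u)"

definition wt_sum :: "(nat \<Rightarrow> nat \<Rightarrow> complex) \<Rightarrow> nat \<Rightarrow> nat \<Rightarrow> complex" where
  "wt_sum f k m = (\<Sum>U | U \<subseteq> {1..k} \<and> card U = m. set_wt f U)"

lemma set_wt_insert:
  assumes "finite U" "\<And>u. u \<in> U \<Longrightarrow> u < x"
  shows "set_wt f (insert x U) = set_wt f U * f (Suc (card U)) x"
proof -
  have x: "x \<notin> U" using assms(2) by blast
  have "insert x U \<inter> {..x} = insert x U" using assms(2) by (auto simp: less_imp_le)
  moreover have "insert x U \<inter> {..u} = U \<inter> {..u}" if "u \<in> U" for u
    using assms(2)[OF that] by auto
  ultimately show ?thesis
    using x assms(1) by (simp add: set_wt_def)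
qed

lemma prod_list_set_wt:
  assumes "sorted_wrt (<) xs"
  shows "(\<Prod>a = 1..length xs. f a (xs ! (a - 1))) = set_wt f (set xs)"
  using assms
proof (induction xs rule: rev_induct)
  case Nil
  then show ?case by (simp add: set_wt_def)
next
  case (snoc x xs)
  have "(\<Prod>a = 1..length xs. f a ((xs @ [x]) ! (a - 1))) = (\<Prod>a = 1..length xs. f a (xs ! (a - 1)))"
    by (intro prod.cong) (auto simp: nth_append)
  moreover have "card (set xs) = length xs"
    using snoc.prems by (intro distinct_card) (auto simp: strict_sorted_iff sorted_wrt_append)
  ultimately show ?case
    using snoc by (simp add: set_wt_insert sorted_wrt_append)
qed

text \<open>Passing from j to j + 1 adds one factor, on the left if j + 1 is in L and on the right
  otherwise; in either case it equals the change of the correction term. At j = n this term is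
  c^(|L|)_n.\<close>

lemma set_wt_complement:
  assumes nz: "\<And>r i. c r i \<noteq> 0" and "L \<subseteq> {1..j}"
  shows "set_wt (\<lambda>b i. Cbar_mon n c (int i - int b) i) L * cval c (int n - int j + int (card L)) j
       = set_wt (\<lambda>a i. C_mon n c (int a) i) ({1..j} - L)"
  using assms(2)
proof (induction j arbitrary: L)
  case 0
  then show ?case by (simp add: set_wt_def cval_def)
next
  case (Suc j)
  note nz' = cval_nonzero[of c, OF nz]
  define M where "M = L - {Suc j}"
  have M: "M \<subseteq> {1..j}" using Suc.prems by (auto simp: M_def le_Suc_eq)
  then have fin: "finite M" by (rule finite_subset) simp
  have lt: "u < Suc j" if "u \<in> M" for u using M that by auto
  have cM: "card ({1..j} - M) = j - card M" "card M \<le> j"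
    using M fin card_mono[of "{1..j}" M] by (auto simp: card_Diff_subset)
  note IH = Suc.IH[OF M]
  show ?case
  proof (cases "Suc j \<in> L")
    case True
    then have L: "L = insert (Suc j) M" "{1..Suc j} - L = {1..j} - M" "Suc j \<notin> M"
      by (auto simp: M_def le_Suc_eq)
    have "int (Suc j) - int (Suc (card M)) = int j - int (card M)" by simp
    then show ?thesis
      unfolding L(2) IH[symmetric] unfolding L(1)
      using nz' L(3) fin lt
      by (simp add: set_wt_insert Cbar_mon_def algebra_simps)
  next
    case False
    then have L: "L = M" "{1..Suc j} - L = insert (Suc j) ({1..j} - M)"
      using M by (auto simp: M_def)
    have e: "int n - int (Suc (j - card M)) = int n - int (Suc j) + int (card M)"
      "int n - int (Suc j) + int (card M) + 1 = int n - int j + int (card M)"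
      using cM(2) by auto
    then have "C_mon n c (int (Suc (j - card M))) (Suc j) * cval c (int n - int j + int (card M)) j
        = cval c (int n - int (Suc j) + int (card M)) (Suc j)"
      using nz' unfolding C_mon_def e by simp
    moreover have "set_wt (\<lambda>a i. C_mon n c (int a) i) ({1..Suc j} - L) =
        set_wt (\<lambda>a i. C_mon n c (int a) i) ({1..j} - M) * C_mon n c (int (Suc (j - card M))) (Suc j)"
      unfolding L(2) by (subst set_wt_insert) (auto simp: cM[unfolded One_nat_def] simp del: of_nat_Suc)
    ultimately show ?thesis
      unfolding IH[symmetric] L(1) by (metis (no_types, lifting) mult.assoc mult.commute)
  qed
qed

lemma mon0_set_wt:
  assumes nz: "\<And>r i. c r i \<noteq> 0" and v: "(us, ls) \<in> calB n"
  shows "mon0 n c (us, ls) = set_wt (\<lambda>a i. C_mon n c (int a) i) (set us) *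
     set_wt (\<lambda>a i. C_mon n c (int a) i) ({1..n} - set ls) / cval c (int (card (set ls))) n"
proof -
  have s: "sorted_wrt (<) us" "sorted_wrt (<) ls" "set ls \<subseteq> {1..n}" using v by (auto simp: calB_def)
  show ?thesis
    using prod_list_set_wt[OF s(1), of "\<lambda>a i. C_mon n c (int a) i"]
      prod_list_set_wt[OF s(2), of "\<lambda>b i. Cbar_mon n c (int i - int b) i"]
      set_wt_complement[OF nz s(3), of n, symmetric] cval_nonzero[of c, OF nz]
    by (simp add: mon0_def)
qed

text \<open>Complementing the barred half turns sequences into all pairs of subsets of equal size m,
  and for fixed m the sum over such pairs is a square. The excluded \<open>hw_seq\<close> is the
  only pair with m = n.\<close>

lemma sum_calB:
  assumes nz: "\<And>r i. c r i \<noteq> 0"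
  shows "(\<Sum>v \<in> calB n - {hw_seq n}. mon0 n c v)
       = (\<Sum>m<n. (wt_sum (\<lambda>a i. C_mon n c (int a) i) n m)\<^sup>2 / cval c (int n - int m) n)"
proof -
  let ?f = "\<lambda>a i. C_mon n c (int a) i"
  define T where "T m = {U. U \<subseteq> {1..n} \<and> card U = m}" for m
  define g where "g = (\<lambda>(U, V). set_wt ?f U * set_wt ?f V / cval c (int n - int (card V)) n)"
  have finT: "finite (T m)" for m unfolding T_def by (rule finite_subset[of _ "Pow {1..n}"]) auto
  have cc: "card ({1..n} - A) = n - card A" "card A \<le> n" if "A \<subseteq> {1..n}" for A
    using that finite_subset[OF that] card_mono[OF _ that] by (auto simp: card_Diff_subset)
  have "(\<Sum>v \<in> calB n - {hw_seq n}. mon0 n c v) = sum g (\<Union>m<n. T m \<times> T m)"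
  proof (rule sum.reindex_bij_witness[where
        i = "\<lambda>(U, V). (sorted_list_of_set U, sorted_list_of_set ({1..n} - V))" and
        j = "\<lambda>(us, ls). (set us, {1..n} - set ls)"])
    fix v assume "v \<in> calB n - {hw_seq n}"
    then obtain us ls where v: "v = (us, ls)" "(us, ls) \<in> calB n" "(us, ls) \<noteq> hw_seq n"
      by (cases v) auto
    then have s: "sorted_wrt (<) us" "sorted_wrt (<) ls" "set us \<subseteq> {1..n}" "set ls \<subseteq> {1..n}"
      "length us + length ls = n" by (auto simp: calB_def)
    have d: "card (set us) = length us" "card (set ls) = length ls"
      using s by (auto intro!: distinct_card simp: strict_sorted_iff)
    have "ls \<noteq> []" using v calB_Nil by blast
    then have lt: "length us < n" using s(5) by (cases ls) auto
    have eq: "{1..n} - ({1..n} - set ls) = set ls" using s(4) by blast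
    show "(case case v of (us, ls) \<Rightarrow> (set us, {1..n} - set ls) of
           (U, V) \<Rightarrow> (sorted_list_of_set U, sorted_list_of_set ({1..n} - V))) = v"
      using s eq by (simp add: v strict_sorted_iff sorted_list_of_set.idem_if_sorted_distinct)
    show "(case v of (us, ls) \<Rightarrow> (set us, {1..n} - set ls)) \<in> (\<Union>m<n. T m \<times> T m)"
      using s d lt cc[OF s(4)] by (auto simp: v T_def)
    show "g (case v of (us, ls) \<Rightarrow> (set us, {1..n} - set ls)) = mon0 n c v"
      using cc[OF s(4)] d s(5) unfolding v mon0_set_wt[OF nz v(2)] g_def
      by (simp add: of_nat_diff)
  next
    fix p assume "p \<in> (\<Union>m<n. T m \<times> T m)"
    then obtain U V where p: "p = (U, V)" "U \<subseteq> {1..n}" "V \<subseteq> {1..n}" "card V = card U" "card U < n"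
      by (auto simp: T_def)
    have fin: "finite U" "finite V" using p finite_subset by blast+
    have eq: "{1..n} - ({1..n} - V) = V" using p by blast
    show "(case case p of (U, V) \<Rightarrow> (sorted_list_of_set U, sorted_list_of_set ({1..n} - V)) of
           (us, ls) \<Rightarrow> (set us, {1..n} - set ls)) = p"
      using fin eq p by simp
    have "length (sorted_list_of_set U) \<noteq> length [1..<Suc n]" using p fin by simp
    then have "(sorted_list_of_set U, sorted_list_of_set ({1..n} - V)) \<noteq> hw_seq n"
      unfolding hw_seq_def by (metis fst_conv)
    moreover have "(sorted_list_of_set U, sorted_list_of_set ({1..n} - V)) \<in> calB n"
      using p fin cc by (auto simp: calB_def)
    ultimately show "(case p of (U, V) \<Rightarrow> (sorted_list_of_set U, sorted_list_of_set ({1..n} - V)))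
        \<in> calB n - {hw_seq n}" by (simp add: p)
  qed
  also have "\<dots> = (\<Sum>m<n. sum g (T m \<times> T m))"
    by (rule sum.UNION_disjoint) (use finT in \<open>auto simp: T_def\<close>)
  also have "\<dots> = (\<Sum>m<n. (wt_sum ?f n m)\<^sup>2 / cval c (int n - int m) n)"
  proof (intro sum.cong refl)
    fix m
    have "sum g (T m \<times> T m) = (\<Sum>U\<in>T m. \<Sum>V\<in>T m. set_wt ?f U * set_wt ?f V / cval c (int n - int m) n)"
      unfolding g_def sum.cartesian_product[symmetric] by (intro sum.cong refl) (auto simp: T_def)
    also have "\<dots> = (\<Sum>U\<in>T m. \<Sum>V\<in>T m. set_wt ?f U * set_wt ?f V) / cval c (int n - int m) n"
      by (simp add: sum_divide_distrib)
    also have "(\<Sum>U\<in>T m. \<Sum>V\<in>T m. set_wt ?f U * set_wt ?f V) = (wt_sum ?f n m)\<^sup>2"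
      by (simp add: wt_sum_def T_def sum_product power2_eq_square)
    finally show "sum g (T m \<times> T m) = (wt_sum ?f n m)\<^sup>2 / cval c (int n - int m) n" .
  qed
  finally show ?thesis .
qed

section \<open>Recursions for the sums over subsets\<close>

lemma wt_sum_0 [simp]: "wt_sum f k 0 = 1"
proof -
  have "{U. U \<subseteq> {1..k} \<and> card U = 0} = {{}}"
    using finite_subset[of _ "{1..k}"] by auto
  then show ?thesis by (simp add: wt_sum_def set_wt_def)
qed

lemma wt_sum_eq_0: "k < m \<Longrightarrow> wt_sum f k m = 0"
proof -
  assume "k < m"
  moreover have "card U \<le> k" if "U \<subseteq> {1..k}" for U
    using card_mono[OF finite_atLeastAtMost that] by simp
  ultimately have "{U. U \<subseteq> {1..k} \<and> card U = m} = {}"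
    unfolding empty_Collect_eq using leD by blast
  then show ?thesis unfolding wt_sum_def by (simp only: sum.empty)
qed

text \<open>Pascal's recursion: either k + 1 is missing, or it is the largest element and thus at
  position m + 1.\<close>

lemma wt_sum_Suc: "wt_sum f (Suc k) (Suc m) = wt_sum f k (Suc m) + wt_sum f k m * f (Suc m) (Suc k)"
proof -
  let ?A = "\<lambda>m. {U. U \<subseteq> {1..k} \<and> card U = m}"
  have fin: "finite U" if "U \<subseteq> {1..k}" for U using that finite_subset by blast
  have finA: "finite (?A m)" for m by (rule finite_subset[of _ "Pow {1..k}"]) auto
  have nin: "Suc k \<notin> U" if "U \<subseteq> {1..k}" for U using that by auto
  have "{U. U \<subseteq> {1..Suc k} \<and> card U = Suc m} = ?A (Suc m) \<union> insert (Suc k) ` ?A m"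
  proof (intro equalityI subsetI)
    fix U assume U: "U \<in> {U. U \<subseteq> {1..Suc k} \<and> card U = Suc m}"
    show "U \<in> ?A (Suc m) \<union> insert (Suc k) ` ?A m"
    proof (cases "Suc k \<in> U")
      case True
      have "finite U" using U finite_subset[of U "{1..Suc k}"] by simp
      then have "U - {Suc k} \<in> ?A m" using U True by (auto simp: le_Suc_eq)
      moreover have "U = insert (Suc k) (U - {Suc k})" using True by blast
      ultimately show ?thesis by blast
    next
      case False
      then have "U \<subseteq> {1..k}" using U by (force simp: le_Suc_eq)
      then show ?thesis using U by simp
    qed
  next
    fix U assume "U \<in> ?A (Suc m) \<union> insert (Suc k) ` ?A m"
    then show "U \<in> {U. U \<subseteq> {1..Suc k} \<and> card U = Suc m}"
      using fin nin by (auto simp: card_insert_if)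
  qed
  moreover have "?A (Suc m) \<inter> insert (Suc k) ` ?A m = {}" using nin by blast
  moreover have "inj_on (insert (Suc k)) (?A m)" by (intro inj_onI) (metis Diff_insert_absorb nin mem_Collect_eq)
  moreover have "set_wt f (insert (Suc k) U) = set_wt f U * f (Suc m) (Suc k)" if "U \<in> ?A m" for U
    using that fin[of U] by (subst set_wt_insert) auto
  ultimately show ?thesis
    using finA by (simp add: wt_sum_def sum.union_disjoint sum.reindex sum_distrib_right)
qed

lemma wt_sum_diag:
  assumes nz: "\<And>r i. c r i \<noteq> 0"
  shows "wt_sum (\<lambda>a i. C_mon n c (int a) i) k k = cval c (int n - int k) k"
proof (induction k)
  case 0
  then show ?case by (simp add: cval_def)
next
  case (Suc k)
  then show ?case
    using cval_nonzero[of c, OF nz] by (simp add: wt_sum_Suc wt_sum_eq_0 C_mon_def algebra_simps)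
qed

text \<open>Summation by parts against Pascal's recursion: the alternating sum is the same for k and
  k + 1, and it vanishes at k = 0. Both linear relations are instances of this, one for the unbarred
  rows and one for the vectors z.\<close>

lemma wt_sum_alternating:
  assumes rec: "\<And>k m. m \<le> k \<Longrightarrow> k < K \<Longrightarrow>
      f (Suc m) (Suc k) * y (Suc k) (Suc m) = y (Suc k) m - y k m"
    and y0: "y 0 0 = 0" and "k \<le> K"
  shows "(\<Sum>m\<le>k. (-1) ^ m * wt_sum f k m * y k m) = 0"
  using assms(3)
proof (induction k)
  case 0
  then show ?case by (simp add: y0)
next
  case (Suc k)
  let ?S = "wt_sum f"
  have "(\<Sum>m\<le>Suc k. (-1) ^ m * ?S (Suc k) m * y (Suc k) m) =
      y (Suc k) 0 + (\<Sum>m\<le>k. (-1) ^ Suc m * ?S (Suc k) (Suc m) * y (Suc k) (Suc m))"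
    by (simp add: sum.atMost_Suc_shift del: sum.atMost_Suc)
  also have "(\<Sum>m\<le>k. (-1) ^ Suc m * ?S (Suc k) (Suc m) * y (Suc k) (Suc m)) =
      (\<Sum>m\<le>k. (-1) ^ Suc m * ?S k (Suc m) * y (Suc k) (Suc m)) -
      (\<Sum>m\<le>k. (-1) ^ m * ?S k m * (y (Suc k) m - y k m))"
    using Suc.prems unfolding sum_subtractf[symmetric]
    by (intro sum.cong refl) (simp add: wt_sum_Suc rec[symmetric] algebra_simps)
  also have "y (Suc k) 0 + \<dots> =
      (\<Sum>m\<le>Suc k. (-1) ^ m * ?S k m * y (Suc k) m) - (\<Sum>m\<le>k. (-1) ^ m * ?S k m * (y (Suc k) m - y k m))"
    by (simp add: sum.atMost_Suc_shift del: sum.atMost_Suc)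
  also have "(\<Sum>m\<le>Suc k. (-1) ^ m * ?S k m * y (Suc k) m) = (\<Sum>m\<le>k. (-1) ^ m * ?S k m * y (Suc k) m)"
    by (simp add: wt_sum_eq_0)
  also have "\<dots> - (\<Sum>m\<le>k. (-1) ^ m * ?S k m * (y (Suc k) m - y k m)) =
      (\<Sum>m\<le>k. (-1) ^ m * ?S k m * y k m)"
    unfolding sum_subtractf[symmetric] by (intro sum.cong refl) (simp add: algebra_simps)
  finally show ?case using Suc by simp
qed

section \<open>Generators of the symplectic group\<close>

text \<open>The rows p in which e_i has an entry, at column p + 1; the corresponding rows p + 1 form
  \<open>dn_rows\<close>. For i = n each set is a singleton.\<close>

definition up_rows :: "nat \<Rightarrow> nat \<Rightarrow> nat set" where
  "up_rows n i = {i - 1, 2 * n - i - 1}"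

definition dn_rows :: "nat \<Rightarrow> nat \<Rightarrow> nat set" where
  "dn_rows n i = {i, 2 * n - i}"

lemma up_rowsD:
  assumes i: "1 \<le> i" "i \<le> n" and p: "p \<in> up_rows n i"
  shows "Suc p \<in> dn_rows n i" "p \<notin> dn_rows n i" "Suc p < 2 * n" "Suc p \<notin> up_rows n i" "p < 2 * n"
proof -
  obtain j where j: "i = Suc j" using i by (cases i) auto
  obtain d where d: "n = Suc j + d" using i j le_Suc_ex by blast
  have "p = j \<or> p = j + 2 * d" using p by (simp add: j d up_rows_def)
  then show "Suc p \<in> dn_rows n i" "p \<notin> dn_rows n i" "Suc p < 2 * n" "Suc p \<notin> up_rows n i" "p < 2 * n"
    by (auto simp: j d up_rows_def dn_rows_def)
qed

lemma dn_rowsD: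
  assumes i: "1 \<le> i" "i \<le> n" and p: "p \<in> dn_rows n i"
  shows "p - 1 \<in> up_rows n i" "p \<notin> up_rows n i" "p < 2 * n" "Suc (p - 1) = p" "p - 1 \<notin> dn_rows n i"
proof -
  obtain j where j: "i = Suc j" using i by (cases i) auto
  obtain d where d: "n = Suc j + d" using i j le_Suc_ex by blast
  have "p = Suc j \<or> p = Suc (j + 2 * d)" using p by (auto simp: j d dn_rows_def)
  then show "p - 1 \<in> up_rows n i" "p \<notin> up_rows n i" "p < 2 * n" "Suc (p - 1) = p" "p - 1 \<notin> dn_rows n i"
    by (auto simp: j d up_rows_def dn_rows_def)
qed

lemma Suc_dn_rows: "1 \<le> i \<Longrightarrow> i \<le> n \<Longrightarrow> Suc p \<in> dn_rows n i \<longleftrightarrow> p \<in> up_rows n i"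
  using up_rowsD(1) dn_rowsD(1) by (metis diff_Suc_1)

lemma rows_bar:
  assumes "1 \<le> i" "i \<le> n" "p < 2 * n"
  shows up_rows_bar: "2 * n - 1 - p \<in> up_rows n i \<longleftrightarrow> p \<in> dn_rows n i"
    and dn_rows_bar: "2 * n - 1 - p \<in> dn_rows n i \<longleftrightarrow> p \<in> up_rows n i"
proof -
  have "2 * n - 1 - p = i - 1 \<longleftrightarrow> p = 2 * n - i" using assms by arith
  moreover have "2 * n - 1 - p = 2 * n - i - 1 \<longleftrightarrow> p = i" using assms by arith
  moreover have "2 * n - 1 - p = i \<longleftrightarrow> p = 2 * n - i - 1" using assms by arith
  moreover have "2 * n - 1 - p = 2 * n - i \<longleftrightarrow> p = i - 1" using assms by arith
  ultimately show "2 * n - 1 - p \<in> up_rows n i \<longleftrightarrow> p \<in> dn_rows n i"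
    "2 * n - 1 - p \<in> dn_rows n i \<longleftrightarrow> p \<in> up_rows n i"
    unfolding up_rows_def dn_rows_def insert_iff empty_iff by blast+
qed

abbreviation cmat :: "nat \<Rightarrow> complex mat set" where
  "cmat n \<equiv> carrier_mat (2 * n) (2 * n)"

lemma mat_eqI2:
  assumes "g \<in> cmat n" "h \<in> cmat n" "\<And>p q. p < 2 * n \<Longrightarrow> q < 2 * n \<Longrightarrow> g $$ (p, q) = h $$ (p, q)"
  shows "g = h"
  using assms by (intro eq_matI) auto

lemma cmat_mult [simp]: "g \<in> cmat n \<Longrightarrow> h \<in> cmat n \<Longrightarrow> g * h \<in> cmat n"
  by (rule mult_carrier_mat)

lemma chev_carrier [simp]: "chev_e n i \<in> cmat n" "chev_f n i \<in> cmat n"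
  by (simp_all add: chev_e_def chev_f_def)

lemma chev_e_index:
  assumes "1 \<le> i" "i \<le> n" "p < 2 * n" "q < 2 * n"
  shows "chev_e n i $$ (p, q) = (if p \<in> up_rows n i \<and> q = Suc p then 1 else 0)"
  using assms by (auto simp: chev_e_def up_rows_def)

lemma chev_f_index:
  assumes "1 \<le> i" "i \<le> n" "p < 2 * n" "q < 2 * n"
  shows "chev_f n i $$ (p, q) = (if q \<in> up_rows n i \<and> p = Suc q then 1 else 0)"
  using assms chev_e_index[of i n q p] by (simp add: chev_f_def chev_e_def)

lemma mult_index:
  assumes "g \<in> cmat n" "h \<in> cmat n" "p < 2 * n" "q < 2 * n"
  shows "(g * h) $$ (p, q) = (\<Sum>r<2 * n. g $$ (p, r) * h $$ (r, q))"
  using assms by (simp add: scalar_prod_def atLeast0LessThan)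

lemma chev_e_square:
  assumes "1 \<le> i" "i \<le> n" shows "chev_e n i * chev_e n i = 0\<^sub>m (2 * n) (2 * n)"
proof (rule mat_eqI2[of _ n])
  fix p q assume pq: "p < 2 * n" "q < 2 * n"
  have "(chev_e n i * chev_e n i) $$ (p, q) = (\<Sum>r<2 * n. chev_e n i $$ (p, r) * chev_e n i $$ (r, q))"
    using pq by (intro mult_index) auto
  also have "\<dots> = 0"
    using pq assms up_rowsD(4)[OF assms] by (intro sum.neutral) (auto simp: chev_e_index)
  finally show "(chev_e n i * chev_e n i) $$ (p, q) = 0\<^sub>m (2 * n) (2 * n) $$ (p, q)" using pq by simp
qed simp_all

lemma mat_exp_square_zero:
  assumes A: "A \<in> carrier_mat N N" and sq: "A * A = 0\<^sub>m N N"
  shows "mat_exp A = 1\<^sub>m N + A"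
proof (rule eq_matI)
  have pow: "A ^\<^sub>m Suc (Suc k) = 0\<^sub>m N N" for k
  proof (induction k)
    case 0
    then show ?case using A sq by (simp add: left_mult_one_mat)
  next
    case (Suc k)
    then show ?case using A by simp
  qed
  fix p q assume pq: "p < dim_row (1\<^sub>m N + A)" "q < dim_col (1\<^sub>m N + A)"
  have 0: "(A ^\<^sub>m k) $$ (p, q) / fact k = 0" if "k \<notin> {0, 1}" for k
  proof -
    have "k \<noteq> 0" "k \<noteq> 1" using that by auto
    then have "k = Suc (Suc (k - 2))" by simp
    then have "A ^\<^sub>m k = 0\<^sub>m N N" using pow by metis
    then show ?thesis using pq A by simp
  qed
  have "(\<Sum>k. (A ^\<^sub>m k) $$ (p, q) / fact k) = (\<Sum>k\<in>{0, 1}. (A ^\<^sub>m k) $$ (p, q) / fact k)"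
    by (rule suminf_finite) (use 0 in auto)
  also have "\<dots> = (1\<^sub>m N + A) $$ (p, q)" using pq A by simp
  finally show "mat_exp A $$ (p, q) = (1\<^sub>m N + A) $$ (p, q)" using pq A by (simp add: mat_exp_def)
qed (use A in \<open>auto simp: mat_exp_def\<close>)

lemma smult_square_zero:
  fixes t :: complex
  assumes A: "A \<in> carrier_mat N N" and sq: "A * A = 0\<^sub>m N N"
  shows "(t \<cdot>\<^sub>m A) * (t \<cdot>\<^sub>m A) = 0\<^sub>m N N"
  using mult_smult_assoc_mat[OF A smult_carrier_mat[OF A], of t t] mult_smult_distrib[OF A A, of t] sq
  by simp

lemma x_sub_eq:
  assumes "1 \<le> i" "i \<le> n" shows "x_sub n i t = 1\<^sub>m (2 * n) + t \<cdot>\<^sub>m chev_e n i"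
  unfolding x_sub_def
  using chev_e_square[OF assms] by (intro mat_exp_square_zero smult_square_zero) simp_all

lemma y_sub_eq:
  assumes "1 \<le> i" "i \<le> n" shows "y_sub n i t = 1\<^sub>m (2 * n) + t \<cdot>\<^sub>m chev_f n i"
proof -
  have "chev_f n i * chev_f n i = 0\<^sub>m (2 * n) (2 * n)"
    unfolding chev_f_def
    using transpose_mult[OF chev_carrier(1) chev_carrier(1), of n i i] chev_e_square[OF assms] by simp
  then show ?thesis
    unfolding y_sub_def by (intro mat_exp_square_zero smult_square_zero) simp_all
qed

lemma xy_carrier [simp]:
  assumes "1 \<le> i" "i \<le> n" shows "x_sub n i t \<in> cmat n" "y_sub n i t \<in> cmat n"
  using assms by (simp_all add: x_sub_eq y_sub_eq)

lemma x_sub_index: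
  assumes "1 \<le> i" "i \<le> n" "p < 2 * n" "q < 2 * n"
  shows "x_sub n i t $$ (p, q) = (if p = q then 1 else 0) + (if p \<in> up_rows n i \<and> q = Suc p then t else 0)"
  using assms by (simp add: x_sub_eq chev_e_index carrier_matD[OF chev_carrier(1)])

lemma y_sub_index:
  assumes "1 \<le> i" "i \<le> n" "p < 2 * n" "q < 2 * n"
  shows "y_sub n i t $$ (p, q) = (if p = q then 1 else 0) + (if q \<in> up_rows n i \<and> p = Suc q then t else 0)"
  using assms by (simp add: y_sub_eq chev_f_index carrier_matD[OF chev_carrier(2)])

lemma x_sub_transpose:
  assumes "1 \<le> i" "i \<le> n" shows "transpose_mat (x_sub n i t) = y_sub n i t"
  using assms by (intro eq_matI) (auto simp: x_sub_index y_sub_index carrier_matD[OF xy_carrier(1)] carrier_matD[OF xy_carrier(2)])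

text \<open>Generators are used through their row operations only. Identities between products are
  then checked on the entries of an arbitrary right factor g.\<close>

lemma x_sub_mult:
  assumes i: "1 \<le> i" "i \<le> n" and g: "g \<in> cmat n" and pq: "p < 2 * n" "q < 2 * n"
  shows "(x_sub n i t * g) $$ (p, q) = g $$ (p, q) + (if p \<in> up_rows n i then t * g $$ (Suc p, q) else 0)"
proof -
  have "(x_sub n i t * g) $$ (p, q) = (\<Sum>r<2 * n. (if r = p then g $$ (r, q) else 0) +
      (if r = Suc p then if p \<in> up_rows n i then t * g $$ (r, q) else 0 else 0))"
    unfolding mult_index[OF xy_carrier(1)[OF i] g pq] using pq i
    by (intro sum.cong) (auto simp: x_sub_index)
  then show ?thesis using pq up_rowsD(3)[OF i, of p] by (auto simp: sum.distrib)
qed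

lemma y_sub_mult:
  assumes i: "1 \<le> i" "i \<le> n" and g: "g \<in> cmat n" and pq: "p < 2 * n" "q < 2 * n"
  shows "(y_sub n i t * g) $$ (p, q) = g $$ (p, q) + (if p \<in> dn_rows n i then t * g $$ (p - 1, q) else 0)"
proof -
  have "(y_sub n i t * g) $$ (p, q) = (\<Sum>r<2 * n. (if r = p then g $$ (r, q) else 0) +
      (if r = p - 1 then if p \<in> dn_rows n i then t * g $$ (r, q) else 0 else 0))"
    unfolding mult_index[OF xy_carrier(2)[OF i] g pq]
  proof (intro sum.cong refl)
    fix r assume "r \<in> {..<2 * n}"
    moreover have "r \<in> up_rows n i \<and> p = Suc r \<longleftrightarrow> r = p - 1 \<and> p \<in> dn_rows n i"
      using up_rowsD(1)[OF i] dn_rowsD(1,4)[OF i] by (metis diff_Suc_1)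
    ultimately show "y_sub n i t $$ (p, r) * g $$ (r, q) = (if r = p then g $$ (r, q) else 0) +
      (if r = p - 1 then if p \<in> dn_rows n i then t * g $$ (r, q) else 0 else 0)"
      using i pq by (auto simp: y_sub_index)
  qed
  then show ?thesis using pq by (auto simp: sum.distrib)
qed

section \<open>Diagonal matrices\<close>

definition dg :: "nat \<Rightarrow> (nat \<Rightarrow> complex) \<Rightarrow> complex mat" where
  "dg n d = mat (2 * n) (2 * n) (\<lambda>(p, q). if p = q then d p else 0)"

lemma dg_carrier [simp]: "dg n d \<in> cmat n"
  by (simp add: dg_def)

lemma dg_index: "p < 2 * n \<Longrightarrow> q < 2 * n \<Longrightarrow> dg n d $$ (p, q) = (if p = q then d p else 0)"
  by (simp add: dg_def)

lemma dg_mult: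
  assumes "g \<in> cmat n" "p < 2 * n" "q < 2 * n"
  shows "(dg n d * g) $$ (p, q) = d p * g $$ (p, q)"
proof -
  have "(dg n d * g) $$ (p, q) = (\<Sum>r<2 * n. if r = p then d r * g $$ (r, q) else 0)"
    unfolding mult_index[OF dg_carrier assms] using assms by (intro sum.cong) (auto simp: dg_def)
  then show ?thesis using assms by simp
qed

lemma coroot_dg: "coroot n i t = dg n (\<lambda>p. t powi chev_h_diag n i p)"
  by (simp add: coroot_def dg_def)

lemma chev_h: "chev_h_diag n i p = (if p \<in> up_rows n i then 1 else if p \<in> dn_rows n i then -1 else 0)"
  by (simp add: chev_h_diag_def up_rows_def dn_rows_def)

lemma coroot_carrier [simp]: "coroot n i t \<in> cmat n"
  by (simp add: coroot_def)

lemma coroot_mult: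
  assumes i: "1 \<le> i" "i \<le> n" and g: "g \<in> cmat n" and pq: "p < 2 * n" "q < 2 * n"
  shows "(coroot n i t * g) $$ (p, q) =
     (if p \<in> up_rows n i then t * g $$ (p, q) else if p \<in> dn_rows n i then inverse t * g $$ (p, q) else g $$ (p, q))"
  unfolding coroot_dg dg_mult[OF g pq] chev_h by (simp add: power_int_minus)

text \<open>The condition for a diagonal matrix to preserve the symplectic form.\<close>

definition torus_diag :: "nat \<Rightarrow> (nat \<Rightarrow> complex) \<Rightarrow> bool" where
  "torus_diag n d \<longleftrightarrow> (\<forall>p<2 * n. d p * d (2 * n - 1 - p) = 1)"

lemma torus_diag_coroot:
  assumes i: "1 \<le> i" "i \<le> n" and "t \<noteq> 0"
  shows "torus_diag n (\<lambda>p. t powi chev_h_diag n i p)"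
  unfolding torus_diag_def chev_h
  using up_rows_bar[OF i] dn_rows_bar[OF i] up_rowsD(2)[OF i] \<open>t \<noteq> 0\<close>
  by (auto simp: power_int_minus)

section \<open>Membership in the symplectic group\<close>

lemma symp_form_mult:
  assumes g: "g \<in> cmat n" and pq: "p < 2 * n" "q < 2 * n"
  shows "(symp_form n * g) $$ (p, q) = (-1) ^ p * g $$ (2 * n - 1 - p, q)"
proof -
  have "(symp_form n * g) $$ (p, q) = (\<Sum>r<2 * n. symp_form n $$ (p, r) * g $$ (r, q))"
    using g pq by (intro mult_index) (auto simp: symp_form_def)
  also have "\<dots> = (\<Sum>r<2 * n. if r = 2 * n - 1 - p then (-1) ^ p * g $$ (r, q) else 0)"
    using pq by (intro sum.cong) (auto simp: symp_form_def)
  finally show ?thesis using pq by simp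
qed

lemma symp_form_carrier [simp]: "symp_form n \<in> cmat n"
  by (simp add: symp_form_def)

lemma symp_form_index:
  "p < 2 * n \<Longrightarrow> q < 2 * n \<Longrightarrow> symp_form n $$ (p, q) = (if q = 2 * n - 1 - p then (-1) ^ p else 0)"
  by (auto simp: symp_form_def)

lemma Sp_memI:
  assumes "g \<in> cmat n"
    "\<And>p q. p < 2 * n \<Longrightarrow> q < 2 * n \<Longrightarrow>
       (transpose_mat g * (symp_form n * g)) $$ (p, q) = (if q = 2 * n - 1 - p then (-1) ^ p else 0)"
  shows "g \<in> carrier (Sp n)"
proof -
  have "transpose_mat g * symp_form n * g = transpose_mat g * (symp_form n * g)"
    using assms(1) by (intro assoc_mult_mat) auto
  also have "\<dots> = symp_form n"
    using assms by (intro mat_eqI2[of _ n]) (simp_all add: symp_form_index)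
  finally show ?thesis using assms(1) by (simp add: Sp_def)
qed

lemma x_sub_Sp:
  assumes i: "1 \<le> i" "i \<le> n" shows "x_sub n i t \<in> carrier (Sp n)"
proof (rule Sp_memI)
  fix p q assume pq: "p < 2 * n" "q < 2 * n"
  let ?M = "symp_form n * x_sub n i t"
  have M: "?M \<in> cmat n" using i by simp
  \<comment> \<open>Row r of this product is, up to sign, row 2n - 1 - r of the generator; passing
    to the barred index exchanges \<open>up_rows\<close> and \<open>dn_rows\<close>.\<close>
  have M_idx: "?M $$ (r, q) = (-1) ^ r * ((if q = 2 * n - 1 - r then 1 else 0) +
      (if r \<in> dn_rows n i \<and> q = Suc (2 * n - 1 - r) then t else 0))" if "r < 2 * n" for r
    using that pq i up_rows_bar[OF i that] by (simp add: symp_form_mult x_sub_index)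
  show "(transpose_mat (x_sub n i t) * ?M) $$ (p, q) = (if q = 2 * n - 1 - p then (-1) ^ p else 0)"
  proof (cases "p \<in> dn_rows n i")
    case True
    obtain r where r: "p = Suc r" using dn_rowsD(4)[OF i True] by metis
    have "r \<notin> dn_rows n i" "2 * n - 1 - r = Suc (2 * n - 1 - p)" "r < 2 * n"
      using dn_rowsD(5)[OF i True] r pq by auto
    then have Mr: "?M $$ (r, q) = - ((-1) ^ p) * (if q = Suc (2 * n - 1 - p) then 1 else 0)"
      by (simp add: M_idx r)
    show ?thesis
      unfolding x_sub_transpose[OF i] y_sub_mult[OF i M pq] M_idx[OF pq(1)]
      using True Mr by (simp add: r)
  next
    case False
    then show ?thesis
      unfolding x_sub_transpose[OF i] y_sub_mult[OF i M pq] M_idx[OF pq(1)] by simp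
  qed
qed (use i in simp)

lemma transpose_y_sub:
  assumes "1 \<le> i" "i \<le> n" shows "transpose_mat (y_sub n i t) = x_sub n i t"
  using x_sub_transpose[OF assms] by (metis transpose_transpose)

lemma y_sub_Sp:
  assumes i: "1 \<le> i" "i \<le> n" shows "y_sub n i t \<in> carrier (Sp n)"
proof (rule Sp_memI)
  fix p q assume pq: "p < 2 * n" "q < 2 * n"
  let ?M = "symp_form n * y_sub n i t"
  have M: "?M \<in> cmat n" using i by simp
  have M_idx: "?M $$ (r, q) = (-1) ^ r * ((if q = 2 * n - 1 - r then 1 else 0) +
      (if r \<in> up_rows n i \<and> 2 * n - 1 - r = Suc q then t else 0))" if "r < 2 * n" for r
  proof -
    have "q \<in> up_rows n i \<and> 2 * n - 1 - r = Suc q \<longleftrightarrow> r \<in> up_rows n i \<and> 2 * n - 1 - r = Suc q"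
      using Suc_dn_rows[OF i, of q] dn_rows_bar[OF i that] by auto
    then show ?thesis
      using that pq i by (auto simp: symp_form_mult y_sub_index)
  qed
  show "(transpose_mat (y_sub n i t) * ?M) $$ (p, q) = (if q = 2 * n - 1 - p then (-1) ^ p else 0)"
  proof (cases "p \<in> up_rows n i")
    case True
    have "Suc p \<notin> up_rows n i" "Suc p < 2 * n" "2 * n - 1 - p = Suc q \<longleftrightarrow> q = 2 * n - 1 - Suc p"
      using up_rowsD[OF i True] pq by auto
    then have Mp: "?M $$ (Suc p, q) = - ((-1) ^ p) * (if 2 * n - 1 - p = Suc q then 1 else 0)"
      by (simp add: M_idx)
    show ?thesis
      unfolding transpose_y_sub[OF i] x_sub_mult[OF i M pq] M_idx[OF pq(1)]
      using True Mp by simp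
  next
    case False
    then show ?thesis
      unfolding transpose_y_sub[OF i] x_sub_mult[OF i M pq] M_idx[OF pq(1)] by simp
  qed
qed (use i in simp)

lemma dg_Sp:
  assumes "torus_diag n d" shows "dg n d \<in> carrier (Sp n)"
proof (rule Sp_memI)
  fix p q assume pq: "p < 2 * n" "q < 2 * n"
  have M: "symp_form n * dg n d \<in> cmat n" by simp
  have tr: "transpose_mat (dg n d) = dg n d" by (intro eq_matI) (auto simp: dg_def)
  show "(transpose_mat (dg n d) * (symp_form n * dg n d)) $$ (p, q)
      = (if q = 2 * n - 1 - p then (-1) ^ p else 0)"
    unfolding tr dg_mult[OF M pq] symp_form_mult[OF dg_carrier pq]
    using pq assms by (auto simp: dg_index torus_diag_def)
qed simp

lemma symp_form_square: "symp_form n * symp_form n = (-1) \<cdot>\<^sub>m 1\<^sub>m (2 * n)"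
proof (rule eq_matI)
  fix p q assume "p < dim_row ((-1) \<cdot>\<^sub>m 1\<^sub>m (2 * n) :: complex mat)"
    "q < dim_col ((-1) \<cdot>\<^sub>m 1\<^sub>m (2 * n) :: complex mat)"
  then have pq: "p < 2 * n" "q < 2 * n" by auto
  have "(-1 :: complex) ^ p * (-1) ^ (2 * n - 1 - p) = (-1) ^ (2 * n - 1)"
    using pq by (simp add: power_add[symmetric])
  also have "\<dots> = -1" using pq by simp
  finally show "(symp_form n * symp_form n) $$ (p, q) = ((-1) \<cdot>\<^sub>m 1\<^sub>m (2 * n)) $$ (p, q)"
    unfolding symp_form_mult[OF symp_form_carrier pq] using pq by (auto simp: symp_form_index)
qed (simp_all add: symp_form_def)

lemma Sp_mult_closed:
  assumes "g \<in> carrier (Sp n)" "h \<in> carrier (Sp n)" shows "g * h \<in> carrier (Sp n)"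
proof -
  let ?J = "symp_form n"
  have g: "g \<in> cmat n" "transpose_mat g * ?J * g = ?J" and h: "h \<in> cmat n" "transpose_mat h * ?J * h = ?J"
    using assms by (auto simp: Sp_def)
  have "transpose_mat (g * h) * ?J * (g * h) = transpose_mat h * (transpose_mat g * ?J * g) * h"
    using g(1) h(1) by (simp add: transpose_mult[OF g(1) h(1)] assoc_mult_mat[of _ "2 * n" "2 * n" _ "2 * n" _ "2 * n"])
  then show ?thesis using g h by (simp add: Sp_def)
qed

lemma Sp_simps [simp]:
  "g \<otimes>\<^bsub>Sp n\<^esub> h = g * h" "\<one>\<^bsub>Sp n\<^esub> = 1\<^sub>m (2 * n)"
  by (simp_all add: Sp_def)

lemma Sp_carrier_mat: "g \<in> carrier (Sp n) \<Longrightarrow> g \<in> cmat n"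
  by (simp add: Sp_def)

lemma Sp_group: "group (Sp n)"
proof (rule groupI)
  let ?J = "symp_form n"
  fix g assume g0: "g \<in> carrier (Sp n)"
  then have g: "g \<in> cmat n" "transpose_mat g * ?J * g = ?J" by (auto simp: Sp_def)
  \<comment> \<open>From g^T J g = J and J^2 = -1, the inverse of g is -J g^T J.\<close>
  define L where "L = (-1) \<cdot>\<^sub>m (?J * (transpose_mat g * ?J))"
  have L: "L \<in> cmat n" using g unfolding L_def by auto
  have "L * g = (-1) \<cdot>\<^sub>m (?J * (transpose_mat g * ?J * g))"
    using g(1) by (simp add: L_def assoc_mult_mat[of _ "2 * n" "2 * n" _ "2 * n" _ "2 * n"]
      mult_smult_assoc_mat[of _ "2 * n" "2 * n" _ "2 * n"])
  also have "\<dots> = 1\<^sub>m (2 * n)"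
    unfolding g(2) symp_form_square by (intro eq_matI) auto
  finally have Lg: "L * g = 1\<^sub>m (2 * n)" .
  then have gL: "g * L = 1\<^sub>m (2 * n)" using mat_mult_left_right_inverse[OF L g(1)] by simp
  \<comment> \<open>Replacing J by g^T J g reduces the claim to g L = 1.\<close>
  have "transpose_mat L * ?J * L = transpose_mat L * (transpose_mat g * ?J * g) * L" using g(2) by simp
  also have "\<dots> = transpose_mat (g * L) * ?J * (g * L)"
    using g(1) L by (simp add: transpose_mult[OF g(1) L] assoc_mult_mat[of _ "2 * n" "2 * n" _ "2 * n" _ "2 * n"])
  also have "\<dots> = ?J"
    by (simp add: gL left_mult_one_mat[OF symp_form_carrier] right_mult_one_mat[OF symp_form_carrier])
  finally have "L \<in> carrier (Sp n)" using L by (simp add: Sp_def)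
  then show "\<exists>y\<in>carrier (Sp n). y \<otimes>\<^bsub>Sp n\<^esub> g = \<one>\<^bsub>Sp n\<^esub>" using Lg by (auto simp: Sp_def)
next
  fix x y z assume "x \<in> carrier (Sp n)" "y \<in> carrier (Sp n)" "z \<in> carrier (Sp n)"
  then show "x \<otimes>\<^bsub>Sp n\<^esub> y \<otimes>\<^bsub>Sp n\<^esub> z = x \<otimes>\<^bsub>Sp n\<^esub> (y \<otimes>\<^bsub>Sp n\<^esub> z)"
    using Sp_carrier_mat by (simp add: assoc_mult_mat[of _ "2 * n" "2 * n" _ "2 * n" _ "2 * n"])
next
  show "\<one>\<^bsub>Sp n\<^esub> \<in> carrier (Sp n)"
    by (simp add: Sp_def left_mult_one_mat[OF symp_form_carrier] right_mult_one_mat[OF symp_form_carrier])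
qed (auto simp: Sp_mult_closed left_mult_one_mat[OF Sp_carrier_mat])

lemma mult_one_right: "g \<in> cmat n \<Longrightarrow> g * 1\<^sub>m (2 * n) = g"
  by simp

section \<open>Relations between the generators\<close>

lemma x_sub_add:
  assumes i: "1 \<le> i" "i \<le> n" and g: "g \<in> cmat n"
  shows "x_sub n i s * (x_sub n i t * g) = x_sub n i (s + t) * g"
proof (rule mat_eqI2[of _ n])
  fix p q assume pq: "p < 2 * n" "q < 2 * n"
  have c: "x_sub n i t * g \<in> cmat n" using assms by simp
  show "(x_sub n i s * (x_sub n i t * g)) $$ (p, q) = (x_sub n i (s + t) * g) $$ (p, q)"
    unfolding x_sub_mult[OF i c pq] x_sub_mult[OF i g pq]
    using x_sub_mult[OF i g _ pq(2), of "Suc p"] up_rowsD(3,4)[OF i, of p]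
    by (simp add: algebra_simps)
qed (use assms in simp_all)

lemma y_sub_add:
  assumes i: "1 \<le> i" "i \<le> n" and g: "g \<in> cmat n"
  shows "y_sub n i s * (y_sub n i t * g) = y_sub n i (s + t) * g"
proof (rule mat_eqI2[of _ n])
  fix p q assume pq: "p < 2 * n" "q < 2 * n"
  have c: "y_sub n i t * g \<in> cmat n" using assms by simp
  have "p - 1 < 2 * n" using pq by simp
  then show "(y_sub n i s * (y_sub n i t * g)) $$ (p, q) = (y_sub n i (s + t) * g) $$ (p, q)"
    unfolding y_sub_mult[OF i c pq] y_sub_mult[OF i g pq] y_sub_mult[OF i g \<open>p - 1 < 2 * n\<close> pq(2)]
    using dn_rowsD(5)[OF i, of p] by (auto simp: algebra_simps)
qed (use assms in simp_all)

lemma xy_sub_0: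
  assumes i: "1 \<le> i" "i \<le> n" shows "x_sub n i 0 = 1\<^sub>m (2 * n)" "y_sub n i 0 = 1\<^sub>m (2 * n)"
  using assms by (auto simp: x_sub_index y_sub_index intro!: mat_eqI2[of _ n])

lemma inv_xy:
  assumes i: "1 \<le> i" "i \<le> n"
  shows "inv\<^bsub>Sp n\<^esub> x_sub n i t = x_sub n i (- t)" "inv\<^bsub>Sp n\<^esub> y_sub n i t = y_sub n i (- t)"
proof -
  show "inv\<^bsub>Sp n\<^esub> x_sub n i t = x_sub n i (- t)"
    using x_sub_add[OF i, of "1\<^sub>m (2 * n)" "- t" t] i
    by (intro group.inv_equality[OF Sp_group]) (auto simp: x_sub_Sp xy_sub_0 mult_one_right)
  show "inv\<^bsub>Sp n\<^esub> y_sub n i t = y_sub n i (- t)"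
    using y_sub_add[OF i, of "1\<^sub>m (2 * n)" "- t" t] i
    by (intro group.inv_equality[OF Sp_group]) (auto simp: y_sub_Sp xy_sub_0 mult_one_right)
qed

lemma x_sub_y_sub_commute:
  assumes i: "1 \<le> i" "i \<le> n" and j: "1 \<le> j" "j \<le> n" and "i \<noteq> j" and g: "g \<in> cmat n"
  shows "x_sub n i s * (y_sub n j t * g) = y_sub n j t * (x_sub n i s * g)"
proof (rule mat_eqI2[of _ n])
  fix p q assume pq: "p < 2 * n" "q < 2 * n"
  have c: "y_sub n j t * g \<in> cmat n" "x_sub n i s * g \<in> cmat n"
    using assms by simp_all
  have "p - 1 < 2 * n" using pq by simp
  have "Suc p \<notin> dn_rows n j" if "p \<in> up_rows n i"
    using Suc_dn_rows[OF j] that i j \<open>i \<noteq> j\<close> by (auto simp: up_rows_def)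
  moreover have "p - 1 \<notin> up_rows n i" if "p \<in> dn_rows n j"
    using dn_rowsD(1)[OF j that] i j \<open>i \<noteq> j\<close> by (auto simp: up_rows_def)
  ultimately show "(x_sub n i s * (y_sub n j t * g)) $$ (p, q) = (y_sub n j t * (x_sub n i s * g)) $$ (p, q)"
    unfolding x_sub_mult[OF i c(1) pq] y_sub_mult[OF j c(2) pq] y_sub_mult[OF j g pq] x_sub_mult[OF i g pq]
    using up_rowsD(3)[OF i, of p] pq i j g
    by (auto simp: x_sub_mult y_sub_mult simp del: index_mult_mat(1))
qed (use assms in simp_all)

text \<open>The Gauss decomposition in SL_2, carried out on the pairs of rows p, p + 1 with p in
  \<open>up_rows n i\<close>.\<close>

lemma x_sub_y_sub_gauss:
  assumes i: "1 \<le> i" "i \<le> n" and g: "g \<in> cmat n" and ne: "1 + s * t \<noteq> 0"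
  shows "x_sub n i s * (y_sub n i t * g) =
    y_sub n i (t / (1 + s * t)) * (coroot n i (1 + s * t) * (x_sub n i (s / (1 + s * t)) * g))"
proof (rule mat_eqI2[of _ n])
  fix p q assume pq: "p < 2 * n" "q < 2 * n"
  let ?x = "x_sub n i (s / (1 + s * t)) * g"
  let ?hx = "coroot n i (1 + s * t) * ?x"
  have c: "y_sub n i t * g \<in> cmat n" "?x \<in> cmat n" "?hx \<in> cmat n"
    using assms by simp_all
  have p1: "p - 1 < 2 * n" using pq by simp
  note simps = x_sub_mult[OF i c(1) pq] y_sub_mult[OF i g pq] y_sub_mult[OF i c(3) pq]
    coroot_mult[OF i c(2) pq] coroot_mult[OF i c(2) p1 pq(2)] x_sub_mult[OF i g pq] x_sub_mult[OF i g p1 pq(2)]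
  consider "p \<in> up_rows n i" | "p \<in> dn_rows n i" | "p \<notin> up_rows n i" "p \<notin> dn_rows n i" by blast
  then show "(x_sub n i s * (y_sub n i t * g)) $$ (p, q) = (y_sub n i (t / (1 + s * t)) * ?hx) $$ (p, q)"
  proof cases
    case 1
    note u = up_rowsD[OF i 1]
    have "s * g $$ (Suc p, q) + g $$ (p, q) + s * t * g $$ (p, q) =
       (1 + s * t) * (g $$ (p, q) + s / (1 + s * t) * g $$ (Suc p, q))"
      using ne by (simp add: field_simps)
    then show ?thesis
      unfolding simps y_sub_mult[OF i g u(3) pq(2)] using 1 u by (simp add: algebra_simps)
  next
    case 2
    note d = dn_rowsD[OF i 2]
    have gauss: "u + t * v = inverse w * u + t / w * (w * (v + s / w * u))"
      if "w = 1 + s * t" "w \<noteq> 0" for u v w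
    proof -
      have "inverse w * u + t / w * (w * (v + s / w * u)) = (1 + s * t) / w * u + t * v"
        using that(2) by (simp add: field_simps)
      then show ?thesis using that by simp
    qed
    have "g $$ (p, q) + t * g $$ (p - 1, q) = inverse (1 + s * t) * g $$ (p, q) +
       t / (1 + s * t) * ((1 + s * t) * (g $$ (p - 1, q) + s / (1 + s * t) * g $$ (p, q)))"
      by (rule gauss) (use ne in auto)
    then show ?thesis unfolding simps using 2 d by simp
  next
    case 3
    then show ?thesis unfolding simps by simp
  qed
qed (use assms in simp_all)

section \<open>Evaluation of the principal minor\<close>

lemma mprod_Nil [simp]: "mprod n [] = 1\<^sub>m (2 * n)"
  and mprod_Cons [simp]: "mprod n (g # gs) = g * mprod n gs"
  by (simp_all add: mprod_def)

lemma mult_one_left: "g \<in> cmat n \<Longrightarrow> 1\<^sub>m (2 * n) * g = g"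
  by simp

lemma mprod_carrier: "set gs \<subseteq> cmat n \<Longrightarrow> mprod n gs \<in> cmat n"
  by (induction gs) auto

lemma assoc_cmat: "f \<in> cmat n \<Longrightarrow> g \<in> cmat n \<Longrightarrow> h \<in> cmat n \<Longrightarrow> f * g * h = f * (g * h)"
  by (rule assoc_mult_mat)

lemma mprod_append:
  assumes "set gs \<subseteq> cmat n" "set hs \<subseteq> cmat n"
  shows "mprod n (gs @ hs) = mprod n gs * mprod n hs"
  using assms
proof (induction gs)
  case (Cons g gs)
  then show ?case by (simp add: assoc_cmat[of _ n] mprod_carrier)
qed (simp add: mprod_carrier mult_one_left)

definition letters :: "nat \<Rightarrow> (nat \<Rightarrow> complex \<Rightarrow> complex mat) \<Rightarrow> complex mat set" where
  "letters n s = {s i t |i t. 1 \<le> i \<and> i \<le> n}"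

lemma generate_letters_mult:
  assumes "1 \<le> i" "i \<le> n" "u \<in> generate (Sp n) (letters n s)"
  shows "s i t * u \<in> generate (Sp n) (letters n s)"
  using generate.eng[OF generate.incl assms(3), of "s i t"] assms(1,2) by (auto simp: letters_def)

text \<open>\<open>generate\<close> allows arbitrary products and inverses, whereas the intended
  induction adds one letter on the left. Inverses of letters are letters, and the strengthened claim
  that left multiplication by h preserves Q passes through products.\<close>

lemma generate_letters_induct:
  assumes u: "u \<in> generate (Sp n) (letters n s)"
    and s: "\<And>i t. 1 \<le> i \<Longrightarrow> i \<le> n \<Longrightarrow> s i t \<in> cmat n"
      "\<And>i t. 1 \<le> i \<Longrightarrow> i \<le> n \<Longrightarrow> inv\<^bsub>Sp n\<^esub> s i t = s i (- t)"
    and one: "P (1\<^sub>m (2 * n))"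
    and mult: "\<And>i t u. 1 \<le> i \<Longrightarrow> i \<le> n \<Longrightarrow> u \<in> generate (Sp n) (letters n s) \<Longrightarrow> P u \<Longrightarrow> P (s i t * u)"
  shows "P u"
proof -
  define Q where "Q g \<longleftrightarrow> g \<in> cmat n \<and> g \<in> generate (Sp n) (letters n s) \<and> P g" for g
  have one': "1\<^sub>m (2 * n) \<in> generate (Sp n) (letters n s)"
    using generate.one[of "Sp n"] by simp
  have Q1: "Q (s i t * g)" if "1 \<le> i" "i \<le> n" "Q g" for i t g
    using that s(1) mult generate_letters_mult unfolding Q_def by simp
  have "h \<in> cmat n \<and> (\<forall>g. Q g \<longrightarrow> Q (h * g))" if "h \<in> generate (Sp n) (letters n s)" for h
    using that
  proof (induction rule: generate.induct)
    case one
    then show ?case by (simp add: Q_def mult_one_left)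
  next
    case (incl h)
    then show ?case using s(1) Q1 unfolding letters_def by blast
  next
    case (inv h)
    then obtain i t where "h = s i t" "1 \<le> i" "i \<le> n" unfolding letters_def by blast
    then show ?case using s Q1 by simp
  next
    case (eng h1 h2)
    then have "h1 * h2 * g = h1 * (h2 * g)" if "Q g" for g
      using that by (simp add: assoc_cmat[of _ n] Q_def)
    then show ?case using eng by simp
  qed
  from this[OF u] have "u \<in> cmat n" "Q (u * 1\<^sub>m (2 * n))"
    using one one' by (auto simp: Q_def)
  then show ?thesis by (simp add: Q_def mult_one_right)
qed

lemma U_letters: "U_minus n = generate (Sp n) (letters n (y_sub n))"
    "U_plus n = generate (Sp n) (letters n (x_sub n))"
  by (simp_all add: U_minus_def U_plus_def letters_def)

lemma U_one: "1\<^sub>m (2 * n) \<in> U_minus n" "1\<^sub>m (2 * n) \<in> U_plus n"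
  unfolding U_letters using generate.one[of "Sp n"] by simp_all

lemma U_minusI: "1 \<le> i \<Longrightarrow> i \<le> n \<Longrightarrow> u \<in> U_minus n \<Longrightarrow> y_sub n i t * u \<in> U_minus n"
  unfolding U_letters by (rule generate_letters_mult)

lemma U_plusI: "1 \<le> i \<Longrightarrow> i \<le> n \<Longrightarrow> u \<in> U_plus n \<Longrightarrow> x_sub n i t * u \<in> U_plus n"
  unfolding U_letters by (rule generate_letters_mult)

lemma U_minus_induct [consumes 1, case_names one mult]:
  assumes "u \<in> U_minus n" "P (1\<^sub>m (2 * n))"
    "\<And>i t u. 1 \<le> i \<Longrightarrow> i \<le> n \<Longrightarrow> u \<in> U_minus n \<Longrightarrow> P u \<Longrightarrow> P (y_sub n i t * u)"
  shows "P u"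
  by (rule generate_letters_induct[OF assms(1)[unfolded U_letters]])
     (use assms(2,3) in \<open>simp_all add: inv_xy U_letters\<close>)

lemma U_plus_induct [consumes 1, case_names one mult]:
  assumes "u \<in> U_plus n" "P (1\<^sub>m (2 * n))"
    "\<And>i t u. 1 \<le> i \<Longrightarrow> i \<le> n \<Longrightarrow> u \<in> U_plus n \<Longrightarrow> P u \<Longrightarrow> P (x_sub n i t * u)"
  shows "P u"
  by (rule generate_letters_induct[OF assms(1)[unfolded U_letters]])
     (use assms(2,3) in \<open>simp_all add: inv_xy U_letters\<close>)

lemma U_carrier: "u \<in> U_minus n \<Longrightarrow> u \<in> carrier (Sp n)" "v \<in> U_plus n \<Longrightarrow> v \<in> carrier (Sp n)"
proof -
  have 1: "1\<^sub>m (2 * n) \<in> carrier (Sp n)"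
    using group.is_monoid[OF Sp_group, THEN monoid.one_closed] by simp
  show "u \<in> U_minus n \<Longrightarrow> u \<in> carrier (Sp n)"
    by (induction rule: U_minus_induct) (auto simp: 1 y_sub_Sp intro: Sp_mult_closed)
  show "v \<in> U_plus n \<Longrightarrow> v \<in> carrier (Sp n)"
    by (induction rule: U_plus_induct) (auto simp: 1 x_sub_Sp intro: Sp_mult_closed)
qed

lemmas U_cmat = U_carrier[THEN Sp_carrier_mat]

section \<open>The torus and its action on the unipotent letters\<close>

lemma dg_dg: "dg n d * dg n e = dg n (\<lambda>p. d p * e p)"
  by (rule mat_eqI2[of _ n]) (simp_all add: dg_mult[OF dg_carrier] dg_index)

lemma dg_cong: "(\<And>p. p < 2 * n \<Longrightarrow> d p = e p) \<Longrightarrow> dg n d = dg n e"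
  by (rule mat_eqI2[of _ n]) (simp_all add: dg_index)

lemma dg_one: "dg n (\<lambda>_. 1) = 1\<^sub>m (2 * n)"
  by (rule mat_eqI2[of _ n]) (simp_all add: dg_index)

definition torus_fun :: "nat \<Rightarrow> (nat \<Rightarrow> complex) \<Rightarrow> nat \<Rightarrow> complex" where
  "torus_fun n a p = (\<Prod>j = 1..n. a j powi chev_h_diag n j p)"

lemma torus_elt_dg: "torus_elt n a = dg n (torus_fun n a)"
proof -
  have "mprod n (map (\<lambda>j. coroot n j (a j)) js) = dg n (\<lambda>p. \<Prod>j\<leftarrow>js. a j powi chev_h_diag n j p)" for js
    by (induction js) (simp_all add: dg_one coroot_dg dg_dg)
  moreover have "(\<Prod>j\<leftarrow>[1..<Suc n]. a j powi chev_h_diag n j p) = torus_fun n a p" for p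
    unfolding torus_fun_def by (subst prod.distinct_set_conv_list[symmetric])
      (auto simp: atLeastLessThanSuc_atLeastAtMost simp del: upt_Suc)
  ultimately show ?thesis unfolding torus_elt_def by simp
qed

lemma torus_diag_torus_fun:
  assumes "\<forall>j\<in>{1..n}. a j \<noteq> 0" shows "torus_diag n (torus_fun n a)"
proof -
  have "torus_fun n a p * torus_fun n a (2 * n - 1 - p) = 1" if "p < 2 * n" for p
    unfolding torus_fun_def prod.distrib[symmetric]
    using torus_diag_coroot[of _ n] assms that by (intro prod.neutral) (auto simp: torus_diag_def)
  then show ?thesis by (simp add: torus_diag_def)
qed

lemma torus_diag_nonzero: "torus_diag n d \<Longrightarrow> p < 2 * n \<Longrightarrow> d p \<noteq> 0"
  unfolding torus_diag_def by (metis mult_zero_left zero_neq_one)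

lemma torus_fun_update:
  assumes i: "i \<in> {1..n}" and "t \<noteq> 0"
  shows "t powi chev_h_diag n i p * torus_fun n a p = torus_fun n (a(i := t * a i)) p"
proof -
  have rest: "(\<Prod>j\<in>{1..n} - {i}. (a(i := t * a i)) j powi chev_h_diag n j p) =
     (\<Prod>j\<in>{1..n} - {i}. a j powi chev_h_diag n j p)"
    by (intro prod.cong) auto
  show ?thesis
    unfolding torus_fun_def prod.remove[OF finite_atLeastAtMost i] rest
    by (simp add: power_int_mult_distrib)
qed

text \<open>The factor \<open>d i / d (i - 1)\<close> is \<alpha>_i(d)^(-1). For i < n the generator
  acts on two pairs of rows, and \<open>torus_diag\<close> makes their ratios equal.\<close>

lemma dg_y_sub:
  assumes i: "1 \<le> i" "i \<le> n" and d: "torus_diag n d" and g: "g \<in> cmat n"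
  shows "dg n d * (y_sub n i s * g) = y_sub n i (s * d i / d (i - 1)) * (dg n d * g)"
proof (rule mat_eqI2[of _ n])
  fix p q assume pq: "p < 2 * n" "q < 2 * n"
  have c: "y_sub n i s * g \<in> cmat n" "dg n d * g \<in> cmat n" using i g by simp_all
  have p1: "p - 1 < 2 * n" using pq by simp
  have "d p * s = s * d i / d (i - 1) * d (p - 1)" if "p \<in> dn_rows n i"
  proof (cases "p = i")
    case True
    then show ?thesis using torus_diag_nonzero[OF d p1] by simp
  next
    case False
    then have p: "p = 2 * n - i" using that by (simp add: dn_rows_def)
    have "i < 2 * n" "i - 1 < 2 * n" "2 * n - 1 - (i - 1) = p" "2 * n - 1 - i = p - 1"
      using i p by auto
    then have "d (i - 1) * d p = 1" "d i * d (p - 1) = 1"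
      using d unfolding torus_diag_def by metis+
    then show ?thesis
      using torus_diag_nonzero[OF d \<open>i - 1 < 2 * n\<close>] by (simp add: field_simps)
  qed
  then show "(dg n d * (y_sub n i s * g)) $$ (p, q) = (y_sub n i (s * d i / d (i - 1)) * (dg n d * g)) $$ (p, q)"
    unfolding dg_mult[OF c(1) pq] y_sub_mult[OF i g pq] y_sub_mult[OF i c(2) pq] dg_mult[OF g pq] dg_mult[OF g p1 pq(2)]
    by (simp add: distrib_left mult.assoc[symmetric])
qed (use i g in simp_all)

lemma x_sub_dg:
  assumes i: "1 \<le> i" "i \<le> n" and d: "torus_diag n d" and g: "g \<in> cmat n"
  shows "x_sub n i s * (dg n d * g) = dg n d * (x_sub n i (s * d i / d (i - 1)) * g)"
proof (rule mat_eqI2[of _ n])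
  fix p q assume pq: "p < 2 * n" "q < 2 * n"
  have c: "x_sub n i (s * d i / d (i - 1)) * g \<in> cmat n" "dg n d * g \<in> cmat n" using i g by simp_all
  have "s * d (Suc p) = d p * (s * d i / d (i - 1))" if "p \<in> up_rows n i"
  proof (cases "p = i - 1")
    case True
    then show ?thesis using torus_diag_nonzero[OF d pq(1)] i by simp
  next
    case False
    then have p: "p = 2 * n - i - 1" using that by (simp add: up_rows_def)
    have "i < 2 * n" "i - 1 < 2 * n" "2 * n - 1 - (i - 1) = Suc p" "2 * n - 1 - i = p"
      using i p by auto
    then have "d (i - 1) * d (Suc p) = 1" "d i * d p = 1"
      using d unfolding torus_diag_def by metis+
    then show ?thesis
      using torus_diag_nonzero[OF d \<open>i - 1 < 2 * n\<close>] by (simp add: field_simps)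
  qed
  then show "(x_sub n i s * (dg n d * g)) $$ (p, q) = (dg n d * (x_sub n i (s * d i / d (i - 1)) * g)) $$ (p, q)"
    unfolding dg_mult[OF c(1) pq] x_sub_mult[OF i g pq] x_sub_mult[OF i c(2) pq] dg_mult[OF g pq]
    using dg_mult[OF g _ pq(2), of "Suc p"] up_rowsD(3)[OF i, of p]
    by (simp add: distrib_left mult.assoc[symmetric])
qed (use i g in simp_all)

lemma dg_U_minus:
  assumes "u \<in> U_minus n" and d: "torus_diag n d"
  shows "\<exists>u'\<in>U_minus n. dg n d * u = u' * dg n d"
  using assms(1)
proof (induction rule: U_minus_induct)
  case one
  then show ?case by (intro bexI[of _ "1\<^sub>m (2 * n)"])
      (auto simp: U_one left_mult_one_mat[OF dg_carrier] right_mult_one_mat[OF dg_carrier])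
next
  case (mult i t u)
  then obtain u' where u': "u' \<in> U_minus n" "dg n d * u = u' * dg n d" by blast
  have "dg n d * (y_sub n i t * u) = y_sub n i (t * d i / d (i - 1)) * u' * dg n d"
    using mult u' by (simp add: dg_y_sub[OF _ _ d] U_cmat assoc_cmat[of _ n])
  then show ?case using U_minusI mult u' by blast
qed

text \<open>For \<open>\<tau>\<close> near 0 the Gauss decomposition applies at every letter of \<open>u\<close>.\<close>

lemma x_sub_U_minus:
  assumes "u \<in> U_minus n"
  shows "\<forall>i\<in>{1..n}. \<forall>\<^sub>F \<tau> in nhds 0. \<exists>u'\<in>U_minus n. \<exists>t s. t \<noteq> 0 \<and>
           x_sub n i \<tau> * u = u' * (coroot n i t * x_sub n i s)"
  using assms
proof (induction rule: U_minus_induct)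
  case one
  have "x_sub n i \<tau> * 1\<^sub>m (2 * n) = 1\<^sub>m (2 * n) * (coroot n i 1 * x_sub n i \<tau>)" if "i \<in> {1..n}" for i \<tau>
    using that by (simp add: coroot_dg dg_one mult_one_left
        mult_one_right)
  then show ?case using U_one(1) by (intro ballI always_eventually allI) (metis zero_neq_one)
next
  case (mult j \<sigma> u)
  have u: "u \<in> cmat n" using mult U_cmat by blast
  show ?case
  proof
    fix i assume i: "i \<in> {1..n}"
    then have i': "1 \<le> i" "i \<le> n" by auto
    show "\<forall>\<^sub>F \<tau> in nhds 0. \<exists>u'\<in>U_minus n. \<exists>t s. t \<noteq> 0 \<and>
           x_sub n i \<tau> * (y_sub n j \<sigma> * u) = u' * (coroot n i t * x_sub n i s)"
    proof (cases "i = j")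
      case False
      show ?thesis
        using mult.IH[rule_format, OF i]
      proof (eventually_elim)
        case (elim \<tau>)
        then obtain u' t s where *: "u' \<in> U_minus n" "t \<noteq> 0"
          "x_sub n i \<tau> * u = u' * (coroot n i t * x_sub n i s)" by blast
        have "x_sub n i \<tau> * (y_sub n j \<sigma> * u) = (y_sub n j \<sigma> * u') * (coroot n i t * x_sub n i s)"
          using * mult i' False u
          by (simp add: x_sub_y_sub_commute U_cmat assoc_cmat[of _ n])
        then show ?case using * U_minusI mult by blast
      qed
    next
      case True
      \<comment> \<open>Moving x_i past y_i replaces \<tau> by \<tau> / (1 + \<tau> \<sigma>). This
        tends to 0 with \<tau>, so the induction hypothesis can be pulled back along it.\<close>
      have "((\<lambda>\<tau>. \<tau> / (1 + \<tau> * \<sigma>)) \<longlongrightarrow> 0 / (1 + 0 * \<sigma>)) (nhds 0)"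
        by (intro tendsto_intros filterlim_ident) auto
      then have "filterlim (\<lambda>\<tau>. \<tau> / (1 + \<tau> * \<sigma>)) (nhds 0) (nhds 0)" by simp
      from eventually_compose_filterlim[OF mult.IH[rule_format, OF i] this]
      have 1: "\<forall>\<^sub>F \<tau> in nhds 0. \<exists>u'\<in>U_minus n. \<exists>t s. t \<noteq> 0 \<and>
           x_sub n i (\<tau> / (1 + \<tau> * \<sigma>)) * u = u' * (coroot n i t * x_sub n i s)" .
      have "((\<lambda>\<tau>. 1 + \<tau> * \<sigma>) \<longlongrightarrow> 1 + 0 * \<sigma>) (nhds 0)"
        by (intro tendsto_intros filterlim_ident)
      then have 2: "\<forall>\<^sub>F \<tau> in nhds 0. 1 + \<tau> * \<sigma> \<noteq> 0"
        by (rule tendsto_imp_eventually_ne) simp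
      show ?thesis
        using 1 2
      proof eventually_elim
        case (elim \<tau>)
        let ?w = "1 + \<tau> * \<sigma>"
        obtain u' t s where *: "u' \<in> U_minus n" "t \<noteq> 0"
          "x_sub n i (\<tau> / ?w) * u = u' * (coroot n i t * x_sub n i s)" using elim(1) by blast
        obtain u'' where u'': "u'' \<in> U_minus n" "coroot n i ?w * u' = u'' * coroot n i ?w"
          using dg_U_minus[OF *(1) torus_diag_coroot[OF i' elim(2)]] by (auto simp: coroot_dg)
        note c = u U_cmat(1)[OF *(1)] U_cmat(1)[OF u''(1)]
        have "x_sub n i \<tau> * (y_sub n j \<sigma> * u) =
            y_sub n i (\<sigma> / ?w) * (coroot n i ?w * (u' * (coroot n i t * x_sub n i s)))"
          unfolding True[symmetric] x_sub_y_sub_gauss[OF i' u elim(2)] *(3) ..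
        also have "\<dots> = (y_sub n i (\<sigma> / ?w) * u'') * (coroot n i ?w * (coroot n i t * x_sub n i s))"
          using c i' u''(2) by (simp add: assoc_cmat[of _ n, symmetric])
        also have "coroot n i ?w * (coroot n i t * x_sub n i s) = coroot n i (?w * t) * x_sub n i s"
          using i' by (simp add: assoc_cmat[of _ n, symmetric] coroot_dg dg_dg power_int_mult_distrib)
        finally show ?case
          using U_minusI[OF i' u''(1)] *(2) elim(2) by (metis mult_eq_0_iff)
      qed
    qed
  qed
qed

section \<open>The cell U^- T U^+\<close>

definition gauss_cell :: "nat \<Rightarrow> complex mat set" where
  "gauss_cell n = {u * torus_elt n a * v |u a v. u \<in> U_minus n \<and> v \<in> U_plus n \<and> (\<forall>j \<in> {1..n}. a j \<noteq> 0)}"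

lemma torus_elt_cmat [simp]: "torus_elt n a \<in> cmat n"
  by (simp add: torus_elt_dg)

lemma gauss_cell_Sp: "h \<in> gauss_cell n \<Longrightarrow> h \<in> carrier (Sp n)"
  unfolding gauss_cell_def torus_elt_dg
  by (auto intro!: Sp_mult_closed dg_Sp torus_diag_torus_fun simp: U_carrier)

lemma gauss_cell_cmat: "h \<in> gauss_cell n \<Longrightarrow> h \<in> cmat n"
  using gauss_cell_Sp Sp_carrier_mat by blast

lemma one_gauss_cell: "1\<^sub>m (2 * n) \<in> gauss_cell n"
proof -
  have "torus_elt n (\<lambda>_. 1) = 1\<^sub>m (2 * n)"
    unfolding torus_elt_dg dg_one[symmetric] by (rule dg_cong) (simp add: torus_fun_def)
  then have "1\<^sub>m (2 * n) = 1\<^sub>m (2 * n) * torus_elt n (\<lambda>_. 1) * 1\<^sub>m (2 * n)" by simp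
  then show ?thesis unfolding gauss_cell_def using U_one
    by (intro CollectI exI[of _ "1\<^sub>m (2 * n)"] exI[of _ "\<lambda>_. 1"]) simp
qed

lemma y_sub_gauss_cell:
  assumes "h \<in> gauss_cell n" "1 \<le> i" "i \<le> n" shows "y_sub n i t * h \<in> gauss_cell n"
proof -
  obtain u a v where h: "h = u * torus_elt n a * v" "u \<in> U_minus n" "v \<in> U_plus n" "\<forall>j \<in> {1..n}. a j \<noteq> 0"
    using assms(1) unfolding gauss_cell_def by blast
  have "y_sub n i t * h = (y_sub n i t * u) * torus_elt n a * v"
    using h assms by (simp add: U_cmat assoc_cmat[of _ n])
  then show ?thesis unfolding gauss_cell_def using h U_minusI assms by blast
qed

lemma coroot_torus_elt:
  assumes "i \<in> {1..n}" "t \<noteq> 0" shows "coroot n i t * torus_elt n a = torus_elt n (a(i := t * a i))"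
  unfolding torus_elt_dg coroot_dg dg_dg by (rule dg_cong) (rule torus_fun_update[OF assms])

lemma coroot_gauss_cell:
  assumes "h \<in> gauss_cell n" "1 \<le> i" "i \<le> n" "t \<noteq> 0" shows "coroot n i t * h \<in> gauss_cell n"
proof -
  obtain u a v where h: "h = u * torus_elt n a * v" "u \<in> U_minus n" "v \<in> U_plus n" "\<forall>j \<in> {1..n}. a j \<noteq> 0"
    using assms(1) unfolding gauss_cell_def by blast
  obtain u' where u': "u' \<in> U_minus n" "coroot n i t * u = u' * coroot n i t"
    using dg_U_minus[OF h(2) torus_diag_coroot[OF assms(2,3,4)]] by (auto simp: coroot_dg)
  have "coroot n i t * h = (coroot n i t * u) * (torus_elt n a * v)"
    using h by (simp add: U_cmat assoc_cmat[of _ n])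
  also have "\<dots> = u' * (coroot n i t * torus_elt n a) * v"
    unfolding u'(2) using h u' by (simp add: U_cmat assoc_cmat[of _ n])
  finally have "coroot n i t * h = u' * torus_elt n (a(i := t * a i)) * v"
    using coroot_torus_elt[of i n t a] assms by simp
  moreover have "\<forall>j \<in> {1..n}. (a(i := t * a i)) j \<noteq> 0" using h(4) assms by simp
  ultimately show ?thesis unfolding gauss_cell_def using h u' by blast
qed

text \<open>The cell is not stable under left multiplication by x_i, so only small \<tau> are
  treated; that is enough, since a polynomial is determined by its values near 0.\<close>

lemma x_sub_gauss_cell:
  assumes "h \<in> gauss_cell n" "1 \<le> i" "i \<le> n"
  shows "\<forall>\<^sub>F \<tau> in nhds 0. x_sub n i \<tau> * h \<in> gauss_cell n"
proof -
  obtain u a v where h: "h = u * torus_elt n a * v" "u \<in> U_minus n" "v \<in> U_plus n" "\<forall>j \<in> {1..n}. a j \<noteq> 0"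
    using assms(1) unfolding gauss_cell_def by blast
  have "\<forall>\<^sub>F \<tau> in nhds 0. \<exists>u'\<in>U_minus n. \<exists>t s. t \<noteq> 0 \<and>
           x_sub n i \<tau> * u = u' * (coroot n i t * x_sub n i s)"
    using x_sub_U_minus[OF h(2)] assms by auto
  then show ?thesis
  proof eventually_elim
    case (elim \<tau>)
    then obtain u' t s where *: "u' \<in> U_minus n" "t \<noteq> 0"
      "x_sub n i \<tau> * u = u' * (coroot n i t * x_sub n i s)" by blast
    define d where "d = torus_fun n a"
    define v' where "v' = x_sub n i (s * d i / d (i - 1)) * v"
    have td: "torus_diag n d" unfolding d_def using h(4) by (rule torus_diag_torus_fun)
    note c = U_cmat(1)[OF h(2)] U_cmat(2)[OF h(3)] U_cmat(1)[OF *(1)]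
    have v': "v' \<in> U_plus n" unfolding v'_def using U_plusI h assms by blast
    have "x_sub n i \<tau> * h = (x_sub n i \<tau> * u) * (torus_elt n a * v)"
      using h c assms by (simp add: assoc_cmat[of _ n])
    also have "\<dots> = u' * (coroot n i t * (x_sub n i s * (torus_elt n a * v)))"
      unfolding *(3) using c assms by (simp add: assoc_cmat[of _ n])
    also have "x_sub n i s * (torus_elt n a * v) = torus_elt n a * v'"
      unfolding torus_elt_dg v'_def d_def[symmetric] using x_sub_dg[OF assms(2,3) td c(2)] .
    also have "u' * (coroot n i t * (torus_elt n a * v')) = u' * (coroot n i t * torus_elt n a) * v'"
      using c U_cmat(2)[OF v'] by (simp add: assoc_cmat[of _ n])
    finally have "x_sub n i \<tau> * h = u' * torus_elt n (a(i := t * a i)) * v'"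
      using coroot_torus_elt[of i n t a] * assms by simp
    moreover have "\<forall>j \<in> {1..n}. (a(i := t * a i)) j \<noteq> 0" using h(4) * by simp
    ultimately show ?case unfolding gauss_cell_def using * v' by blast
  qed
qed

lemma poly_fun_x_sub:
  assumes "poly_fun n P" and i: "1 \<le> i" "i \<le> n" and w: "w \<in> cmat n" and h: "h \<in> cmat n"
  shows "\<exists>r. \<forall>\<tau>. P (w * (x_sub n i \<tau> * h)) = poly r \<tau>"
  using assms(1)
proof induction
  case (const z)
  show ?case by (intro exI[of _ "[:z:]"]) simp
next
  case (entry p q)
  have "(w * (x_sub n i \<tau> * h)) $$ (p, q) =
      poly (\<Sum>k<2 * n. [:w $$ (p, k) * h $$ (k, q), if k \<in> up_rows n i then w $$ (p, k) * h $$ (Suc k, q) else 0:]) \<tau>" for \<tau>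
  proof -
    have c: "x_sub n i \<tau> * h \<in> cmat n" using i h by simp
    show ?thesis
      unfolding mult_index[OF w c entry] poly_sum
    proof (intro sum.cong refl)
      fix k assume "k \<in> {..<2 * n}"
      then have "(x_sub n i \<tau> * h) $$ (k, q) = h $$ (k, q) + (if k \<in> up_rows n i then \<tau> * h $$ (Suc k, q) else 0)"
        using x_sub_mult[OF i h _ entry(2)] by simp
      then show "w $$ (p, k) * (x_sub n i \<tau> * h) $$ (k, q) =
          poly [:w $$ (p, k) * h $$ (k, q), if k \<in> up_rows n i then w $$ (p, k) * h $$ (Suc k, q) else 0:] \<tau>"
        by (simp add: algebra_simps)
    qed
  qed
  then show ?case by blast
next
  case (add f g)
  then obtain r s where "\<forall>\<tau>. f (w * (x_sub n i \<tau> * h)) = poly r \<tau>" "\<forall>\<tau>. g (w * (x_sub n i \<tau> * h)) = poly s \<tau>" by blast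
  then show ?case by (intro exI[of _ "r + s"]) simp
next
  case (mult f g)
  then obtain r s where "\<forall>\<tau>. f (w * (x_sub n i \<tau> * h)) = poly r \<tau>" "\<forall>\<tau>. g (w * (x_sub n i \<tau> * h)) = poly s \<tau>" by blast
  then show ?case by (intro exI[of _ "r * s"]) simp
qed

lemma poly_eq_0_near_0:
  fixes r :: "complex poly"
  assumes "\<forall>\<^sub>F \<tau> in nhds 0. poly r \<tau> = 0" shows "r = 0"
proof (rule ccontr)
  assume "r \<noteq> 0"
  then have "finite {\<tau>. poly r \<tau> = 0}" by (rule poly_roots_finite)
  moreover obtain e where e: "e > 0" "\<And>\<tau>. dist \<tau> 0 < e \<Longrightarrow> poly r \<tau> = 0"
    using assms unfolding eventually_nhds_metric by blast
  \<comment> \<open>Infinitely many roots inside the disc of radius e, in contrast to the finiteness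
    of the root set.\<close>
  have "(\<lambda>k. of_real (e / real (k + 2)) :: complex) ` UNIV \<subseteq> {\<tau>. poly r \<tau> = 0}"
  proof safe
    fix k :: nat
    have "e / real (k + 2) < e"
      using e(1) by (simp add: divide_less_eq add_pos_nonneg distrib_left)
    then show "poly r (of_real (e / real (k + 2))) = 0"
      using e(1) by (intro e(2)) (simp add: dist_norm norm_of_real del: of_real_divide)
  qed
  moreover have "inj (\<lambda>k. of_real (e / real (k + 2)) :: complex)"
    using e(1) by (intro injI) (simp add: of_real_eq_iff field_simps del: of_real_divide)
  ultimately show False using finite_subset range_inj_infinite by blast
qed

definition Sp_gens :: "nat \<Rightarrow> complex mat set" where
  "Sp_gens n = {x_sub n i t |i t. 1 \<le> i \<and> i \<le> n} \<union> {y_sub n i t |i t. 1 \<le> i \<and> i \<le> n}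
     \<union> {coroot n i t |i t. 1 \<le> i \<and> i \<le> n \<and> t \<noteq> 0}"

lemma Sp_gens_cmat: "g \<in> Sp_gens n \<Longrightarrow> g \<in> cmat n"
  by (auto simp: Sp_gens_def)

lemma Sp_gens_Sp: "g \<in> Sp_gens n \<Longrightarrow> g \<in> carrier (Sp n)"
  by (auto simp: Sp_gens_def x_sub_Sp y_sub_Sp coroot_dg dg_Sp torus_diag_coroot)

text \<open>Stands in for the density of the cell. The product is followed by an arbitrary cell
  element h, and its letters are absorbed into h from the right: y_i and the coroots keep h in the
  cell, while for x_i(t) the value is a polynomial in t that vanishes near 0 and hence at t.\<close>

lemma poly_fun_vanish:
  assumes P: "poly_fun n P" and cell: "\<And>h. h \<in> gauss_cell n \<Longrightarrow> P h = 0"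
    and gs: "set gs \<subseteq> Sp_gens n"
  shows "P (mprod n gs) = 0"
proof -
  have "P (mprod n gs * h) = 0" if "h \<in> gauss_cell n" for h
    using gs that
  proof (induction gs arbitrary: h rule: rev_induct)
    case Nil
    then show ?case using cell gauss_cell_cmat by (simp add: mult_one_left)
  next
    case (snoc g gs)
    have h: "h \<in> cmat n" using snoc.prems gauss_cell_cmat by blast
    have w: "mprod n gs \<in> cmat n" using snoc.prems Sp_gens_cmat by (intro mprod_carrier) auto
    have g: "g \<in> Sp_gens n" "g \<in> cmat n" using snoc.prems Sp_gens_cmat by auto
    have "set gs \<subseteq> cmat n" using snoc.prems Sp_gens_cmat by auto
    then have eq: "mprod n (gs @ [g]) * h = mprod n gs * (g * h)"
      using g h w by (simp add: mprod_append assoc_cmat[of _ n] mult_one_right)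
    consider i t where "g = x_sub n i t" "1 \<le> i" "i \<le> n" | "g * h \<in> gauss_cell n"
      using g(1) y_sub_gauss_cell[OF snoc.prems(2)] coroot_gauss_cell[OF snoc.prems(2)]
      unfolding Sp_gens_def by blast
    then show ?case
    proof cases
      case 1
      obtain r where r: "\<And>\<tau>. P (mprod n gs * (x_sub n i \<tau> * h)) = poly r \<tau>"
        using poly_fun_x_sub[OF P 1(2,3) w h] by blast
      have "\<forall>\<^sub>F \<tau> in nhds 0. poly r \<tau> = 0"
        using x_sub_gauss_cell[OF snoc.prems(2) 1(2,3)]
        by eventually_elim (use snoc in \<open>simp add: r[symmetric]\<close>)
      then have "r = 0" by (rule poly_eq_0_near_0)
      then show ?thesis using r[of t] eq 1 by simp
    next
      case 2
      then show ?thesis using snoc eq by simp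
    qed
  qed
  from this[OF one_gauss_cell] show ?thesis
    using Sp_gens_cmat gs mprod_carrier[of gs n] by (metis right_mult_one_mat subset_iff)
qed

section \<open>The leading minor and its identification with \<open>Delta\<close>\<close>

definition lead_minor :: "nat \<Rightarrow> complex mat \<Rightarrow> complex" where
  "lead_minor n g = det (mat n n (\<lambda>(p, q). g $$ (p, q)))"

lemma poly_fun_sum:
  assumes "finite A" "\<And>x. x \<in> A \<Longrightarrow> poly_fun n (f x)"
  shows "poly_fun n (\<lambda>g. \<Sum>x\<in>A. f x g)"
  using assms by (induction rule: finite_induct) (auto intro: poly_fun.intros)

lemma poly_fun_prod:
  assumes "finite A" "\<And>x. x \<in> A \<Longrightarrow> poly_fun n (f x)"
  shows "poly_fun n (\<lambda>g. \<Prod>x\<in>A. f x g)"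
  using assms by (induction rule: finite_induct) (auto intro: poly_fun.intros)

lemma poly_fun_lead_minor: "poly_fun n (lead_minor n)"
proof -
  have eq: "lead_minor n = (\<lambda>g. \<Sum>p | p permutes {0..<n}. signof p * (\<Prod>i = 0..<n. g $$ (i, p i)))"
  proof
    fix g
    have "p i < n" if "p permutes {0..<n}" "i < n" for p i
      using permutes_in_image[OF that(1), of i] that(2) by simp
    then show "lead_minor n g = (\<Sum>p | p permutes {0..<n}. signof p * (\<Prod>i = 0..<n. g $$ (i, p i)))"
      unfolding lead_minor_def by (subst det_def') (auto intro!: sum.cong prod.cong)
  qed
  have "p i < 2 * n" if "p permutes {0..<n}" "i < n" for p i
    using permutes_in_image[OF that(1), of i] that(2) by simp
  then show ?thesis
    unfolding eq
    by (intro poly_fun_sum poly_fun.mult poly_fun_prod poly_fun.const poly_fun.entry finite_permutations)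
       auto
qed

text \<open>For i < n the leading block undergoes one row addition; for i = n only a row below the
  block changes.\<close>

lemma lead_minor_y_sub:
  assumes i: "1 \<le> i" "i \<le> n" and g: "g \<in> cmat n"
  shows "lead_minor n (y_sub n i t * g) = lead_minor n g"
proof (cases "i < n")
  case True
  have "mat n n (\<lambda>(p, q). (y_sub n i t * g) $$ (p, q)) = addrow t i (i - 1) (mat n n (\<lambda>(p, q). g $$ (p, q)))"
  proof (rule eq_matI)
    fix p q assume "p < dim_row (addrow t i (i - 1) (mat n n (\<lambda>(p, q). g $$ (p, q))))"
      "q < dim_col (addrow t i (i - 1) (mat n n (\<lambda>(p, q). g $$ (p, q))))"
    then have pq: "p < n" "q < n" by simp_all
    then show "mat n n (\<lambda>(p, q). (y_sub n i t * g) $$ (p, q)) $$ (p, q) =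
        addrow t i (i - 1) (mat n n (\<lambda>(p, q). g $$ (p, q))) $$ (p, q)"
      using True y_sub_mult[OF i g, of p q t] by (auto simp: dn_rows_def)
  qed simp_all
  then show ?thesis unfolding lead_minor_def using i True
    using det_addrow[of "i - 1" n i "mat n n (\<lambda>(p, q). g $$ (p, q))" t] by simp
next
  case False
  then have "i = n" using i by simp
  then have "(y_sub n i t * g) $$ (p, q) = g $$ (p, q)" if "p < n" "q < n" for p q
    using y_sub_mult[OF i g, of p q t] that by (auto simp: dn_rows_def)
  then show ?thesis unfolding lead_minor_def by (intro arg_cong[where f = det] eq_matI) auto
qed

lemma lead_minor_transpose:
  assumes "g \<in> cmat n" shows "lead_minor n (transpose_mat g) = lead_minor n g"
proof -
  have "mat n n (\<lambda>(p, q). transpose_mat g $$ (p, q)) = transpose_mat (mat n n (\<lambda>(p, q). g $$ (p, q)))"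
    using assms by (intro eq_matI) auto
  then show ?thesis unfolding lead_minor_def using det_transpose[of "mat n n (\<lambda>(p, q). g $$ (p, q))" n] by simp
qed

lemma lead_minor_U_minus:
  assumes "u \<in> U_minus n" "g \<in> cmat n" shows "lead_minor n (u * g) = lead_minor n g"
  using assms(1)
proof (induction rule: U_minus_induct)
  case (mult i t u)
  then show ?case using assms(2) by (simp add: assoc_cmat[of _ n] U_cmat lead_minor_y_sub)
qed (use assms in simp)

lemma lead_minor_U_plus:
  assumes "v \<in> U_plus n" "g \<in> cmat n" shows "lead_minor n (g * v) = lead_minor n g"
  using assms
proof (induction arbitrary: g rule: U_plus_induct)
  case (mult i t v)
  have "lead_minor n (g * x_sub n i t) = lead_minor n (transpose_mat (g * x_sub n i t))"
    using mult by (intro lead_minor_transpose[symmetric]) simp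
  also have "\<dots> = lead_minor n (y_sub n i t * transpose_mat g)"
    using mult by (simp add: transpose_mult[of _ "2 * n" "2 * n" _ "2 * n"] x_sub_transpose)
  also have "\<dots> = lead_minor n g"
    using mult by (simp add: lead_minor_y_sub lead_minor_transpose)
  finally show ?case
    using mult by (simp add: assoc_cmat[of _ n, symmetric] U_cmat)
qed simp

text \<open>Over the first n rows the exponents of h_j sum to 0 for j < n and to 1 for j = n, which
  is why the leading minor restricts to \<Lambda>_n on the torus.\<close>

lemma prod_chev_h:
  assumes j: "1 \<le> j" "j \<le> n"
  shows "(\<Prod>p<n. (x :: complex) powi chev_h_diag n j p) = (if j = n then x else if x = 0 then 0 else 1)"
proof (cases "j = n")
  case True
  have "(\<Prod>p<n. x powi chev_h_diag n j p) = (\<Prod>p\<in>{n - 1}. x powi chev_h_diag n j p)"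
    using True j by (intro prod.mono_neutral_right) (auto simp: chev_h_diag_def)
  then show ?thesis using True by (simp add: chev_h_diag_def)
next
  case False
  have "(\<Prod>p<n. x powi chev_h_diag n j p) = (\<Prod>p\<in>{j - 1, j}. x powi chev_h_diag n j p)"
    using False j by (intro prod.mono_neutral_right) (auto simp: chev_h_diag_def)
  then show ?thesis using False j by (auto simp: chev_h_diag_def power_int_minus)
qed

lemma lead_minor_torus:
  assumes "n \<ge> 1" "\<forall>j \<in> {1..n}. a j \<noteq> 0" shows "lead_minor n (torus_elt n a) = a n"
proof -
  have "lead_minor n (torus_elt n a) = (\<Prod>p<n. torus_fun n a p)"
    unfolding lead_minor_def torus_elt_dg
    by (subst det_upper_triangular[of _ n])
       (auto simp: upper_triangular_def prod_list_diag_prod dg_index atLeast0LessThan)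
  also have "\<dots> = (\<Prod>j = 1..n. \<Prod>p<n. a j powi chev_h_diag n j p)"
    unfolding torus_fun_def by (rule prod.swap)
  also have "\<dots> = (\<Prod>j = 1..n. if j = n then a j else 1)"
    using assms(2) by (intro prod.cong) (auto simp: prod_chev_h)
  also have "\<dots> = a n" using assms(1) by simp
  finally show ?thesis .
qed

lemma lead_minor_cell:
  assumes "n \<ge> 1" "u \<in> U_minus n" "v \<in> U_plus n" "\<forall>j \<in> {1..n}. a j \<noteq> 0"
  shows "lead_minor n (u * torus_elt n a * v) = a n"
  using assms by (simp add: lead_minor_U_plus lead_minor_U_minus U_cmat lead_minor_torus)

text \<open>The leading minor shows that the defining property of \<open>Delta\<close> can be
  satisfied, and \<open>poly_fun_vanish\<close> that it determines the values at products of
  generators. Restricting to such products spares a proof that they exhaust the group.\<close>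

lemma Delta_eq_lead_minor:
  assumes n: "n \<ge> 1" and gs: "set gs \<subseteq> Sp_gens n"
  shows "Delta n n (mprod n gs) = lead_minor n (mprod n gs)"
proof -
  define Q where "Q f \<longleftrightarrow> regular_on_Sp n f \<and>
     (\<forall>um \<in> U_minus n. \<forall>up \<in> U_plus n. \<forall>a. (\<forall>j \<in> {1..n}. a j \<noteq> 0) \<longrightarrow>
        f (um * torus_elt n a * up) = a n)" for f
  have "Q (lead_minor n)"
    unfolding Q_def regular_on_Sp_def using poly_fun_lead_minor lead_minor_cell[OF n] by blast
  then have "Q (SOME f. Q f)" by (rule someI[of Q])
  then have Q: "Q (Delta n n)" unfolding Delta_def Q_def .
  then obtain P where P: "poly_fun n P" "\<And>g. g \<in> carrier (Sp n) \<Longrightarrow> Delta n n g = P g"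
    unfolding Q_def regular_on_Sp_def by blast
  have "poly_fun n (\<lambda>g. P g + (-1) * lead_minor n g)"
    by (intro poly_fun.add poly_fun.mult poly_fun.const P(1) poly_fun_lead_minor)
  moreover have "P h + (-1) * lead_minor n h = 0" if hc: "h \<in> gauss_cell n" for h
  proof -
    obtain u a v where h: "h = u * torus_elt n a * v" "u \<in> U_minus n" "v \<in> U_plus n" "\<forall>j \<in> {1..n}. a j \<noteq> 0"
      using hc unfolding gauss_cell_def by blast
    have "Delta n n h = a n" using Q h unfolding Q_def by blast
    then show ?thesis using P(2)[OF gauss_cell_Sp[OF hc]] lead_minor_cell[OF n h(2-4)] h(1) by simp
  qed
  ultimately have "P (mprod n gs) + (-1) * lead_minor n (mprod n gs) = 0"
    using gs by (rule poly_fun_vanish)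
  moreover have "mprod n gs \<in> carrier (Sp n)"
    using gs
  proof (induction gs)
    case Nil
    then show ?case using gauss_cell_Sp[OF one_gauss_cell] by simp
  next
    case (Cons g gs)
    then show ?case by (simp add: Sp_mult_closed Sp_gens_Sp)
  qed
  ultimately show ?thesis using P(2) by simp
qed

section \<open>Generalized minors as minors of rows\<close>

text \<open>The matrices at which \<open>Delta\<close> has been identified; \<Theta> and the lifts
  of Weyl group elements are among them.\<close>

definition Sp_words :: "nat \<Rightarrow> complex mat set" where
  "Sp_words n = {mprod n gs |gs. set gs \<subseteq> Sp_gens n}"

lemma Sp_words_one: "1\<^sub>m (2 * n) \<in> Sp_words n"
  unfolding Sp_words_def by (intro CollectI exI[of _ "[]"]) simp

lemma Sp_words_gen: "g \<in> Sp_gens n \<Longrightarrow> g \<in> Sp_words n"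
  unfolding Sp_words_def using Sp_gens_cmat
  by (intro CollectI exI[of _ "[g]"]) (simp add: mult_one_right)

lemma Sp_words_mult: "g \<in> Sp_words n \<Longrightarrow> h \<in> Sp_words n \<Longrightarrow> g * h \<in> Sp_words n"
proof -
  assume "g \<in> Sp_words n" "h \<in> Sp_words n"
  then obtain gs hs where gs: "g = mprod n gs" "set gs \<subseteq> Sp_gens n" "h = mprod n hs" "set hs \<subseteq> Sp_gens n"
    unfolding Sp_words_def by blast
  then have "g * h = mprod n (gs @ hs)"
    using Sp_gens_cmat by (subst mprod_append) auto
  then show ?thesis
    unfolding Sp_words_def using gs by (intro CollectI exI[of _ "gs @ hs"]) simp
qed

lemma Sp_words_mprod: "set gs \<subseteq> Sp_words n \<Longrightarrow> mprod n gs \<in> Sp_words n"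
  by (induction gs) (auto intro: Sp_words_one Sp_words_mult)

lemma Sp_words_Sp: "g \<in> Sp_words n \<Longrightarrow> g \<in> carrier (Sp n)"
proof -
  have "mprod n gs \<in> carrier (Sp n)" if "set gs \<subseteq> Sp_gens n" for gs
    using that
  proof (induction gs)
    case Nil
    then show ?case using gauss_cell_Sp[OF one_gauss_cell] by simp
  qed (simp add: Sp_mult_closed Sp_gens_Sp)
  then show "g \<in> Sp_words n \<Longrightarrow> g \<in> carrier (Sp n)" unfolding Sp_words_def by blast
qed

lemma Sp_words_cmat: "g \<in> Sp_words n \<Longrightarrow> g \<in> cmat n"
  using Sp_words_Sp Sp_carrier_mat by blast

lemma Sp_words_Delta: "n \<ge> 1 \<Longrightarrow> g \<in> Sp_words n \<Longrightarrow> Delta n n g = lead_minor n g"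
  unfolding Sp_words_def using Delta_eq_lead_minor by blast

text \<open>One formula for both the lift of s_i, with e = -1, and its inverse, with e = 1.\<close>

definition refl_mat :: "nat \<Rightarrow> nat \<Rightarrow> complex \<Rightarrow> complex mat" where
  "refl_mat n i e = x_sub n i e * y_sub n i (- e) * x_sub n i e"

lemma sbar_refl_mat: "sbar n i = refl_mat n i (-1)"
  by (simp add: sbar_def refl_mat_def)

lemma refl_mat_cmat [simp]: "1 \<le> i \<Longrightarrow> i \<le> n \<Longrightarrow> refl_mat n i e \<in> cmat n"
  by (simp add: refl_mat_def)

lemma refl_mat_words: "1 \<le> i \<Longrightarrow> i \<le> n \<Longrightarrow> refl_mat n i e \<in> Sp_words n"
  unfolding refl_mat_def by (intro Sp_words_mult Sp_words_gen) (auto simp: Sp_gens_def)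

lemma refl_mat_mult:
  assumes i: "1 \<le> i" "i \<le> n" and g: "g \<in> cmat n" and pq: "p < 2 * n" "q < 2 * n" and e: "e * e = 1"
  shows "(refl_mat n i e * g) $$ (p, q) =
     (if p \<in> up_rows n i then e * g $$ (Suc p, q) else if p \<in> dn_rows n i then - e * g $$ (p - 1, q) else g $$ (p, q))"
proof -
  define g1 where "g1 = x_sub n i e * g"
  define g2 where "g2 = y_sub n i (- e) * g1"
  have c: "g1 \<in> cmat n" "g2 \<in> cmat n" unfolding g1_def g2_def using i g by simp_all
  have eq: "refl_mat n i e * g = x_sub n i e * g2"
    unfolding refl_mat_def g1_def g2_def using i g by (simp add: assoc_cmat[of _ n])
  have g1: "g1 $$ (r, q) = g $$ (r, q) + (if r \<in> up_rows n i then e * g $$ (Suc r, q) else 0)"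
    if "r < 2 * n" for r unfolding g1_def using x_sub_mult[OF i g that pq(2)] .
  have g2: "g2 $$ (r, q) = g1 $$ (r, q) + (if r \<in> dn_rows n i then - e * g1 $$ (r - 1, q) else 0)"
    if "r < 2 * n" for r unfolding g2_def using y_sub_mult[OF i c(1) that pq(2)] .
  have dn: "g2 $$ (r, q) = - e * g $$ (r - 1, q)" if r: "r \<in> dn_rows n i" for r
  proof -
    note d = dn_rowsD[OF i r]
    have "r - 1 < 2 * n" using d(3) by simp
    then have "g2 $$ (r, q) = g $$ (r, q) - e * (g $$ (r - 1, q) + e * g $$ (r, q))"
      using g2[OF d(3)] g1[OF d(3)] g1[of "r - 1"] d r by simp
    also have "\<dots> = - e * g $$ (r - 1, q) + (1 - e * e) * g $$ (r, q)" by (simp add: algebra_simps)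
    finally show ?thesis using e by simp
  qed
  show ?thesis
  proof (cases "p \<in> up_rows n i")
    case True
    note u = up_rowsD[OF i True]
    have "(refl_mat n i e * g) $$ (p, q) = g $$ (p, q) + e * g $$ (Suc p, q) + e * (- e * g $$ (p, q))"
      unfolding eq x_sub_mult[OF i c(2) pq] using True u dn[OF u(1)] g2[OF pq(1)] g1[OF pq(1)] by simp
    also have "\<dots> = e * g $$ (Suc p, q) + (1 - e * e) * g $$ (p, q)" by (simp add: algebra_simps)
    finally show ?thesis using e True by simp
  next
    case False
    then show ?thesis
      unfolding eq x_sub_mult[OF i c(2) pq] using dn[of p] g2[OF pq(1)] g1[OF pq(1)] by simp
  qed
qed

lemma inv_sbar:
  assumes i: "1 \<le> i" "i \<le> n" shows "inv\<^bsub>Sp n\<^esub> sbar n i = refl_mat n i 1"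
proof -
  have "refl_mat n i 1 * (refl_mat n i (-1) * 1\<^sub>m (2 * n)) = 1\<^sub>m (2 * n)"
  proof (rule mat_eqI2[of _ n])
    fix p q assume pq: "p < 2 * n" "q < 2 * n"
    have c: "refl_mat n i (-1) * 1\<^sub>m (2 * n) \<in> cmat n" using i by simp
    have p1: "p - 1 < 2 * n" using pq by simp
    show "(refl_mat n i 1 * (refl_mat n i (-1) * 1\<^sub>m (2 * n))) $$ (p, q) = 1\<^sub>m (2 * n) $$ (p, q)"
      unfolding refl_mat_mult[OF i c pq, of 1, simplified]
      using up_rowsD[OF i, of p] dn_rowsD[OF i, of p] i pq p1
        refl_mat_mult[OF i one_carrier_mat p1 pq(2), of "-1"]
        refl_mat_mult[OF i one_carrier_mat pq, of "-1"]
        refl_mat_mult[OF i one_carrier_mat _ pq(2), of "Suc p" "-1"]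
      by (auto simp del: index_mult_mat(1))
  qed (use i in simp_all)
  then show ?thesis
    unfolding sbar_refl_mat using i Sp_words_Sp[OF refl_mat_words[OF i]]
    by (intro group.inv_equality[OF Sp_group]) (simp_all add: mult_one_right)
qed

text \<open>Sign vectors are the weights in the Weyl orbit of \<Lambda>_n = (1, ..., 1); a sign -1
  at a exchanges the row a for its barred partner.\<close>

definition row_idx :: "nat \<Rightarrow> (nat \<Rightarrow> int) \<Rightarrow> nat \<Rightarrow> nat" where
  "row_idx n \<mu> a = (if \<mu> a = 1 then a else 2 * n - 1 - a)"

definition row_minor :: "nat \<Rightarrow> (nat \<Rightarrow> int) \<Rightarrow> complex mat \<Rightarrow> complex" where
  "row_minor n \<mu> g = det (mat n n (\<lambda>(a, q). g $$ (row_idx n \<mu> a, q)))"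

text \<open>
  The sign is that of the permutation which sorts the chosen rows, where position \<open>a\<close> holds the
  row \<open>a\<close> or \<open>2n-1-a\<close>.
\<close>

definition ext_minor :: "nat \<Rightarrow> (nat \<Rightarrow> int) \<Rightarrow> complex mat \<Rightarrow> complex" where
  "ext_minor n \<mu> g = (\<Prod>a<n. of_int (\<mu> a) ^ (n - 1 - a)) * row_minor n \<mu> g"

lemma row_idx_less: "a < n \<Longrightarrow> row_idx n \<mu> a < 2 * n"
  by (auto simp: row_idx_def)

lemma ext_minor_one: "ext_minor n (\<lambda>_. 1) g = lead_minor n g"
  by (simp add: ext_minor_def row_minor_def lead_minor_def row_idx_def)

text \<open>The lift exchanges two chosen rows and scales them by signs. Their total effect is the
  product of the two entries of \<mu>, which is also the change of the sorting sign, so no sign is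
  left over.\<close>

lemma ext_minor_swap:
  assumes i: "1 \<le> i" "i < n" and mu: "\<And>a. a < n \<Longrightarrow> \<mu> a = 1 \<or> \<mu> a = -1" and g: "g \<in> cmat n"
  shows "ext_minor n \<mu> (refl_mat n i 1 * g) = ext_minor n (refl_act n i \<mu>) g"
proof -
  define \<nu> where "\<nu> = refl_act n i \<mu>"
  have nu: "\<nu> (i - 1) = \<mu> i" "\<nu> i = \<mu> (i - 1)" "\<And>a. a \<noteq> i - 1 \<Longrightarrow> a \<noteq> i \<Longrightarrow> \<nu> a = \<mu> a"
    using i by (auto simp: \<nu>_def refl_act_def transpose_def)
  let ?M = "mat n n (\<lambda>(a, q). g $$ (row_idx n \<nu> a, q))"
  have i': "1 \<le> i" "i \<le> n" using i by auto
  have rows: "(refl_mat n i 1 * g) $$ (row_idx n \<mu> a, q) =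
      (if a = i - 1 then of_int (\<mu> a) * g $$ (row_idx n \<nu> i, q)
       else if a = i then - of_int (\<mu> a) * g $$ (row_idx n \<nu> (i - 1), q) else g $$ (row_idx n \<nu> a, q))"
    if a: "a < n" "q < n" for a q
  proof -
    have q: "q < 2 * n" using a by simp
    have r: "row_idx n \<mu> a < 2 * n" using a by (intro row_idx_less)
    have up: "row_idx n \<mu> a \<in> up_rows n i \<longleftrightarrow> a = i - 1 \<and> \<mu> a = 1 \<or> a = i \<and> \<mu> a \<noteq> 1"
      using a i by (auto simp: row_idx_def up_rows_def)
    have dn: "row_idx n \<mu> a \<in> dn_rows n i \<longleftrightarrow> a = i \<and> \<mu> a = 1 \<or> a = i - 1 \<and> \<mu> a \<noteq> 1"
      using a i by (auto simp: row_idx_def dn_rows_def)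
    have bar: "Suc (2 * n - 1 - i) = 2 * n - 1 - (i - 1)" "2 * n - 1 - (i - 1) - 1 = 2 * n - 1 - i"
      "i - 1 \<noteq> i" "Suc (i - 1) = i"
      using i by auto
    consider "a = i - 1" | "a = i" | "a \<noteq> i - 1" "a \<noteq> i" by blast
    then show ?thesis
    proof cases
      case 1
      then show ?thesis
        unfolding refl_mat_mult[OF i' g r q mult_1] up dn
        using mu[OF a(1)] nu bar by (auto simp: row_idx_def)
    next
      case 2
      then show ?thesis
        unfolding refl_mat_mult[OF i' g r q mult_1] up dn
        using mu[OF a(1)] nu bar by (auto simp: row_idx_def)
    next
      case 3
      then show ?thesis
        unfolding refl_mat_mult[OF i' g r q mult_1] up dn
        using nu(3)[OF 3] by (simp add: row_idx_def)
    qed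
  qed
  \<comment> \<open>The sign of the row swap cancels the minus in the factor of row i.\<close>
  have "mat n n (\<lambda>(a, q). (refl_mat n i 1 * g) $$ (row_idx n \<mu> a, q)) =
      multrow (i - 1) (of_int (\<mu> (i - 1))) (multrow i (- of_int (\<mu> i)) (swaprows (i - 1) i ?M))"
    by (rule eq_matI) (use i in \<open>auto simp: rows\<close>)
  then have "row_minor n \<mu> (refl_mat n i 1 * g) = of_int (\<mu> (i - 1)) * of_int (\<mu> i) * row_minor n \<nu> g"
    unfolding row_minor_def using i
    by (simp add: det_multrow[of _ n] det_swaprows[of _ n])
  moreover have "(\<Prod>a<n. of_int (\<mu> a) ^ (n - 1 - a)) * (of_int (\<mu> (i - 1)) * of_int (\<mu> i)) =
      (\<Prod>a<n. of_int (\<nu> a) ^ (n - 1 - a) :: complex)"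
  proof -
    have S: "{..<n} = insert (i - 1) (insert i ({..<n} - {i - 1, i}))" using i by auto
    have split: "(\<Prod>a<n. f a) = f (i - 1) * (f i * (\<Prod>a \<in> {..<n} - {i - 1, i}. f a))" for f :: "nat \<Rightarrow> complex"
      by (subst S) (use i in \<open>simp add: prod.insert_if\<close>)
    have rest: "(\<Prod>a \<in> {..<n} - {i - 1, i}. of_int (\<nu> a) ^ (n - 1 - a) :: complex) =
       (\<Prod>a \<in> {..<n} - {i - 1, i}. of_int (\<mu> a) ^ (n - 1 - a))"
      using nu(3) by (intro prod.cong) auto
    have alg: "x ^ Suc k * (y ^ k * r) * (x * y) = y ^ Suc k * (x ^ k * r)" if "x * x = 1"
      for x y r :: complex and k
    proof -
      have "x ^ Suc k * (y ^ k * r) * (x * y) = (x * x) * (y ^ Suc k * (x ^ k * r))"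
        by (simp add: mult_ac)
      then show ?thesis using that by simp
    qed
    have "n - 1 - (i - 1) = Suc (n - 1 - i)" using i by auto
    moreover have "i - 1 < n" using i by simp
    then have "\<mu> (i - 1) * \<mu> (i - 1) = 1" using mu[of "i - 1"] by auto
    then have "of_int (\<mu> (i - 1)) * of_int (\<mu> (i - 1)) = (1 :: complex)"
      by (metis of_int_1 of_int_mult)
    ultimately show ?thesis
      unfolding split rest nu by (simp only: alg)
  qed
  ultimately show ?thesis unfolding ext_minor_def \<nu>_def[symmetric] by (metis mult.assoc)
qed

text \<open>The last position has exponent 0 in the sorting sign, so the sign
  \<open>\<mu> (n - 1)\<close> is not absorbed; it is 1 exactly when the letter creates a negative
  entry.\<close>

lemma ext_minor_flip:
  assumes n: "1 \<le> n" and mu: "\<And>a. a < n \<Longrightarrow> \<mu> a = 1 \<or> \<mu> a = -1" and g: "g \<in> cmat n"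
  shows "ext_minor n \<mu> (refl_mat n n 1 * g) = of_int (\<mu> (n - 1)) * ext_minor n (refl_act n n \<mu>) g"
proof -
  define \<nu> where "\<nu> = refl_act n n \<mu>"
  have nu: "\<nu> (n - 1) = - \<mu> (n - 1)" "\<And>a. a \<noteq> n - 1 \<Longrightarrow> \<nu> a = \<mu> a"
    using n by (auto simp: \<nu>_def refl_act_def)
  let ?M = "mat n n (\<lambda>(a, q). g $$ (row_idx n \<nu> a, q))"
  have rows: "(refl_mat n n 1 * g) $$ (row_idx n \<mu> a, q) =
      (if a = n - 1 then of_int (\<mu> a) * g $$ (row_idx n \<nu> a, q) else g $$ (row_idx n \<nu> a, q))"
    if a: "a < n" "q < n" for a q
  proof -
    have q: "q < 2 * n" using a by simp
    have r: "row_idx n \<mu> a < 2 * n" using a by (intro row_idx_less)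
    have up: "row_idx n \<mu> a \<in> up_rows n n \<longleftrightarrow> a = n - 1 \<and> \<mu> a = 1"
      using a by (auto simp: row_idx_def up_rows_def)
    have dn: "row_idx n \<mu> a \<in> dn_rows n n \<longleftrightarrow> a = n - 1 \<and> \<mu> a \<noteq> 1"
      using a by (auto simp: row_idx_def dn_rows_def)
    have bar: "2 * n - 1 - (n - 1) = n" "Suc (n - 1) = n" using n by auto
    show ?thesis
      unfolding refl_mat_mult[OF n le_refl g r q mult_1] up dn
      using mu[OF a(1)] nu bar by (auto simp: row_idx_def)
  qed
  have "mat n n (\<lambda>(a, q). (refl_mat n n 1 * g) $$ (row_idx n \<mu> a, q)) =
      multrow (n - 1) (of_int (\<mu> (n - 1))) ?M"
    by (rule eq_matI) (use n in \<open>auto simp: rows\<close>)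
  then have "row_minor n \<mu> (refl_mat n n 1 * g) = of_int (\<mu> (n - 1)) * row_minor n \<nu> g"
    unfolding row_minor_def using n by (simp add: det_multrow[of _ n])
  moreover have "(\<Prod>a<n. of_int (\<mu> a) ^ (n - 1 - a)) = (\<Prod>a<n. of_int (\<nu> a) ^ (n - 1 - a) :: complex)"
  proof (rule prod.cong)
    fix a show "of_int (\<mu> a) ^ (n - 1 - a) = (of_int (\<nu> a) ^ (n - 1 - a) :: complex)"
      by (cases "a = n - 1") (simp_all add: nu)
  qed simp
  ultimately show ?thesis unfolding ext_minor_def \<nu>_def[symmetric] by (simp add: mult.left_commute)
qed

lemma refl_act_sign:
  assumes "1 \<le> i" "i \<le> n" "\<And>a. a < n \<Longrightarrow> \<mu> a = 1 \<or> \<mu> a = (-1 :: int)" "a < n"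
  shows "refl_act n i \<mu> a = 1 \<or> refl_act n i \<mu> a = -1"
  using assms(1,2,4) assms(3)[of a] assms(3)[of i] assms(3)[of "i - 1"] assms(3)[of "n - 1"]
  by (auto simp: refl_act_def transpose_def)

lemma wbar_Sp: "set us \<subseteq> {1..n} \<Longrightarrow> wbar n us \<in> carrier (Sp n)"
  unfolding wbar_def sbar_refl_mat
  by (intro Sp_words_Sp Sp_words_mprod image_subsetI) (force intro!: refl_mat_words)

lemma inv_wbar_Cons:
  assumes "1 \<le> i" "i \<le> n" "set us \<subseteq> {1..n}"
  shows "inv\<^bsub>Sp n\<^esub> wbar n (i # us) = inv\<^bsub>Sp n\<^esub> wbar n us * refl_mat n i 1"
  using group.inv_mult_group[OF Sp_group, of "sbar n i" n "wbar n us"]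
    Sp_words_Sp[OF refl_mat_words[of i n "-1"]] wbar_Sp[OF assms(3)] inv_sbar[of i n] assms
  by (simp add: wbar_def sbar_refl_mat)

lemma inv_wbar_words: "set us \<subseteq> {1..n} \<Longrightarrow> inv\<^bsub>Sp n\<^esub> wbar n us \<in> Sp_words n"
proof (induction us)
  case Nil
  have "inv\<^bsub>Sp n\<^esub> wbar n [] = 1\<^sub>m (2 * n)"
    using monoid.inv_one[OF group.is_monoid[OF Sp_group], of n] by (simp add: wbar_def)
  then show ?case by (simp add: Sp_words_one)
next
  case (Cons i us)
  then show ?case by (simp add: inv_wbar_Cons Sp_words_mult refl_mat_words)
qed

text \<open>Each letter \<open>n\<close> that undoes a negative sign contributes a sign, so there must be none.\<close>

lemma ext_minor_wbar:
  assumes n: "1 \<le> n" and "set us \<subseteq> {1..n}"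
  defines "\<mu> \<equiv> word_act n us (\<lambda>_. 1)"
  shows "(\<forall>a<n. \<mu> a = 1 \<or> \<mu> a = -1) \<and> num_neg n \<mu> \<le> count_list us n \<and>
    (num_neg n \<mu> = count_list us n \<longrightarrow>
      (\<forall>g \<in> cmat n. lead_minor n (inv\<^bsub>Sp n\<^esub> wbar n us * g) = ext_minor n \<mu> g))"
  using assms(2) unfolding \<mu>_def
proof (induction us)
  case Nil
  have "inv\<^bsub>Sp n\<^esub> wbar n [] = 1\<^sub>m (2 * n)"
    using monoid.inv_one[OF group.is_monoid[OF Sp_group], of n] by (simp add: wbar_def)
  then show ?case by (simp add: num_neg_def ext_minor_one)
next
  case (Cons i us)
  let ?\<mu> = "word_act n us (\<lambda>_. 1)"
  have i: "1 \<le> i" "i \<le> n" and us: "set us \<subseteq> {1..n}" using Cons.prems by auto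
  from Cons.IH[OF us] have mu: "\<And>a. a < n \<Longrightarrow> ?\<mu> a = 1 \<or> ?\<mu> a = -1"
    and le: "num_neg n ?\<mu> \<le> count_list us n"
    and IH: "\<And>g. num_neg n ?\<mu> = count_list us n \<Longrightarrow> g \<in> cmat n \<Longrightarrow>
      lead_minor n (inv\<^bsub>Sp n\<^esub> wbar n us * g) = ext_minor n ?\<mu> g"
    by auto
  have c: "inv\<^bsub>Sp n\<^esub> wbar n us \<in> cmat n" using inv_wbar_words[OF us] by (rule Sp_words_cmat)
  have eq: "inv\<^bsub>Sp n\<^esub> wbar n (i # us) * g = inv\<^bsub>Sp n\<^esub> wbar n us * (refl_mat n i 1 * g)"
    if "g \<in> cmat n" for g
    unfolding inv_wbar_Cons[OF i us] using c i that by (simp add: assoc_cmat[of _ n])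
  have sg: "\<forall>a<n. word_act n (i # us) (\<lambda>_. 1) a = 1 \<or> word_act n (i # us) (\<lambda>_. 1) a = -1"
    using refl_act_sign[OF i mu] by simp
  show ?case
  proof (cases "i = n")
    case False
    then have "i < n" using i by simp
    then show ?thesis
      using sg le num_neg_swap[OF i(1), of n ?\<mu>] eq IH i False ext_minor_swap[OF i(1) \<open>i < n\<close> mu] by simp
  next
    case True
    show ?thesis
    proof (cases "?\<mu> (n - 1) = 1")
      case pos: True
      have "num_neg n (word_act n (i # us) (\<lambda>_. 1)) = num_neg n ?\<mu> + 1"
        using num_neg_flip_pos[OF n, of ?\<mu>] pos True by simp
      then show ?thesis
        using sg le eq IH i True pos ext_minor_flip[OF n mu] by simp
    next
      case False
      \<comment> \<open>Here the letter lowers the number of negative entries while the number of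
        letters n grows, so the two can no longer be equal and the last claim is vacuous.\<close>
      then have "?\<mu> (n - 1) = -1" using mu[of "n - 1"] n by auto
      then have "num_neg n (word_act n (i # us) (\<lambda>_. 1)) + 1 = num_neg n ?\<mu>"
        using num_neg_flip_neg[OF n, of ?\<mu>] True by simp
      then show ?thesis using sg le True by simp
    qed
  qed
qed

lemma gen_minor_rows:
  assumes n: "n \<ge> 2" and us: "reduced_expression n us (longest_elt n \<circ> simple_refl n n)"
    and vs: "reduced_expression n vs id" and g: "g \<in> Sp_words n"
  shows "gen_minor n n us vs g = (\<Prod>a<n. (-1) ^ a) *
     det (mat n n (\<lambda>(a, q). g $$ (if a = n - 1 then n - 1 else 2 * n - 1 - a, q)))"
proof -
  note us' = reduced_expression_w0_sn[OF n us]
  let ?\<mu> = "word_act n us (\<lambda>_. 1)"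
  have n1: "1 \<le> n" using n by simp
  have mu: "?\<mu> a = (if a = n - 1 then 1 else -1)" if "a < n" for a using us'(3)[OF that] .
  have "{a. a < n \<and> ?\<mu> a < 0} = {..<n - 1}" using mu by (auto split: if_splits)
  then have "num_neg n ?\<mu> = n - 1" by (simp add: num_neg_def)
  \<comment> \<open>The word has at most n - 1 letters n because it is reduced, and at least n - 1
    because it must produce n - 1 negative signs.\<close>
  then have eq: "num_neg n ?\<mu> = count_list us n"
    using ext_minor_wbar[OF n1 us'(1)] us'(2) by linarith
  have gc: "g \<in> cmat n" using g by (rule Sp_words_cmat)
  have "wbar n vs = 1\<^sub>m (2 * n)" using reduced_expression_id[OF vs] by (simp add: wbar_def)
  moreover have w: "inv\<^bsub>Sp n\<^esub> wbar n us * g \<in> Sp_words n"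
    using inv_wbar_words[OF us'(1)] g by (rule Sp_words_mult)
  ultimately have "gen_minor n n us vs g = lead_minor n (inv\<^bsub>Sp n\<^esub> wbar n us * g)"
    unfolding gen_minor_def using Sp_words_Delta[OF n1 w] Sp_words_cmat[OF w] by (simp add: mult_one_right)
  also have "\<dots> = ext_minor n ?\<mu> g"
    using ext_minor_wbar[OF n1 us'(1)] eq gc by blast
  also have "\<dots> = (\<Prod>a<n. (-1) ^ a) * det (mat n n (\<lambda>(a, q). g $$ (if a = n - 1 then n - 1 else 2 * n - 1 - a, q)))"
  proof -
    have "(\<Prod>a<n. of_int (?\<mu> a) ^ (n - 1 - a)) = (\<Prod>a<n. (-1) ^ (n - 1 - a) :: complex)"
      by (intro prod.cong) (auto simp: mu)
    also have "\<dots> = (\<Prod>a<n. (-1) ^ a)"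
      by (rule prod.reindex_bij_witness[of _ "\<lambda>a. n - 1 - a" "\<lambda>a. n - 1 - a"]) auto
    finally show ?thesis
      unfolding ext_minor_def row_minor_def row_idx_def
      by (auto simp: mu intro!: arg_cong[where f = det] eq_matI)
  qed
  finally show ?thesis .
qed

section \<open>The matrix $\Theta$\<close>

lemma ybold_cmat [simp]: "1 \<le> i \<Longrightarrow> i \<le> n \<Longrightarrow> ybold n i t \<in> cmat n"
  by (simp add: ybold_def)

lemma ybold_mult:
  assumes i: "1 \<le> i" "i \<le> n" and t: "t \<noteq> 0" and g: "g \<in> cmat n" and pq: "p < 2 * n" "q < 2 * n"
  shows "(ybold n i t * g) $$ (p, q) =
     (if p \<in> up_rows n i then g $$ (p, q) / t
      else if p \<in> dn_rows n i then t * g $$ (p, q) + g $$ (p - 1, q) else g $$ (p, q))"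
proof -
  let ?h = "coroot n i (inverse t) * g"
  have h: "?h \<in> cmat n" using g by simp
  have eq: "ybold n i t * g = y_sub n i t * ?h"
    unfolding ybold_def using i g by (simp add: assoc_cmat[of _ n])
  have p1: "p - 1 < 2 * n" using pq by simp
  show ?thesis
    unfolding eq y_sub_mult[OF i h pq] coroot_mult[OF i g pq] coroot_mult[OF i g p1 pq(2)]
    using up_rowsD(2)[OF i, of p] dn_rowsD(1)[OF i, of p] t by (auto simp: field_simps)
qed

definition Yprod :: "nat \<Rightarrow> (nat \<Rightarrow> complex) \<Rightarrow> nat \<Rightarrow> complex mat" where
  "Yprod n t i = mprod n (map (\<lambda>i. ybold n i (t i)) [i..<Suc n])"

lemma Yprod_cmat: "1 \<le> i \<Longrightarrow> Yprod n t i \<in> cmat n"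
  unfolding Yprod_def by (rule mprod_carrier) auto

text \<open>The induction descends in i because the factor with index i multiplies from the left. A
  barred row k collects all barred rows j \<ge> k and the single unbarred row n; the latter is the
  source of the block of rank one.\<close>

lemma Yprod_partial:
  assumes t: "\<And>i. t i \<noteq> 0" and g: "g \<in> cmat n" and q: "q < 2 * n" and i: "1 \<le> i" "i \<le> Suc n"
    and k: "1 \<le> k" "k \<le> n"
  shows "(Yprod n t i * g) $$ (k - 1, q) =
     (if k < i then g $$ (k - 1, q) else if k = i then g $$ (k - 1, q) / t k
      else g $$ (k - 2, q) + t (k - 1) / t k * g $$ (k - 1, q))"
    (is "?top i k")
    and "(Yprod n t i * g) $$ (2 * n - k, q) =
     (if k < i then g $$ (2 * n - k, q)
      else ((\<Sum>j = k..n. t j * g $$ (2 * n - j, q)) + g $$ (n - 1, q)) / (if k = i then 1 else t (k - 1)))"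
    (is "?bot i k")
proof -
  have "\<forall>k. 1 \<le> k \<and> k \<le> n \<longrightarrow> ?top i k \<and> ?bot i k"
    using i(2,1)
  proof (induction rule: inc_induct)
    case base
    then show ?case using g by (auto simp: Yprod_def mult_one_left)
  next
    case (step i)
    define h where "h = Yprod n t (Suc i) * g"
    have h: "h \<in> cmat n" unfolding h_def using g by (simp add: Yprod_cmat)
    have i: "1 \<le> i" "i \<le> n" using step by auto
    have eq: "Yprod n t i * g = ybold n i (t i) * h"
    proof -
      have "Yprod n t i = ybold n i (t i) * Yprod n t (Suc i)"
        unfolding Yprod_def using i by (subst upt_conv_Cons) auto
      then show ?thesis
        unfolding h_def using i g by (simp add: assoc_cmat[of _ n] Yprod_cmat)
    qed
    have IH: "?top (Suc i) k" "?bot (Suc i) k" if "1 \<le> k" "k \<le> n" for k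
      using step.IH that by auto
    note IH = IH[folded h_def]
    show ?case
    proof (intro allI impI)
      fix k assume "1 \<le> k \<and> k \<le> n"
      then have k: "1 \<le> k" "k \<le> n" by auto
      have p: "k - 1 < 2 * n" "2 * n - k < 2 * n" using k by auto
      have tu: "k - 1 \<in> up_rows n i \<longleftrightarrow> k = i" and td: "k - 1 \<in> dn_rows n i \<longleftrightarrow> k = Suc i"
        and bu: "2 * n - k \<in> up_rows n i \<longleftrightarrow> k = Suc i" and bd: "2 * n - k \<in> dn_rows n i \<longleftrightarrow> k = i"
        using k i by (auto simp: up_rows_def dn_rows_def)
      have "?top i k"
        unfolding eq ybold_mult[OF i t h p(1) q] tu td
        using IH(1)[OF k] IH(1)[OF i] k i t[of i] by (auto simp: numeral_2_eq_2)
      moreover have "?bot i k"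
      proof -
        let ?R = "\<lambda>k. (\<Sum>j = k..n. t j * g $$ (2 * n - j, q)) + g $$ (n - 1, q)"
        have R: "?R i = t i * g $$ (2 * n - i, q) + ?R (Suc i)"
          using i by (simp add: sum.atLeast_Suc_atMost)
        consider "k < i" | "k = i" | "k = Suc i" | "k > Suc i" by linarith
        then show ?thesis
        proof cases
          case 2
          \<comment> \<open>For i = n the row above is the unbarred row n, and the sum over barred
            rows is empty.\<close>
          have "h $$ (2 * n - i - 1, q) = ?R (Suc i)"
          proof (cases "i = n")
            case True
            then have "2 * n - i - 1 = n - 1" by simp
            then show ?thesis using IH(1)[of n] i True by simp
          next
            case False
            then have "2 * n - i - 1 = 2 * n - Suc i" "1 \<le> Suc i" "Suc i \<le> n" using i by auto
            then show ?thesis using IH(2)[of "Suc i"] by simp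
          qed
          then show ?thesis
            unfolding eq ybold_mult[OF i t h p(2) q] bu bd
            using 2 R IH(2)[OF k] by simp
        next
          case 3
          then show ?thesis
            unfolding eq ybold_mult[OF i t h p(2) q] bu bd using IH(2)[OF k] by simp
        qed (use IH(2)[OF k] ybold_mult[OF i t h p(2) q, unfolded bu bd] eq in auto)
      qed
      ultimately show "?top i k \<and> ?bot i k" ..
    qed
  qed
  then show "?top i k" "?bot i k" using k by auto
qed

definition Theta_tail :: "nat \<Rightarrow> (nat \<Rightarrow> nat \<Rightarrow> complex) \<Rightarrow> nat \<Rightarrow> complex mat" where
  "Theta_tail n c r = mprod n (concat (map (\<lambda>m. map (\<lambda>i. ybold n i (c m i)) [1..<Suc n]) [Suc r..<Suc n]))"

lemma Theta_tail_cmat: "Theta_tail n c r \<in> cmat n"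
  unfolding Theta_tail_def by (rule mprod_carrier) auto

lemma Theta_minus_tail: "Theta_minus n c = Theta_tail n c 0"
  by (simp add: Theta_minus_def Theta_tail_def)

lemma Theta_tail_top: "Theta_tail n c n = 1\<^sub>m (2 * n)"
  by (simp add: Theta_tail_def)

lemma Theta_tail_step:
  assumes "r < n" shows "Theta_tail n c r = Yprod n (c (Suc r)) 1 * Theta_tail n c (Suc r)"
proof -
  have "[Suc r..<Suc n] = Suc r # [Suc (Suc r)..<Suc n]" using assms by (simp add: upt_conv_Cons del: upt_Suc)
  then show ?thesis
    unfolding Theta_tail_def Yprod_def by (simp del: upt_Suc) (rule mprod_append, auto)
qed

definition cv :: "(nat \<Rightarrow> nat \<Rightarrow> complex) \<Rightarrow> nat \<Rightarrow> nat \<Rightarrow> complex" where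
  "cv c r i = (if i = 0 then 1 else c r i)"

lemma cval_cv: "cval c (int r) i = cv c r i"
  by (simp add: cval_def cv_def)

text \<open>Rows \<open>k\<close> and \<open>k\<close>-bar of the partial products, in a fixed column \<open>q\<close>.\<close>

definition top_row :: "nat \<Rightarrow> (nat \<Rightarrow> nat \<Rightarrow> complex) \<Rightarrow> nat \<Rightarrow> nat \<Rightarrow> nat \<Rightarrow> complex" where
  "top_row n c q k r = (if k = 0 then 0 else Theta_tail n c r $$ (k - 1, q))"

definition bot_row :: "nat \<Rightarrow> (nat \<Rightarrow> nat \<Rightarrow> complex) \<Rightarrow> nat \<Rightarrow> nat \<Rightarrow> nat \<Rightarrow> complex" where
  "bot_row n c q r k = (if k \<in> {1..n} then Theta_tail n c r $$ (2 * n - k, q) else 0)"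

text \<open>The lower right block of Y_r, acting on the column formed by the barred rows.\<close>

definition D_op :: "nat \<Rightarrow> (nat \<Rightarrow> nat \<Rightarrow> complex) \<Rightarrow> nat \<Rightarrow> (nat \<Rightarrow> complex) \<Rightarrow> nat \<Rightarrow> complex" where
  "D_op n c r v k = (if k \<in> {1..n} then (\<Sum>j = k..n. c r j * v j) / cv c r (k - 1) else 0)"

primrec D_ops :: "nat \<Rightarrow> (nat \<Rightarrow> nat \<Rightarrow> complex) \<Rightarrow> nat \<Rightarrow> (nat \<Rightarrow> complex) \<Rightarrow> nat \<Rightarrow> complex" where
  "D_ops n c 0 v = v"
| "D_ops n c (Suc r) v = D_ops n c r (D_op n c (Suc r) v)"

text \<open>For k = n this is the column that spans the lower left block of Y_r. The truncation at k
  provides the index along which \<open>wt_sum_alternating\<close> runs.\<close>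

definition omega :: "(nat \<Rightarrow> nat \<Rightarrow> complex) \<Rightarrow> nat \<Rightarrow> nat \<Rightarrow> nat \<Rightarrow> complex" where
  "omega c r k j = (if 1 \<le> j \<and> j \<le> k then 1 / cv c r (j - 1) else 0)"

definition zvec :: "nat \<Rightarrow> (nat \<Rightarrow> nat \<Rightarrow> complex) \<Rightarrow> nat \<Rightarrow> nat \<Rightarrow> nat \<Rightarrow> complex" where
  "zvec n c k s = D_ops n c s (omega c (Suc s) k)"

lemma D_ops_linear:
  "D_ops n c r (\<lambda>j. u j + a * v j) k = D_ops n c r u k + a * D_ops n c r v k"
proof (induction r arbitrary: u v k)
  case (Suc r)
  have "D_op n c (Suc r) (\<lambda>j. u j + a * v j) = (\<lambda>j. D_op n c (Suc r) u j + a * D_op n c (Suc r) v j)"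
    by (auto simp: D_op_def sum.distrib sum_distrib_left algebra_simps add_divide_distrib)
  then show ?case by (simp add: Suc)
qed simp

lemma D_ops_zero: "D_ops n c r (\<lambda>_. 0) = (\<lambda>_. 0)"
proof (induction r)
  case (Suc r)
  have "D_op n c (Suc r) (\<lambda>_. 0) = (\<lambda>_. 0)" by (auto simp: D_op_def)
  with Suc show ?case by simp
qed simp

lemma D_ops_scale: "D_ops n c r (\<lambda>j. a * v j) k = a * D_ops n c r v k"
  using D_ops_linear[of n c r "\<lambda>_. 0" a v k] by (simp add: D_ops_zero)

lemma sum_reverse: "(\<Sum>m<n. (-1) ^ m * h m) = (-1) ^ (n - 1) * (\<Sum>s<n. (-1) ^ s * h (n - Suc s))"
  for n :: nat and h :: "nat \<Rightarrow> complex"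
proof -
  have "(\<Sum>m<n. (-1) ^ m * h m) = (\<Sum>s<n. (-1) ^ (n - Suc s) * h (n - Suc s))"
    by (rule sum.nat_diff_reindex[symmetric])
  also have "\<dots> = (\<Sum>s<n. (-1) ^ (n - 1) * ((-1) ^ s * h (n - Suc s)))"
  proof (intro sum.cong refl)
    fix s assume "s \<in> {..<n}"
    then have "n - 1 = s + (n - Suc s)" by simp
    then have e: "(-1 :: complex) ^ (n - 1) = (-1) ^ s * (-1) ^ (n - Suc s)" by (simp only: power_add)
    have sq: "(-1 :: complex) ^ s * (-1) ^ s = 1" by (simp flip: power_mult_distrib)
    have "(-1) ^ (n - 1) * ((-1) ^ s * h (n - Suc s)) =
        ((-1) ^ s * (-1) ^ s) * ((-1) ^ (n - Suc s) * h (n - Suc s))"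
      unfolding e by (simp only: mult_ac)
    then show "(-1) ^ (n - Suc s) * h (n - Suc s) = (-1) ^ (n - 1) * ((-1) ^ s * h (n - Suc s))"
      unfolding sq mult_1_left by (rule sym)
  qed
  finally show ?thesis by (simp add: sum_distrib_left)
qed

text \<open>Cramer's rule for the last coordinate of x. Once the last column is replaced by A x or B
  x, expansion along it leaves the same minor in both cases, with factor S or 1.\<close>

lemma det_replace_last_row:
  fixes A B :: "complex mat"
  assumes A: "A \<in> carrier_mat n n" and B: "B \<in> carrier_mat n n" and n: "n \<ge> 1"
    and eq: "\<And>a s. a < n - 1 \<Longrightarrow> s < n \<Longrightarrow> A $$ (a, s) = B $$ (a, s)"
    and x: "x \<in> carrier_vec n" "x $ (n - 1) \<noteq> 0"
    and Ax: "\<And>a. a < n \<Longrightarrow> (A *\<^sub>v x) $ a = (if a = n - 1 then S else 0)"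
    and Bx: "\<And>a. a < n \<Longrightarrow> (B *\<^sub>v x) $ a = (if a = n - 1 then 1 else 0)"
  shows "det A = S * det B"
proof -
  have n1: "n - 1 < n" using n by simp
  define A' where "A' = replace_col A (A *\<^sub>v x) (n - 1)"
  define B' where "B' = replace_col B (B *\<^sub>v x) (n - 1)"
  have A': "A' \<in> carrier_mat n n" and B': "B' \<in> carrier_mat n n"
    using A B by (auto simp: A'_def B'_def replace_col_def)
  have colA: "A' $$ (a, n - 1) = (if a = n - 1 then S else 0)" if "a < n" for a
    using that A n1 Ax[OF that] by (simp add: A'_def replace_col_def)
  have colB: "B' $$ (a, n - 1) = (if a = n - 1 then 1 else 0)" if "a < n" for a
    using that B n1 Bx[OF that] by (simp add: B'_def replace_col_def)
  have md: "mat_delete A' (n - 1) (n - 1) = mat_delete B' (n - 1) (n - 1)"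
    using A B n eq by (intro eq_matI) (auto simp: mat_delete_def A'_def B'_def replace_col_def)
  have "det A' = (\<Sum>a<n. A' $$ (a, n - 1) * cofactor A' a (n - 1))"
    by (rule laplace_expansion_column[OF A' n1])
  also have "\<dots> = (\<Sum>a<n. if a = n - 1 then S * cofactor A' a (n - 1) else 0)"
    by (intro sum.cong) (auto simp: colA[unfolded One_nat_def])
  also have "\<dots> = S * cofactor A' (n - 1) (n - 1)" using n1 by simp
  finally have dA: "det A' = S * cofactor A' (n - 1) (n - 1)" .
  have "det B' = (\<Sum>a<n. B' $$ (a, n - 1) * cofactor B' a (n - 1))"
    by (rule laplace_expansion_column[OF B' n1])
  also have "\<dots> = (\<Sum>a<n. if a = n - 1 then cofactor B' a (n - 1) else 0)"
    by (intro sum.cong) (auto simp: colB[unfolded One_nat_def])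
  also have "\<dots> = cofactor B' (n - 1) (n - 1)" using n1 by simp
  finally have "det A' = S * det B'" using dA md by (simp add: cofactor_def)
  then have "x $ (n - 1) * det A = S * (x $ (n - 1) * det B)"
    unfolding A'_def B'_def cramer_lemma_mat[OF A x(1) n1] cramer_lemma_mat[OF B x(1) n1] .
  then show ?thesis using x(2) by simp
qed

context
  fixes n :: nat and c :: "nat \<Rightarrow> nat \<Rightarrow> complex"
  assumes nz: "c r i \<noteq> 0"
begin

lemma cv_nz [simp]: "cv c r i \<noteq> 0"
  using nz by (simp add: cv_def)

text \<open>The conventions that the row 0 vanishes and that c_0 = 1 make the case k = 1 fit
  in.\<close>

lemma top_row_rec:
  assumes "q < n" "1 \<le> k" "k \<le> n" "r < n"
  shows "top_row n c q k r = top_row n c q (k - 1) (Suc r) + cv c (Suc r) (k - 1) / c (Suc r) k * top_row n c q k (Suc r)"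
proof -
  have "k - 2 = k - 1 - 1" by simp
  then show ?thesis
    using Yprod_partial(1)[of "c (Suc r)", OF nz Theta_tail_cmat[of n c "Suc r"], of q 1 k] assms
    by (auto simp: top_row_def Theta_tail_step cv_def)
qed

lemma bot_row_rec:
  assumes "q < n" "r < n"
  shows "bot_row n c q r = (\<lambda>k. D_op n c (Suc r) (bot_row n c q (Suc r)) k + top_row n c q n (Suc r) * omega c (Suc r) n k)"
proof
  fix k
  show "bot_row n c q r k = D_op n c (Suc r) (bot_row n c q (Suc r)) k + top_row n c q n (Suc r) * omega c (Suc r) n k"
  proof (cases "k \<in> {1..n}")
    case True
    have "(\<Sum>j = k..n. c (Suc r) j * bot_row n c q (Suc r) j)
        = (\<Sum>j = k..n. c (Suc r) j * Theta_tail n c (Suc r) $$ (2 * n - j, q))"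
      using True by (intro sum.cong) (auto simp: bot_row_def)
    then show ?thesis
      using Yprod_partial(2)[of "c (Suc r)", OF nz Theta_tail_cmat[of n c "Suc r"], of q 1 k] assms True
      by (auto simp: bot_row_def D_op_def top_row_def omega_def Theta_tail_step cv_def add_divide_distrib)
  qed (auto simp: bot_row_def D_op_def omega_def)
qed

lemma top_row_last: "q < n \<Longrightarrow> k \<le> n \<Longrightarrow> top_row n c q k n = (if k = Suc q then 1 else 0)"
  by (auto simp: top_row_def Theta_tail_top)

lemma bot_row_last: "q < n \<Longrightarrow> bot_row n c q n = (\<lambda>_. 0)"
  by (auto simp: fun_eq_iff bot_row_def Theta_tail_top)

text \<open>The groups of factors are unfolded from the left, each contributing one multiple of a
  row n; the remainder vanishes because the identity matrix has no entries in the barred rows of the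
  first n columns.\<close>

lemma bot_row_expansion:
  assumes "q < n" shows "bot_row n c q 0 k = (\<Sum>s<n. zvec n c n s k * top_row n c q n (Suc s))"
proof -
  have "bot_row n c q 0 k = D_ops n c t (bot_row n c q t) k + (\<Sum>s<t. zvec n c n s k * top_row n c q n (Suc s))"
    if "t \<le> n" for t
    using that
  proof (induction t)
    case (Suc t)
    have "D_ops n c t (bot_row n c q t) k = D_ops n c (Suc t) (bot_row n c q (Suc t)) k
        + top_row n c q n (Suc t) * zvec n c n t k"
      unfolding zvec_def using Suc.prems
      by (subst bot_row_rec[OF assms]) (simp_all add: D_ops_linear)
    then show ?case using Suc by simp
  qed simp
  from this[of n] show ?thesis using assms by (simp add: bot_row_last D_ops_zero)
qed

text \<open>Each group of factors moves an unbarred row down by at most one place, with coefficient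
  1, and d groups remain.\<close>

lemma top_row_upper:
  assumes q: "q < n" and "d \<le> n" "k \<le> n"
  shows "q + 1 + d < k \<Longrightarrow> top_row n c q k (n - d) = 0"
    "q + 1 + d = k \<Longrightarrow> top_row n c q k (n - d) = 1"
proof -
  have "(q + 1 + d < k \<longrightarrow> top_row n c q k (n - d) = 0) \<and> (q + 1 + d = k \<longrightarrow> top_row n c q k (n - d) = 1)"
    using assms(2,3)
  proof (induction d arbitrary: k)
    case 0
    then show ?case using q by (simp add: top_row_last)
  next
    case (Suc d)
    have e: "Suc (n - Suc d) = n - d" using Suc.prems by simp
    show ?case
      using top_row_rec[OF q, of k "n - Suc d"] Suc.IH[of k] Suc.IH[of "k - 1"] Suc.prems
      unfolding e by auto
  qed
  then show "q + 1 + d < k \<Longrightarrow> top_row n c q k (n - d) = 0"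
    "q + 1 + d = k \<Longrightarrow> top_row n c q k (n - d) = 1" by auto
qed

text \<open>The unbarred block of each group is lower triangular, so the diagonal entries
  multiply.\<close>

lemma top_row_lower:
  assumes q: "q < n" and "k \<le> n" "r \<le> n"
  shows "k \<le> q \<Longrightarrow> top_row n c q k r = 0"
    "k = Suc q \<Longrightarrow> top_row n c q k r = (\<Prod>t = Suc r..n. cv c t (k - 1) / cv c t k)"
proof -
  have "\<forall>k\<le>n. (k \<le> q \<longrightarrow> top_row n c q k r = 0) \<and>
      (k = Suc q \<longrightarrow> top_row n c q k r = (\<Prod>t = Suc r..n. cv c t (k - 1) / cv c t k))"
    using assms(3)
  proof (induction rule: inc_induct)
    case base
    then show ?case using q by (simp add: top_row_last)
  next
    case (step r)
    show ?case
    proof (intro allI impI)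
      fix k assume k: "k \<le> n"
      have IH: "k \<le> q \<Longrightarrow> top_row n c q k (Suc r) = 0" "k - 1 \<le> q \<Longrightarrow> top_row n c q (k - 1) (Suc r) = 0"
        "k = Suc q \<Longrightarrow> top_row n c q k (Suc r) = (\<Prod>t = Suc (Suc r)..n. cv c t (k - 1) / cv c t k)"
        using step.IH k by auto
      have "(\<Prod>t = Suc r..n. cv c t (k - 1) / cv c t k) =
          cv c (Suc r) (k - 1) / cv c (Suc r) k * (\<Prod>t = Suc (Suc r)..n. cv c t (k - 1) / cv c t k)"
        using step.hyps by (intro prod.atLeast_Suc_atMost) auto
      moreover have "top_row n c q k r = cv c (Suc r) (k - 1) / cv c (Suc r) k * top_row n c q k (Suc r)"
        if "k \<noteq> 0" "k \<le> Suc q"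
        using top_row_rec[OF q, of k r] IH(2) k that step.hyps by (simp add: cv_def)
      ultimately show "(k \<le> q \<longrightarrow> top_row n c q k r = 0) \<and>
          (k = Suc q \<longrightarrow> top_row n c q k r = (\<Prod>t = Suc r..n. cv c t (k - 1) / cv c t k))"
        using IH(1,3) by (cases "k = 0") (auto simp: top_row_def)
    qed
  qed
  then show "k \<le> q \<Longrightarrow> top_row n c q k r = 0"
    "k = Suc q \<Longrightarrow> top_row n c q k r = (\<Prod>t = Suc r..n. cv c t (k - 1) / cv c t k)"
    using assms(2) by auto
qed

text \<open>Links the operators to the truncated columns: a unit vector is the difference of two
  truncations up to a scalar, and its image is again a truncation. This yields the recursion of the
  z in k.\<close>

lemma D_op_delta:
  assumes "1 \<le> k" "k \<le> n"
  shows "D_op n c r (\<lambda>j. if j = k then 1 else 0) = (\<lambda>j. c r k * omega c r k j)"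
proof
  fix j
  have "(\<Sum>i = j..n. c r i * (if i = k then 1 else 0)) = (\<Sum>i = j..n. if i = k then c r i else 0)"
    by (intro sum.cong) auto
  then show "D_op n c r (\<lambda>j. if j = k then 1 else 0) j = c r k * omega c r k j"
    using assms by (auto simp: D_op_def omega_def)
qed

lemma zvec_Suc:
  "zvec n c (Suc k) s j = zvec n c k s j + D_ops n c s (\<lambda>j. if j = Suc k then 1 else 0) j / cv c (Suc s) k"
proof -
  have "omega c (Suc s) (Suc k) = (\<lambda>j. omega c (Suc s) k j + (1 / cv c (Suc s) k) * (if j = Suc k then 1 else 0))"
    by (auto simp: fun_eq_iff omega_def le_Suc_eq)
  then show ?thesis unfolding zvec_def by (simp only: D_ops_linear) simp
qed

lemma D_ops_delta:
  assumes "1 \<le> k" "k \<le> n"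
  shows "D_ops n c (Suc s) (\<lambda>j. if j = k then 1 else 0) j = c (Suc s) k * zvec n c k s j"
  unfolding zvec_def D_ops.simps D_op_delta[OF assms] D_ops_scale ..

section \<open>The two linear relations\<close>

lemma C_mon_cv:
  "m < n \<Longrightarrow> C_mon n c (int (Suc m)) (Suc k) = cv c (n - Suc m) (Suc k) / cv c (n - m) k"
proof -
  assume "m < n"
  then have "int n - int (Suc m) = int (n - Suc m)" "int n - int (Suc m) + 1 = int (n - m)" by auto
  then show ?thesis unfolding C_mon_def by (simp only: cval_cv diff_Suc_1)
qed

abbreviation sig :: "nat \<Rightarrow> complex" where
  "sig m \<equiv> wt_sum (\<lambda>a i. C_mon n c (int a) i) n m"

lemma sig_top: "sig n = cv c 0 n"
  using wt_sum_diag[of c n n] nz cval_cv[of c 0 n] by simp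

lemma top_row_relation:
  assumes q: "q < n"
  shows "top_row n c q n 0 = (\<Sum>s<n. (-1) ^ s * sig (n - Suc s) / c (Suc s) n * top_row n c q n (Suc s))"
proof -
  have n: "n \<ge> 1" using q by simp
  \<comment> \<open>Division by c^(n-m)_k turns \<open>top_row_rec\<close> into the hypothesis of
    \<open>wt_sum_alternating\<close>, and the sign (-1)^k turns its sum into a difference.\<close>
  define y where "y k m = (-1) ^ k * top_row n c q k (n - m) / cv c (n - m) k" for k m
  have rec: "C_mon n c (int (Suc m)) (Suc k) * y (Suc k) (Suc m) = y (Suc k) m - y k m"
    if "m \<le> k" "k < n" for k m
  proof -
    have m: "m < n" "Suc (n - Suc m) = n - m" using that by auto
    have "top_row n c q (Suc k) (n - Suc m) = top_row n c q k (n - m) + cv c (n - m) k / cv c (n - m) (Suc k) * top_row n c q (Suc k) (n - m)"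
      using top_row_rec[OF q, of "Suc k" "n - Suc m"] that m by (simp add: cv_def)
    then show ?thesis
      unfolding C_mon_cv[OF m(1)] y_def by (simp add: field_simps)
  qed
  have "(\<Sum>m\<le>n. (-1) ^ m * sig m * y n m) = 0"
    by (rule wt_sum_alternating[where K = n]) (use rec in \<open>auto simp: y_def top_row_def\<close>)
  \<comment> \<open>The term m = n is the row of \<Theta> itself, as S_n = c^(0)_n cancels its
    denominator.\<close>
  then have "(-1) ^ n * sig n * y n n + (\<Sum>m<n. (-1) ^ m * (sig m * y n m)) = 0"
    by (simp add: lessThan_Suc_atMost[symmetric] mult.assoc add.commute)
  moreover have "(-1) ^ n * sig n * y n n = top_row n c q n 0"
    unfolding y_def sig_top by (simp add: flip: power_mult_distrib)
  moreover have "(\<Sum>m<n. (-1) ^ m * (sig m * y n m)) =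
     (-1) ^ (n - 1) * (\<Sum>s<n. (-1) ^ s * (sig (n - Suc s) * y n (n - Suc s)))"
    by (rule sum_reverse)
  moreover have "(\<Sum>s<n. (-1) ^ s * (sig (n - Suc s) * y n (n - Suc s))) =
     (-1) ^ n * (\<Sum>s<n. (-1) ^ s * sig (n - Suc s) / c (Suc s) n * top_row n c q n (Suc s))"
    unfolding sum_distrib_left
    using n by (intro sum.cong refl) (simp add: y_def cv_def Suc_diff_Suc mult_ac)
  moreover have "(-1 :: complex) ^ (n - 1) * (-1) ^ n = -1"
    using n by (cases n) (simp_all flip: power_mult_distrib)
  ultimately show ?thesis by (simp add: mult.assoc[symmetric])
qed

lemma zvec_relation:
  assumes n: "n \<ge> 1"
  shows "(\<Sum>s<n. (-1) ^ s * sig (n - Suc s) * zvec n c n s j) = (if j = n then 1 else 0)"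
proof -
  \<comment> \<open>The value at m = n is dictated by the recursion at m = k = n - 1; multiplied by
    S_n = c^(0)_n it becomes the unit vector of the claim.\<close>
  define y where "y k m = (if m < n then zvec n c k (n - Suc m) j
      else (if j = n then 1 else 0) / cv c 0 n)" for k m
  have rec: "C_mon n c (int (Suc m)) (Suc k) * y (Suc k) (Suc m) = y (Suc k) m - y k m"
    if "m \<le> k" "k < n" for k m
  proof -
    have m: "m < n" "Suc (n - Suc m) = n - m" using that by auto
    show ?thesis
    proof (cases "Suc m < n")
      case True
      then have s: "n - Suc m = Suc (n - Suc (Suc m))" by simp
      have "y (Suc k) m - y k m = D_ops n c (n - Suc m) (\<lambda>j. if j = Suc k then 1 else 0) j / cv c (n - m) k"
        unfolding y_def using m zvec_Suc[of k "n - Suc m" j] by simp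
      also have "D_ops n c (n - Suc m) (\<lambda>j. if j = Suc k then 1 else 0) j =
          c (n - Suc m) (Suc k) * zvec n c (Suc k) (n - Suc (Suc m)) j"
        unfolding s using that by (intro D_ops_delta) auto
      finally show ?thesis
        unfolding C_mon_cv[OF m(1)] using True by (simp add: y_def cv_def)
    next
      case False
      then have mk: "m = n - 1" "k = n - 1" "Suc k = n" "Suc m = n" "n - m = 1" using that by auto
      have "y (Suc k) m - y k m = (if j = n then 1 else 0) / cv c 1 k"
        unfolding y_def using m(1) zvec_Suc[of k 0 j] mk(3,4) by simp
      moreover have "C_mon n c (int (Suc m)) (Suc k) * y (Suc k) (Suc m) = (if j = n then 1 else 0) / cv c 1 k"
        unfolding C_mon_cv[OF m(1)] unfolding mk(3-5) y_def using cv_nz[of 0 n] by simp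
      ultimately show ?thesis by simp
    qed
  qed
  have z0: "D_ops n c s (omega c r 0) = (\<lambda>_. 0)" for s r
  proof -
    have "omega c r 0 = (\<lambda>_. 0)" by (auto simp: fun_eq_iff omega_def)
    then show ?thesis by (simp add: D_ops_zero)
  qed
  have "(\<Sum>m\<le>n. (-1) ^ m * sig m * y n m) = 0"
    by (rule wt_sum_alternating[where K = n]) (use rec n z0 in \<open>auto simp: y_def zvec_def\<close>)
  then have "(-1) ^ n * sig n * y n n + (\<Sum>m<n. (-1) ^ m * (sig m * y n m)) = 0"
    by (simp add: lessThan_Suc_atMost[symmetric] mult.assoc add.commute)
  moreover have "(-1) ^ n * sig n * y n n = (-1) ^ n * (if j = n then 1 else 0)"
    unfolding y_def sig_top using cv_nz[of 0 n] by simp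
  moreover have "(\<Sum>m<n. (-1) ^ m * (sig m * y n m)) =
     (-1) ^ (n - 1) * (\<Sum>s<n. (-1) ^ s * (sig (n - Suc s) * y n (n - Suc s)))"
    by (rule sum_reverse)
  moreover have "(\<Sum>s<n. (-1) ^ s * (sig (n - Suc s) * y n (n - Suc s))) =
      (\<Sum>s<n. (-1) ^ s * sig (n - Suc s) * zvec n c n s j)"
    using n by (intro sum.cong refl) (simp add: y_def Suc_diff_Suc)
  moreover have "(-1 :: complex) ^ n = - ((-1) ^ (n - 1))" using n by (cases n) auto
  ultimately have "(-1) ^ (n - 1) * ((\<Sum>s<n. (-1) ^ s * sig (n - Suc s) * zvec n c n s j) - (if j = n then 1 else 0)) = 0"
    by (simp add: algebra_simps)
  then show ?thesis by simp
qed

text \<open>The symplectic form pairs the rows \<open>k\<close> with the rows \<open>k\<close>-bar.\<close>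

lemma D_op_pairing:
  assumes q: "q < n" and r: "r < n"
  shows "(\<Sum>k = 1..n. (-1) ^ k * top_row n c q k r * D_op n c (Suc r) v k) =
         (\<Sum>k = 1..n. (-1) ^ k * top_row n c q k (Suc r) * v k)"
proof -
  let ?T = "\<lambda>k. \<Sum>j = k..n. c (Suc r) j * v j"
  let ?A = "\<lambda>k. (-1) ^ k * top_row n c q k (Suc r) * ?T k / cv c (Suc r) k"
  let ?B = "\<lambda>k. (-1) ^ k * top_row n c q k (Suc r) * ?T (Suc k) / cv c (Suc r) k"
  have "(\<Sum>k = 1..n. (-1) ^ k * top_row n c q k r * D_op n c (Suc r) v k) = (\<Sum>k = 1..n. ?A k - ?B (k - 1))"
  proof (intro sum.cong refl)
    fix k assume k: "k \<in> {1..n}"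
    then obtain k' where k': "k = Suc k'" by (cases k) auto
    show "(-1) ^ k * top_row n c q k r * D_op n c (Suc r) v k = ?A k - ?B (k - 1)"
    proof -
      have alg: "e * (u + a / d * w) * (t / a) = e * w * t / d - (- e) * u * t / a"
        if "a \<noteq> 0" "d \<noteq> 0" for e u a d w t :: complex
        using that by (simp add: field_simps)
      have "top_row n c q k r = top_row n c q k' (Suc r) + cv c (Suc r) k' / cv c (Suc r) k * top_row n c q k (Suc r)"
        using top_row_rec[OF q, of k r] k r by (simp add: k' cv_def)
      moreover have "D_op n c (Suc r) v k = ?T k / cv c (Suc r) k'" using k by (simp add: D_op_def k')
      ultimately show ?thesis
        using alg[OF cv_nz cv_nz, of "(-1) ^ k"] by (simp add: k')
    qed
  qed
  also have "\<dots> = (\<Sum>k = 1..n. ?A k) - (\<Sum>k = 1..n. ?B (k - 1))" by (rule sum_subtractf)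
  \<comment> \<open>Summation by parts without boundary terms: B vanishes at 0 with the row 0, and
    at n because its tail sum is empty.\<close>
  also have "(\<Sum>k = 1..n. ?B (k - 1)) = (\<Sum>k<n. ?B k)"
    by (rule sum.reindex_bij_witness[of _ Suc "\<lambda>k. k - 1"]) auto
  also have "\<dots> = (\<Sum>k\<le>n. ?B k)" by (simp add: lessThan_Suc_atMost[symmetric])
  also have "\<dots> = (\<Sum>k = 1..n. ?B k)"
    by (intro sum.mono_neutral_right) (auto simp: top_row_def)
  also have "(\<Sum>k = 1..n. ?A k) - \<dots> = (\<Sum>k = 1..n. (-1) ^ k * top_row n c q k (Suc r) * v k)"
    unfolding sum_subtractf[symmetric]
  proof (intro sum.cong refl)
    fix k assume k: "k \<in> {1..n}"
    then have "?T k = c (Suc r) k * v k + ?T (Suc k)" by (simp add: sum.atLeast_Suc_atMost)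
    then show "?A k - ?B k = (-1) ^ k * top_row n c q k (Suc r) * v k"
      using k nz[of "Suc r" k] by (simp add: cv_def field_simps)
  qed
  finally show ?thesis .
qed

text \<open>c^(s+1)_n z_s is D_1 ... D_(s+1) applied to the last unit vector.
  \<open>D_op_pairing\<close> moves these s + 1 operators onto the unbarred rows, where the unit
  vector selects the row n.\<close>

lemma zvec_pairing:
  assumes q: "q < n" and s: "s < n"
  shows "(\<Sum>k = 1..n. (-1) ^ k * top_row n c q k 0 * zvec n c n s k) = (-1) ^ n * top_row n c q n (Suc s) / c (Suc s) n"
proof -
  have D: "(\<Sum>k = 1..n. (-1) ^ k * top_row n c q k 0 * D_ops n c t v k) =
         (\<Sum>k = 1..n. (-1) ^ k * top_row n c q k t * v k)" if "t \<le> n" for t v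
    using that
  proof (induction t arbitrary: v)
    case (Suc t)
    then show ?case using D_op_pairing[OF q, of t v] by simp
  qed simp
  have "c (Suc s) n * zvec n c n s k = D_ops n c (Suc s) (\<lambda>j. if j = n then 1 else 0) k" for k
    using D_ops_delta[of n s k] q by simp
  then have "c (Suc s) n * (\<Sum>k = 1..n. (-1) ^ k * top_row n c q k 0 * zvec n c n s k) =
      (\<Sum>k = 1..n. (-1) ^ k * top_row n c q k 0 * D_ops n c (Suc s) (\<lambda>j. if j = n then 1 else 0) k)"
    unfolding sum_distrib_left by (intro sum.cong refl) (metis mult.left_commute)
  also have "\<dots> = (\<Sum>k = 1..n. (-1) ^ k * top_row n c q k (Suc s) * (if k = n then 1 else 0))"
    using s by (intro D) simp
  also have "\<dots> = (\<Sum>k\<in>{1..n}. if k = n then (-1) ^ k * top_row n c q k (Suc s) else 0)"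
    by (intro sum.cong) auto
  also have "\<dots> = (-1) ^ n * top_row n c q n (Suc s)" using q by simp
  finally show ?thesis using nz[of "Suc s" n] by (simp add: field_simps)
qed

section \<open>Determinants of the matrices built from the rows and from the z\<close>

definition top_mat :: "complex mat" where
  "top_mat = mat n n (\<lambda>(a, q). top_row n c q (Suc a) 0)"

definition last_mat :: "complex mat" where
  "last_mat = mat n n (\<lambda>(s, q). top_row n c q n (Suc s))"

definition z_mat :: "complex mat" where
  "z_mat = mat n n (\<lambda>(a, s). zvec n c n s (Suc a))"

lemma det_top_mat: "det top_mat = (\<Prod>s<n. 1 / c (Suc s) n)"
proof (cases "n = 0")
  case False
  have tel: "(\<Prod>a<k. cv c t a / cv c t (Suc a)) = 1 / cv c t k" for t k
  proof (induction k)
    case 0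
    show ?case by (simp add: cv_def)
  qed simp
  have "det top_mat = prod_list (diag_mat top_mat)"
    by (rule det_lower_triangular[of n]) (auto simp: top_mat_def top_row_lower(1))
  also have "\<dots> = (\<Prod>a<n. top_row n c a (Suc a) 0)"
    by (simp add: prod_list_diag_prod top_mat_def atLeast0LessThan)
  also have "\<dots> = (\<Prod>a<n. \<Prod>t = 1..n. cv c t a / cv c t (Suc a))"
    by (intro prod.cong refl) (use top_row_lower(2) in simp)
  also have "\<dots> = (\<Prod>t = 1..n. 1 / cv c t n)" by (subst prod.swap) (simp only: tel)
  also have "\<dots> = (\<Prod>s<n. 1 / c (Suc s) n)"
    by (rule prod.reindex_bij_witness[of _ Suc "\<lambda>t. t - 1"]) (use False in \<open>auto simp: cv_def\<close>)
  finally show ?thesis .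
next
  case True
  have "top_mat \<in> carrier_mat n n" by (simp add: top_mat_def)
  then show ?thesis using True by simp
qed

lemma last_mat_upper:
  assumes "s < n" "q < n"
  shows "q < s \<Longrightarrow> top_row n c q n (Suc s) = 0" "top_row n c s n (Suc s) = 1"
proof -
  have "n - (n - Suc s) = Suc s" using assms by simp
  then show "q < s \<Longrightarrow> top_row n c q n (Suc s) = 0" "top_row n c s n (Suc s) = 1"
    using top_row_upper(1)[of q "n - Suc s" n] top_row_upper(2)[of s "n - Suc s" n] assms by auto
qed

lemma det_last_mat: "det last_mat = 1"
proof -
  have "det last_mat = prod_list (diag_mat last_mat)"
    by (rule det_upper_triangular[of _ n]) (auto simp: upper_triangular_def last_mat_def last_mat_upper)
  also have "\<dots> = 1"
    by (simp add: prod_list_diag_prod last_mat_def last_mat_upper)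
  finally show ?thesis .
qed

text \<open>\<open>zvec_pairing\<close> in matrix form is A^T J Z = R, with A the unbarred block of
  \<Theta>, J diagonal with signs, and R the transpose of Q with column s divided by c^(s+1)_n. A
  and R are triangular with the same nonzero determinant, which cancels.\<close>

lemma det_z_mat: "(\<Prod>a<n. (-1) ^ a) * det z_mat = 1"
proof -
  define J where "J = mat n n (\<lambda>(a, b). if a = b then (-1 :: complex) ^ (n - Suc a) else 0)"
  define R where "R = mat n n (\<lambda>(q, s). top_row n c q n (Suc s) / c (Suc s) n)"
  have J: "J \<in> carrier_mat n n" and R: "R \<in> carrier_mat n n" and Z: "z_mat \<in> carrier_mat n n"
    and A: "top_mat \<in> carrier_mat n n"
    by (auto simp: J_def R_def z_mat_def top_mat_def)
  have "det J = prod_list (diag_mat J)"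
    by (rule det_upper_triangular[OF _ J]) (auto simp: upper_triangular_def J_def)
  also have "\<dots> = (\<Prod>a<n. (-1) ^ (n - Suc a))"
    by (simp add: prod_list_diag_prod J_def atLeast0LessThan)
  also have "\<dots> = (\<Prod>a<n. (-1) ^ a)" by (rule prod.nat_diff_reindex)
  finally have detJ: "det J = (\<Prod>a<n. (-1) ^ a)" .
  have "det R = prod_list (diag_mat R)"
    by (rule det_lower_triangular[OF _ R]) (auto simp: R_def last_mat_upper)
  also have "\<dots> = (\<Prod>s<n. 1 / c (Suc s) n)"
    by (simp add: prod_list_diag_prod R_def atLeast0LessThan last_mat_upper)
  finally have detR: "det R = det top_mat" by (simp add: det_top_mat)
  have JZ: "(J * z_mat) $$ (a, s) = (-1) ^ (n - Suc a) * zvec n c n s (Suc a)" if "a < n" "s < n" for a s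
  proof -
    have "(J * z_mat) $$ (a, s) = (\<Sum>b<n. J $$ (a, b) * z_mat $$ (b, s))"
      using that J Z by (simp add: scalar_prod_def atLeast0LessThan)
    also have "\<dots> = (\<Sum>b<n. if b = a then (-1) ^ (n - Suc a) * zvec n c n s (Suc b) else 0)"
      using that by (intro sum.cong) (auto simp: J_def z_mat_def)
    finally show ?thesis using that by simp
  qed
  have "transpose_mat top_mat * (J * z_mat) = R"
  proof (rule eq_matI)
    fix q s assume "q < dim_row R" "s < dim_col R"
    then have qs: "q < n" "s < n" by (auto simp: R_def)
    have "(transpose_mat top_mat * (J * z_mat)) $$ (q, s) =
        (\<Sum>a<n. top_row n c q (Suc a) 0 * ((-1) ^ (n - Suc a) * zvec n c n s (Suc a)))"
    proof -
      have "(transpose_mat top_mat * (J * z_mat)) $$ (q, s) =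
          (\<Sum>a<n. transpose_mat top_mat $$ (q, a) * (J * z_mat) $$ (a, s))"
        using qs A J Z by (simp add: scalar_prod_def atLeast0LessThan)
      also have "\<dots> = (\<Sum>a<n. top_row n c q (Suc a) 0 * ((-1) ^ (n - Suc a) * zvec n c n s (Suc a)))"
        using qs JZ by (intro sum.cong refl) (simp add: top_mat_def del: index_mult_mat)
      finally show ?thesis .
    qed
    also have "\<dots> = (-1) ^ n * (\<Sum>k = 1..n. (-1) ^ k * top_row n c q k 0 * zvec n c n s k)"
      unfolding sum_distrib_left
    proof (rule sum.reindex_bij_witness[of _ "\<lambda>k. k - 1" Suc])
      fix a assume a: "a \<in> {..<n}"
      then have "n + Suc a = (n - Suc a) + 2 * Suc a" by simp
      then have "(-1 :: complex) ^ n * (-1) ^ Suc a = (-1) ^ (n - Suc a)"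
        by (metis (no_types) minus_one_power_iff even_add even_mult_iff power_add even_numeral)
      then show "(-1) ^ n * ((-1) ^ Suc a * top_row n c q (Suc a) 0 * zvec n c n s (Suc a)) =
          top_row n c q (Suc a) 0 * ((-1) ^ (n - Suc a) * zvec n c n s (Suc a))"
        by (simp add: mult.assoc[symmetric] del: power_Suc)
    qed auto
    also have "\<dots> = top_row n c q n (Suc s) / c (Suc s) n"
      unfolding zvec_pairing[OF qs] by (simp add: mult.assoc[symmetric] flip: power_mult_distrib)
    finally show "(transpose_mat top_mat * (J * z_mat)) $$ (q, s) = R $$ (q, s)"
      using qs by (simp add: R_def)
  qed (use A J Z in \<open>auto simp: R_def\<close>)
  then have "det R = det (transpose_mat top_mat) * (det J * det z_mat)"
    using det_mult[of "transpose_mat top_mat" n "J * z_mat"] det_mult[OF J Z] A J Z by simp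
  then have "det top_mat * (det J * det z_mat) = det top_mat * 1"
    using detR det_transpose[OF A] by simp
  moreover have "det top_mat \<noteq> 0" using nz by (simp add: det_top_mat)
  ultimately show ?thesis using detJ by simp
qed

lemma det_Theta_rows:
  assumes n: "n \<ge> 1"
  shows "(\<Prod>a<n. (-1) ^ a) *
     det (mat n n (\<lambda>(a, q). Theta_minus n c $$ (if a = n - 1 then n - 1 else 2 * n - 1 - a, q)))
     = (\<Sum>m<n. (sig m)\<^sup>2 / cval c (int n - int m) n)"
proof -
  \<comment> \<open>The coefficients of the rows of the minor with respect to Q: the last row from
    \<open>top_row_relation\<close>, the others from \<open>bot_row_expansion\<close>.\<close>
  define P where "P = mat n n (\<lambda>(a, s). if a = n - 1 then (-1) ^ s * sig (n - Suc s) / c (Suc s) n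
      else zvec n c n s (Suc a))"
  \<comment> \<open>The coefficients in \<open>zvec_relation\<close>, so Z x is the last unit
    vector. The last row of P has the entries x_s / c^(s+1)_n, so its product with x is the desired
    sum of squares.\<close>
  define x where "x = vec n (\<lambda>s. (-1) ^ s * sig (n - Suc s))"
  define S where "S = (\<Sum>s<n. (sig (n - Suc s))\<^sup>2 / c (Suc s) n)"
  have P: "P \<in> carrier_mat n n" and Q: "last_mat \<in> carrier_mat n n" and Z: "z_mat \<in> carrier_mat n n"
    by (auto simp: P_def last_mat_def z_mat_def)
  have "mat n n (\<lambda>(a, q). Theta_minus n c $$ (if a = n - 1 then n - 1 else 2 * n - 1 - a, q)) = P * last_mat"
  proof (rule eq_matI)
    fix a q assume "a < dim_row (P * last_mat)" "q < dim_col (P * last_mat)"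
    then have aq: "a < n" "q < n" using P Q by auto
    have "(P * last_mat) $$ (a, q) = (\<Sum>s<n. P $$ (a, s) * top_row n c q n (Suc s))"
      using aq P by (simp add: scalar_prod_def atLeast0LessThan last_mat_def)
    also have "\<dots> = Theta_minus n c $$ (if a = n - 1 then n - 1 else 2 * n - 1 - a, q)"
    proof (cases "a = n - 1")
      case True
      have "(\<Sum>s<n. P $$ (a, s) * top_row n c q n (Suc s)) = top_row n c q n 0"
        unfolding top_row_relation[OF aq(2)] using aq True by (intro sum.cong) (auto simp: P_def)
      then show ?thesis using True n by (simp add: top_row_def Theta_minus_tail)
    next
      case False
      have "(\<Sum>s<n. P $$ (a, s) * top_row n c q n (Suc s)) = bot_row n c q 0 (Suc a)"
        unfolding bot_row_expansion[OF aq(2)] using aq False by (intro sum.cong) (auto simp: P_def)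
      then show ?thesis using False aq by (simp add: bot_row_def Theta_minus_tail)
    qed
    finally show "mat n n (\<lambda>(a, q). Theta_minus n c $$ (if a = n - 1 then n - 1 else 2 * n - 1 - a, q)) $$ (a, q)
        = (P * last_mat) $$ (a, q)" using aq by simp
  qed (use P Q in auto)
  then have "det (mat n n (\<lambda>(a, q). Theta_minus n c $$ (if a = n - 1 then n - 1 else 2 * n - 1 - a, q))) = det P"
    using det_mult[OF P Q] det_last_mat by simp
  also have "det P = S * det z_mat"
  proof (rule det_replace_last_row[OF P Z n])
    show "P $$ (a, s) = z_mat $$ (a, s)" if "a < n - 1" "s < n" for a s
      using that by (simp add: P_def z_mat_def)
    show "x \<in> carrier_vec n" by (simp add: x_def)
    \<comment> \<open>This entry is +-S_0 = +-1.\<close>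
    show "x $ (n - 1) \<noteq> 0" using n by (simp add: x_def)
    have Zx: "(z_mat *\<^sub>v x) $ a = (if a = n - 1 then 1 else 0)" if "a < n" for a
    proof -
      have "(z_mat *\<^sub>v x) $ a = (\<Sum>s<n. (-1) ^ s * sig (n - Suc s) * zvec n c n s (Suc a))"
        using that by (simp add: z_mat_def x_def scalar_prod_def atLeast0LessThan mult.commute)
      then show ?thesis unfolding zvec_relation[OF n] using that by auto
    qed
    then show "(z_mat *\<^sub>v x) $ a = (if a = n - 1 then 1 else 0)" if "a < n" for a
      using that by blast
    show "(P *\<^sub>v x) $ a = (if a = n - 1 then S else 0)" if a: "a < n" for a
    proof (cases "a = n - 1")
      case True
      have "(P *\<^sub>v x) $ a = (\<Sum>s<n. ((-1) ^ s * (-1) ^ s) * ((sig (n - Suc s))\<^sup>2 / c (Suc s) n))"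
        using a True by (simp add: P_def x_def scalar_prod_def atLeast0LessThan power2_eq_square mult_ac)
      then show ?thesis using True by (simp add: S_def flip: power_mult_distrib)
    next
      case False
      have "(P *\<^sub>v x) $ a = (z_mat *\<^sub>v x) $ a"
        using a False by (simp add: P_def z_mat_def x_def scalar_prod_def)
      then show ?thesis using Zx[OF a] False by simp
    qed
  qed
  also have "(\<Prod>a<n. (-1) ^ a) * (S * det z_mat) = S"
    using det_z_mat by (metis mult.left_commute mult.right_neutral)
  also have "S = (\<Sum>s<n. (sig (n - Suc s))\<^sup>2 / cval c (int n - int (n - Suc s)) n)"
    unfolding S_def
  proof (intro sum.cong refl)
    fix s assume "s \<in> {..<n}"
    then have "int n - int (n - Suc s) = int (Suc s)" by auto
    then show "(sig (n - Suc s))\<^sup>2 / c (Suc s) n = (sig (n - Suc s))\<^sup>2 / cval c (int n - int (n - Suc s)) n"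
      using n by (simp only: cval_cv) (simp add: cv_def)
  qed
  also have "\<dots> = (\<Sum>m<n. (sig m)\<^sup>2 / cval c (int n - int m) n)"
    by (rule sum.nat_diff_reindex)
  finally show ?thesis .
qed

end

section \<open>The theorem\<close>

lemma Theta_minus_words:
  assumes "\<forall>m \<in> {1..n}. \<forall>i \<in> {1..n}. c m i \<noteq> 0" shows "Theta_minus n c \<in> Sp_words n"
proof -
  have "ybold n i (c m i) \<in> Sp_words n" if "m \<in> {1..n}" "i \<in> {1..n}" for m i
  proof -
    have "1 \<le> i" "i \<le> n" "inverse (c m i) \<noteq> 0" using that assms by auto
    then have "y_sub n i (c m i) \<in> Sp_gens n" "coroot n i (inverse (c m i)) \<in> Sp_gens n"
      unfolding Sp_gens_def by blast+
    then show ?thesis unfolding ybold_def by (intro Sp_words_mult Sp_words_gen)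
  qed
  then show ?thesis
    unfolding Theta_minus_def
    by (intro Sp_words_mprod) (auto simp: atLeastLessThanSuc_atLeastAtMost simp del: upt_Suc)
qed

lemma Theta_minus_cong:
  assumes "\<And>m i. m \<in> {1..n} \<Longrightarrow> i \<in> {1..n} \<Longrightarrow> c m i = c' m i"
  shows "Theta_minus n c = Theta_minus n c'"
proof -
  have "map (\<lambda>m. map (\<lambda>i. ybold n i (c m i)) [1..<Suc n]) [1..<Suc n] =
        map (\<lambda>m. map (\<lambda>i. ybold n i (c' m i)) [1..<Suc n]) [1..<Suc n]"
    using assms by (intro map_cong refl) auto
  then show ?thesis unfolding Theta_minus_def by (rule arg_cong)
qed

text \<open>Fewer than n unbarred entries keep the superscripts n - a and n - a + 1 between 1 and n,
  and b \<le> l_b \<le> n does the same for n - l_b + b. Hence no value of c outside the square is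
  read.\<close>

lemma mon0_cong:
  assumes eq: "\<And>m i. m \<in> {1..n} \<Longrightarrow> i \<in> {1..n} \<Longrightarrow> c m i = c' m i"
    and v: "(us, ls) \<in> calB n" "(us, ls) \<noteq> hw_seq n"
  shows "mon0 n c (us, ls) = mon0 n c' (us, ls)"
proof -
  have cval: "cval c r i = cval c' r i" if "1 \<le> r" "r \<le> int n" "i \<le> n" for r i
  proof -
    have "nat r \<in> {1..n}" using that by auto
    then show ?thesis using eq[of "nat r" i] that by (simp add: cval_def)
  qed
  have "ls \<noteq> []" using v calB_Nil by blast
  then have len: "length us < n" using v(1) by (cases ls) (auto simp: calB_def)
  have us: "us ! (a - 1) \<in> {1..n}" if "a \<in> {1..length us}" for a
  proof -
    have "us ! (a - 1) \<in> set us" using that by (intro nth_mem) auto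
    then show ?thesis using v(1) by (auto simp: calB_def)
  qed
  have ls: "ls ! (b - 1) \<in> {1..n}" if "b \<in> {1..length ls}" for b
  proof -
    have "ls ! (b - 1) \<in> set ls" using that by (intro nth_mem) auto
    then show ?thesis using v(1) by (auto simp: calB_def)
  qed
  have "C_mon n c (int a) (us ! (a - 1)) = C_mon n c' (int a) (us ! (a - 1))"
    if a: "a \<in> {1..length us}" for a
    unfolding C_mon_def using us[OF a] a len
    by (intro arg_cong2[where f = "(/)"] cval) auto
  moreover have "Cbar_mon n c (int (ls ! (b - 1)) - int b) (ls ! (b - 1)) =
      Cbar_mon n c' (int (ls ! (b - 1)) - int b) (ls ! (b - 1))" if b: "b \<in> {1..length ls}" for b
    unfolding Cbar_mon_def using ls[OF b] b calB_bounds(3)[OF v(1), of b]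
    by (intro arg_cong2[where f = "(/)"] cval) auto
  ultimately show ?thesis unfolding mon0_def by simp
qed

theorem theorem7p25:
  fixes n :: nat and c :: "nat \<Rightarrow> nat \<Rightarrow> complex" and us vs :: "nat list"
  assumes "n \<ge> 2"
    and "\<forall>m \<in> {1..n}. \<forall>i \<in> {1..n}. c m i \<noteq> 0"
    and "reduced_expression n us (longest_elt n \<circ> simple_refl n n)"
    and "reduced_expression n vs id"
  shows "gen_minor n n us vs (Theta_minus n c) =
    (\<Sum>b \<in> B_Lambda n - {hw_seq n}. of_nat (rect_mult n b) * mon0 n c b)"
proof -
  \<comment> \<open>Outside \<open>{1..n}\<close> the value of \<open>c\<close> matters only for \<open>hw_seq n\<close>; making it nonzero avoids division by zero.\<close>
  define c' where "c' m i = (if m \<in> {1..n} \<and> i \<in> {1..n} then c m i else 1)" for m i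
  have nz: "c' m i \<noteq> 0" for m i using assms(2) by (simp add: c'_def)
  have eq: "c m i = c' m i" if "m \<in> {1..n}" "i \<in> {1..n}" for m i using that by (simp add: c'_def)
  have n: "1 \<le> n" using assms(1) by simp
  have "gen_minor n n us vs (Theta_minus n c) = gen_minor n n us vs (Theta_minus n c')"
    using Theta_minus_cong[OF eq] by simp
  also have "\<dots> = (\<Prod>a<n. (-1) ^ a) *
      det (mat n n (\<lambda>(a, q). Theta_minus n c' $$ (if a = n - 1 then n - 1 else 2 * n - 1 - a, q)))"
    using nz by (intro gen_minor_rows assms Theta_minus_words) auto
  also have "\<dots> = (\<Sum>m<n. (wt_sum (\<lambda>a i. C_mon n c' (int a) i) n m)\<^sup>2 / cval c' (int n - int m) n)"
    by (rule det_Theta_rows[OF nz n])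
  also have "\<dots> = (\<Sum>v \<in> calB n - {hw_seq n}. mon0 n c' v)"
    by (rule sum_calB[OF nz, symmetric])
  also have "\<dots> = (\<Sum>b \<in> B_Lambda n - {hw_seq n}. of_nat (rect_mult n b) * mon0 n c' b)"
    by (rule sum_rect_mult[OF nz, symmetric])
  also have "\<dots> = (\<Sum>b \<in> B_Lambda n - {hw_seq n}. of_nat (rect_mult n b) * mon0 n c b)"
  proof (intro sum.cong refl arg_cong2[where f = "(*)"])
    fix b assume b: "b \<in> B_Lambda n - {hw_seq n}"
    obtain us ls where e: "b = (us, ls)" by (cases b)
    have "(us, ls) \<in> calB n" "(us, ls) \<noteq> hw_seq n"
      using b B_Lambda_subset[of n] unfolding e by blast+
    then show "mon0 n c' b = mon0 n c b"
      using mon0_cong[of n c c' us ls, OF eq] unfolding e by simp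
  qed
  finally show ?thesis .
qed

end
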